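(* Let $G$ be a second countable locally compact group endowed with a (left) Haar measure $\lambda$. Then the following conditions on a measure class preserving action of $G$ on a measure space $(X,\varkappa)$ are equivalent: (i) the action is amenable; (ii) there exists a measurable map $\boldsymbol{\theta}:X\to\mathcal{P}_\lambda(G)$, $x\mapsto\theta^x$, such that, for $\varkappa$-almost every $x\in X$, the tail boundary of the random walk on $G$ in the associated environment $\operatorname{env}_{\boldsymbol{\theta}}(x)=\{\mu^g\}_{g\in G}$, $\mu^g=\theta^{g^{-1}x}$, is $\mathsf{P}_\lambda$-(mod 0) trivial; (iii) there exists a measurable map $\boldsymbol{\theta}:X\to\mathcal{P}_\lambda(G)$, $x\mapsto\theta^x$, such that, for $\varkappa$-almost every $x\in X$, the random walk on $G$ in the associated environment $\operatorname{env}_{\boldsymbol{\theta}}(x)=\{\mu^g\}_{g\in G}$, $\mu^g=\theta^{g^{-1}x}$, is Liouville.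
   Context: All measure spaces are Lebesgue–Rokhlin spaces and all measures are finite or $\sigma$-finite. The action of $G$ on $X$ is a (measurable) left action, and it is measure class preserving, i.e. $\varkappa$ is quasi-invariant. $\mathcal{P}_\lambda(G)$ is the space of probability measures on $G$ absolutely continuous with respect to $\lambda$; a map $x\mapsto\theta^x$ into it is measurable if $x\mapsto\int f\,d\theta^x$ is measurable for every non-negative measurable $f$ on $G$. For a measure $\theta$ on $G$, $g\theta$ is its image under left multiplication by $g$, and $\|\cdot\|$ is the total variation norm. Amenability of the action: there is a sequence of measurable maps $x\mapsto\theta_n^x$ from $X$ to $\mathcal{P}_\lambda(G)$ such that the functions $(g,x)\mapsto\|g\,\theta_n^{g^{-1}x}-\theta_n^x\|$ on $G\times X$ converge to $0$ in the weak$^*$ topology $\sigma(L^\infty,L^1)$ of $L^\infty(G\times X,\lambda\otimes\varkappa)$. Random walk in an environment: an environment on $G$ is a family $\{\mu^g\}_{g\in G}$ of probability measures on $G$. The random walk on $G$ in this environment is the Markov chain on $G$ with the transition probabilities $\pi^g=g\mu^g$, i.e. from $g$ the chain moves to $gh$, where $h$ has distribution $\mu^g$. Boundaries: for a Markov chain on $G$, let $\mathsf{P}_\lambda$ be the ($\sigma$-finite) measure on the path space $G^{\mathbb{Z}_+}$ corresponding to the initial measure $\lambda$. The tail $\sigma$-algebra is the ($\mathsf{P}_\lambda$-completed) $\sigma$-algebra $\bigcap_n\sigma(\omega_n,\omega_{n+1},\dots)$ of paths $(\omega_0,\omega_1,\dots)$; the exit $\sigma$-algebra is its subalgebra of time shift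 invariant events. The tail boundary (resp. Poisson boundary) is the quotient of the path space determined by the tail (resp. exit) $\sigma$-algebra; it is trivial $\mathsf{P}_\lambda$-(mod 0) if every event of this $\sigma$-algebra is $\mathsf{P}_\lambda$-negligible or has $\mathsf{P}_\lambda$-negligible complement. The chain is Liouville if its Poisson boundary is $\mathsf{P}_\lambda$-(mod 0) trivial (equivalently, it has no non-constant bounded harmonic functions, mod 0). *)

theory Defs
  imports "HOL-Probability.Probability"
begin

text \<open>
  Groups are written additively, following the library class \<open>topological_group_add\<close>, which does
  not assume commutativity: \<open>g + h\<close> is the product, \<open>- g\<close> the inverse and \<open>0\<close> the identity.
\<close>

section \<open>Groups, measure spaces and actions\<close>

text \<open>
  On a second countable locally compact group, a Borel measure that is finite on compact sets is
  automatically regular, so regularity is not listed.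
\<close>

definition left_haar_measure ::
    "'g::{topological_group_add, second_countable_topology, t2_space} measure \<Rightarrow> bool" where
  "left_haar_measure \<mu> \<longleftrightarrow>
     sets \<mu> = sets borel \<and>
     emeasure \<mu> UNIV \<noteq> 0 \<and>
     (\<forall>K. compact K \<longrightarrow> emeasure \<mu> K < \<infinity>) \<and>
     (\<forall>g. distr \<mu> borel (\<lambda>h. g + h) = \<mu>)"

definition isomorphic_mod0 :: "'a measure \<Rightarrow> 'b measure \<Rightarrow> bool" where
  "isomorphic_mod0 M N \<longleftrightarrow>
     (\<exists>A\<in>null_sets M. \<exists>B\<in>null_sets N. \<exists>f f'.
        let M' = restrict_space M (space M - A); N' = restrict_space N (space N - B) in
        f \<in> measurable M' N' \<and> f' \<in> measurable N' M' \<and>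
        (\<forall>x\<in>space M'. f' (f x) = x) \<and> (\<forall>y\<in>space N'. f (f' y) = y) \<and>
        distr M' N' f = N')"

text \<open>
  A Lebesgue--Rokhlin space is a complete measure space isomorphic (mod 0) to a completed Borel
  measure on the line, i.e. to an interval together with at most countably many atoms.
\<close>

definition lebesgue_rokhlin_space :: "'a measure \<Rightarrow> bool" where
  "lebesgue_rokhlin_space M \<longleftrightarrow>
     complete_measure M \<and> sigma_finite_measure M \<and>
     (\<exists>\<nu> :: real measure. sets \<nu> = sets borel \<and> sigma_finite_measure \<nu> \<and>
        isomorphic_mod0 M (completion \<nu>))"

text \<open>
  Since \<open>\<kappa>\<close> is complete, joint measurability of the action has to be taken with respect to the
  completed product: the preimage of a \<open>\<kappa>\<close>-null set need not lie in the product
  \<open>\<sigma>\<close>-algebra itself.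
\<close>

definition measure_class_preserving_action ::
    "'g::group_add measure \<Rightarrow> 'x measure \<Rightarrow> ('g \<Rightarrow> 'x \<Rightarrow> 'x) \<Rightarrow> bool" where
  "measure_class_preserving_action \<mu> \<kappa> act \<longleftrightarrow>
     (\<forall>x\<in>space \<kappa>. act 0 x = x) \<and>
     (\<forall>g h. \<forall>x\<in>space \<kappa>. act (g + h) x = act g (act h x)) \<and>
     (\<lambda>(g, x). act g x) \<in> measurable (completion (\<mu> \<Otimes>\<^sub>M \<kappa>)) \<kappa> \<and>
     (\<forall>g. act g \<in> measurable \<kappa> \<kappa>) \<and>
     (\<forall>g. null_sets (distr \<kappa> \<kappa> (act g)) = null_sets \<kappa>)"

definition ac_prob_measures :: "'g::topological_space measure \<Rightarrow> 'g measure set" where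
  "ac_prob_measures \<mu> =
     {\<theta>. prob_space \<theta> \<and> sets \<theta> = sets borel \<and> absolutely_continuous \<mu> \<theta>}"

definition measurable_ac_prob_map ::
    "'g::topological_space measure \<Rightarrow> 'x measure \<Rightarrow> ('x \<Rightarrow> 'g measure) \<Rightarrow> bool" where
  "measurable_ac_prob_map \<mu> \<kappa> \<theta> \<longleftrightarrow>
     (\<forall>x\<in>space \<kappa>. \<theta> x \<in> ac_prob_measures \<mu>) \<and>
     (\<forall>f :: 'g \<Rightarrow> ennreal. f \<in> borel_measurable borel \<longrightarrow>
        (\<lambda>x. \<integral>\<^sup>+ g. f g \<partial>\<theta> x) \<in> borel_measurable \<kappa>)"

definition translate_measure ::
    "'g::topological_group_add \<Rightarrow> 'g measure \<Rightarrow> 'g measure" where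
  "translate_measure g \<theta> = distr \<theta> borel (\<lambda>h. g + h)"

section \<open>Amenability\<close>

text \<open>
  The total variation norm of the signed measure \<open>\<mu> - \<nu>\<close>, for finite measures \<open>\<mu>\<close> and \<open>\<nu>\<close> on
  the same \<open>\<sigma>\<close>-algebra.
\<close>

definition total_variation_diff :: "'a measure \<Rightarrow> 'a measure \<Rightarrow> real" where
  "total_variation_diff \<mu> \<nu> =
     (SUP \<A>\<in>{\<A>. finite \<A> \<and> \<A> \<subseteq> sets \<mu> \<and> disjoint \<A>}.
        \<Sum>A\<in>\<A>. \<bar>measure \<mu> A - measure \<nu> A\<bar>)"

definition essentially_bounded :: "'a measure \<Rightarrow> ('a \<Rightarrow> real) \<Rightarrow> bool" where
  "essentially_bounded M f \<longleftrightarrow> f \<in> borel_measurable M \<and> (\<exists>C. AE x in M. \<bar>f x\<bar> \<le> C)"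

definition weak_star_tendsto :: "'a measure \<Rightarrow> (nat \<Rightarrow> 'a \<Rightarrow> real) \<Rightarrow> ('a \<Rightarrow> real) \<Rightarrow> bool" where
  "weak_star_tendsto M F f \<longleftrightarrow>
     (\<forall>n. essentially_bounded M (F n)) \<and> essentially_bounded M f \<and>
     (\<forall>\<phi> :: 'a \<Rightarrow> real. integrable M \<phi> \<longrightarrow>
        (\<lambda>n. \<integral>z. F n z * \<phi> z \<partial>M) \<longlonglongrightarrow> (\<integral>z. f z * \<phi> z \<partial>M))"

definition amenable_action ::
    "'g::topological_group_add measure \<Rightarrow> 'x measure \<Rightarrow> ('g \<Rightarrow> 'x \<Rightarrow> 'x) \<Rightarrow> bool" where
  "amenable_action \<mu> \<kappa> act \<longleftrightarrow>
     (\<exists>\<theta> :: nat \<Rightarrow> 'x \<Rightarrow> 'g measure.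
        (\<forall>n. measurable_ac_prob_map \<mu> \<kappa> (\<theta> n)) \<and>
        weak_star_tendsto (completion (\<mu> \<Otimes>\<^sub>M \<kappa>))
          (\<lambda>n (g, x). total_variation_diff (translate_measure g (\<theta> n (act (- g) x))) (\<theta> n x))
          (\<lambda>_. 0))"

section \<open>Markov chains and their boundaries\<close>

text \<open>
  The transition probabilities are only required to depend on the starting point in a
  \<open>\<mu>\<close>-measurable way (measurability with respect to the completion), as one obtains by restricting
  a jointly measurable family to almost every section.
\<close>

definition markov_kernel ::
    "'g::topological_space measure \<Rightarrow> ('g \<Rightarrow> 'g measure) \<Rightarrow> bool" where
  "markov_kernel \<mu> \<pi> \<longleftrightarrow>
     (\<forall>g. prob_space (\<pi> g) \<and> sets (\<pi> g) = sets borel) \<and>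
     (\<forall>A\<in>sets borel. (\<lambda>g. emeasure (\<pi> g) A) \<in> borel_measurable (completion \<mu>))"

text \<open>
  \<open>cylinder_prob \<pi> [A\<^sub>1, \<dots>, A\<^sub>n] g\<close> is the probability that the chain started at \<open>g\<close> visits
  \<open>A\<^sub>1, \<dots>, A\<^sub>n\<close> at times \<open>1, \<dots>, n\<close>. Functions that are measurable only for the completion of
  \<open>\<mu>\<close> are harmless here when all \<open>\<pi> g\<close> are absolutely continuous with respect to \<open>\<mu>\<close>, since the
  integral \<open>nn_integral\<close> does not change under completion of the measure.
\<close>

primrec cylinder_prob :: "('g \<Rightarrow> 'g measure) \<Rightarrow> 'g set list \<Rightarrow> 'g \<Rightarrow> ennreal" where
  "cylinder_prob \<pi> [] g = 1"
| "cylinder_prob \<pi> (A # As) g = (\<integral>\<^sup>+ h\<in>A. cylinder_prob \<pi> As h \<partial>\<pi> g)"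

text \<open>
  \<open>P\<close> is the measure on the path space of the Markov chain with transition probabilities \<open>\<pi>\<close> and
  \<open>\<sigma>\<close>-finite initial measure \<open>\<mu>\<close>; it is uniquely determined by its values on cylinders.
\<close>

definition markov_path_measure ::
    "'g::topological_space measure \<Rightarrow> ('g \<Rightarrow> 'g measure) \<Rightarrow> (nat \<Rightarrow> 'g) measure \<Rightarrow> bool" where
  "markov_path_measure \<mu> \<pi> P \<longleftrightarrow>
     markov_kernel \<mu> \<pi> \<and>
     sets P = sets (\<Pi>\<^sub>M n\<in>UNIV. borel) \<and>
     (\<forall>A As. A \<in> sets borel \<longrightarrow> set As \<subseteq> sets borel \<longrightarrow>
        emeasure P {\<omega>. \<omega> 0 \<in> A \<and> (\<forall>i<length As. \<omega> (Suc i) \<in> As ! i)} =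
          (\<integral>\<^sup>+ g\<in>A. cylinder_prob \<pi> As g \<partial>\<mu>))"

definition tail_events :: "(nat \<Rightarrow> 'g::topological_space) measure \<Rightarrow> (nat \<Rightarrow> 'g) set set" where
  "tail_events P =
     {E. \<exists>F \<in> (\<Inter>n. sigma_sets UNIV {{\<omega>. \<omega> k \<in> A} | k A. n \<le> k \<and> A \<in> sets borel}).
        sym_diff E F \<in> null_sets (completion P)}"

definition exit_events :: "(nat \<Rightarrow> 'g::topological_space) measure \<Rightarrow> (nat \<Rightarrow> 'g) set set" where
  "exit_events P = {E \<in> tail_events P. (\<lambda>\<omega> n. \<omega> (Suc n)) -` E = E}"

definition trivial_mod0 :: "'a measure \<Rightarrow> 'a set set \<Rightarrow> bool" where
  "trivial_mod0 P \<E> \<longleftrightarrow>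
     (\<forall>E\<in>\<E>. E \<in> null_sets (completion P) \<or> space P - E \<in> null_sets (completion P))"

definition trivial_tail_boundary ::
    "'g::topological_space measure \<Rightarrow> ('g \<Rightarrow> 'g measure) \<Rightarrow> bool" where
  "trivial_tail_boundary \<mu> \<pi> \<longleftrightarrow>
     (\<exists>P. markov_path_measure \<mu> \<pi> P \<and> trivial_mod0 P (tail_events P))"

definition liouville_chain ::
    "'g::topological_space measure \<Rightarrow> ('g \<Rightarrow> 'g measure) \<Rightarrow> bool" where
  "liouville_chain \<mu> \<pi> \<longleftrightarrow>
     (\<exists>P. markov_path_measure \<mu> \<pi> P \<and> trivial_mod0 P (exit_events P))"

section \<open>Random walks in an environment\<close>

definition environment ::
    "('g::group_add \<Rightarrow> 'x \<Rightarrow> 'x) \<Rightarrow> ('x \<Rightarrow> 'g measure) \<Rightarrow> 'x \<Rightarrow> 'g \<Rightarrow> 'g measure" where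
  "environment act \<theta> x = (\<lambda>g. \<theta> (act (- g) x))"

definition random_walk_transition ::
    "('g::topological_group_add \<Rightarrow> 'g measure) \<Rightarrow> 'g \<Rightarrow> 'g measure" where
  "random_walk_transition env = (\<lambda>g. translate_measure g (env g))"

end

theory Submission
  imports Defs
begin

text \<open>
  (iii) implies (i): the shift on the path space of a Liouville chain is a nonsingular ergodic
  transformation. For such a transformation the averaged images of two absolutely continuous
  probability measures merge in total variation: a weak* cluster point of the almost optimal
  averaged test functions is invariant, hence constant. Therefore the averages over \<open>k \<le> n\<close> of the
  time \<open>k\<close> distributions of the walk started at the identity are asymptotically invariant.

  (i) implies (ii): given an asymptotically invariant sequence \<open>\<theta>\<close> of maps, mix the \<open>\<theta> (s i)\<close> with
  the weights \<open>1 / 2 ^ (i + 1)\<close>, for an \<open>s\<close> growing so fast that a step of type \<open>n\<close> forgets the result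
  of at most \<open>n * 2 ^ n\<close> preceding steps of types less than \<open>n\<close>. In a long word of types the first
  occurrence of the largest type is such a forgetting step, so the time \<open>k\<close> distributions from two
  starting points merge, and the tail boundary is trivial by a zero-one law.

  Maps that are only measurable with respect to a completion are replaced by jointly Borel versions
  off a null set.
\<close>

section \<open>Approximation by a countable algebra\<close>

text \<open>In both directions translation by \<open>g\<close> becomes a change of starting point:
  the image under \<open>g\<close> of the walk in the environment of \<open>act (- g) x\<close> is
  the walk in the environment of \<open>x\<close> started at \<open>g\<close>. Asymptotic invariance
  and boundary triviality thus both compare one chain from two starting points. The exit
  \<sigma>-algebra sees shift invariant events only, and periodicity may keep the time
  \<open>k\<close> laws themselves apart; this is why averages appear in the passage from (iii) to
  (i). Absolute continuity of the steps hides null sets after one step: it makes the shift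
  nonsingular and lets kernels be changed off null sets. The number \<open>n * 2 ^ n\<close> comes
  from \<open>(1 - 1 / 2 ^ n) ^ (n * 2 ^ n) \<le> exp (- n)\<close>: a word of that length rarely
  consists of types below \<open>n\<close> alone. Weak* convergence to 0 yields almost everywhere
  convergence of a subsequence because the functions are nonnegative. The countable algebra below
  serves measurability: total variation is a supremum over uncountably many partitions.\<close>

datatype setexp = Gen nat | Neg setexp | Or setexp setexp

instance setexp :: countable by countable_datatype

text \<open>Finite Boolean combinations are given by syntax because \<open>setexp\<close> is
  countable: suprema and almost everywhere statements over the generated algebra become countable
  ones.\<close>

primrec setexp_val :: "(nat \<Rightarrow> 'a set) \<Rightarrow> setexp \<Rightarrow> 'a set" where
  "setexp_val B (Gen i) = B i"
| "setexp_val B (Neg e) = - setexp_val B e"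
| "setexp_val B (Or d e) = setexp_val B d \<union> setexp_val B e"

lemma setexp_val_UN: "\<exists>e. setexp_val B e = (\<Union>i<n::nat. setexp_val B (f i))"
proof (induction n)
  case 0
  \<comment> \<open>The expression denotes the complement of \<open>B 0 \<union> - B 0\<close>, the
    empty set, for which the syntax has no constant.\<close>
  show ?case by (rule exI[of _ "Neg (Or (Gen 0) (Neg (Gen 0)))"]) auto
next
  case (Suc n)
  then obtain e where "setexp_val B e = (\<Union>i<n. setexp_val B (f i))" by blast
  then have "setexp_val B (Or (f n) e) = (\<Union>i<Suc n. setexp_val B (f i))"
    by (auto simp: lessThan_Suc)
  then show ?case by blast
qed

lemma setexp_val_sets:
  assumes "\<And>i. B i \<in> sets M" "space M = UNIV"
  shows "setexp_val B e \<in> sets M"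
  by (induction e) (use assms sets.compl_sets[of _ M] in \<open>auto simp: Compl_eq_Diff_UNIV\<close>)

text \<open>The sets that the algebra approximates in measure are closed under complements and
  countable unions, so they exhaust the generated \<sigma>-algebra. A countable union is first cut
  down to \<open>n\<close> members by continuity from below; then each member is approximated
  separately.\<close>

lemma (in finite_measure) approx_setexp:
  assumes B: "sets M = sigma_sets UNIV (range B)" and A: "A \<in> sets M" and "0 < \<epsilon>"
  shows "\<exists>e. measure M (sym_diff A (setexp_val B e)) < \<epsilon>"
proof -
  have sp: "space M = UNIV"
    using sigma_sets_top[of UNIV "range B"] sets.sets_into_space[of UNIV M] B by auto
  have "B i \<in> sets M" for i
    unfolding B by (auto intro: sigma_sets.Basic)
  note E = setexp_val_sets[OF this sp]
  have "A \<in> sigma_sets UNIV (range B)" using A B by simp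
  then show ?thesis
    using \<open>0 < \<epsilon>\<close>
  proof (induction A arbitrary: \<epsilon>)
    case (Basic A)
    then obtain i where "A = B i" by blast
    with Basic show ?case by (intro exI[of _ "Gen i"]) simp
  next
    case Empty
    then show ?case by (intro exI[of _ "Neg (Or (Gen 0) (Neg (Gen 0)))"]) simp
  next
    case (Compl A)
    then obtain e where e: "measure M (sym_diff A (setexp_val B e)) < \<epsilon>" by blast
    have "sym_diff (UNIV - A) (setexp_val B (Neg e)) = sym_diff A (setexp_val B e)"
      by auto
    with e show ?case by (intro exI[of _ "Neg e"]) simp
  next
    case (Union A)
    have A[measurable]: "A i \<in> sets M" for i
      using Union.hyps B by simp
    let ?U = "\<Union>i. A i"
    have "(\<lambda>n. measure M (\<Union>i<n. A i)) \<longlonglongrightarrow> measure M (\<Union>n. \<Union>i<n. A i)"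
    proof (rule finite_Lim_measure_incseq)
      show "incseq (\<lambda>n. \<Union>i<n. A i)" by (intro monoI UN_mono) auto
    qed auto
    moreover have "(\<Union>n. \<Union>i<n. A i) = ?U" by auto
    ultimately have "eventually (\<lambda>n. dist (measure M (\<Union>i<n. A i)) (measure M ?U) < \<epsilon> / 2) sequentially"
      using Union.prems by (auto dest!: tendstoD[where e = "\<epsilon> / 2"])
    then obtain n where "\<bar>measure M (\<Union>i<n. A i) - measure M ?U\<bar> < \<epsilon> / 2"
      unfolding eventually_sequentially dist_real_def by blast
    moreover have "measure M (?U - (\<Union>i<n. A i)) = measure M ?U - measure M (\<Union>i<n. A i)"
      by (rule finite_measure_Diff) auto
    ultimately have n: "measure M (?U - (\<Union>i<n. A i)) < \<epsilon> / 2"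
      by linarith
    \<comment> \<open>The \<open>n\<close> errors sum to at most half of \<epsilon>;
      \<open>Suc n\<close> keeps the bound positive when \<open>n = 0\<close>.\<close>
    have "\<exists>e. measure M (sym_diff (A i) (setexp_val B e)) < \<epsilon> / (2 * real (Suc n))" for i
      using Union.IH[of "\<epsilon> / (2 * real (Suc n))" i] Union.prems by simp
    then obtain f where f: "\<And>i. measure M (sym_diff (A i) (setexp_val B (f i))) < \<epsilon> / (2 * real (Suc n))"
      by metis
    obtain e where e: "setexp_val B e = (\<Union>i<n. setexp_val B (f i))"
      using setexp_val_UN by metis
    let ?D = "\<Union>i<n. sym_diff (A i) (setexp_val B (f i))"
    have "measure M (sym_diff ?U (setexp_val B e)) \<le> measure M ((?U - (\<Union>i<n. A i)) \<union> ?D)"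
      using E unfolding e by (intro finite_measure_mono) auto
    also have "\<dots> \<le> measure M (?U - (\<Union>i<n. A i)) + measure M ?D"
      using E by (intro measure_Un_le) auto
    also have "measure M ?D \<le> (\<Sum>i<n. measure M (sym_diff (A i) (setexp_val B (f i))))"
      using E by (intro measure_UNION_le) auto
    also have "\<dots> \<le> (\<Sum>i<n. \<epsilon> / (2 * real (Suc n)))"
      using f by (intro sum_mono less_imp_le)
    also have "\<dots> \<le> \<epsilon> / 2"
      using Union.prems by (simp add: field_simps)
    finally show ?case
      using n by (intro exI[of _ e]) simp
  qed
qed

lemma ex_countable_generator:
  "\<exists>B :: nat \<Rightarrow> 'a::second_countable_topology set. sets borel = sigma_sets UNIV (range B)"
proof -
  obtain \<B> :: "'a set set" where \<B>: "countable \<B>" "topological_basis \<B>"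
    using ex_countable_basis by blast
  have "\<B> \<noteq> {}"
    using \<B>(2) unfolding topological_basis_def by (metis UNIV_not_empty Union_empty empty_subsetI open_UNIV subset_empty)
  with \<B>(1) have r: "range (from_nat_into \<B>) = \<B>"
    by (rule range_from_nat_into[rotated])
  have "sets (borel :: 'a measure) = sigma_sets UNIV (range (from_nat_into \<B>))"
    unfolding r borel_eq_countable_basis[OF \<B>] by simp
  then show ?thesis by blast
qed

text \<open>Makes the countable algebra a \<pi>-system, so that measurability of a kernel into
  probability measures can be checked on its members.\<close>

lemma Int_stable_setexp: "Int_stable (range (setexp_val B))"
proof (rule Int_stableI)
  fix a b assume "a \<in> range (setexp_val B)" "b \<in> range (setexp_val B)"
  then obtain d e where "a = setexp_val B d" "b = setexp_val B e" by blast
  then have "a \<inter> b = setexp_val B (Neg (Or (Neg d) (Neg e)))" by simp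
  then show "a \<inter> b \<in> range (setexp_val B)" by blast
qed

lemma sigma_sets_setexp:
  fixes B :: "nat \<Rightarrow> 'a::topological_space set"
  assumes B: "sets borel = sigma_sets UNIV (range B)"
  shows "sets borel = sigma_sets UNIV (range (setexp_val B))"
proof
  have "range B \<subseteq> range (setexp_val B)"
    by (metis image_subsetI rangeI setexp_val.simps(1))
  then show "sets borel \<subseteq> sigma_sets UNIV (range (setexp_val B))"
    unfolding B by (rule sigma_sets_mono')
  have "B i \<in> sets borel" for i
    unfolding B by (auto intro: sigma_sets.Basic)
  then show "sigma_sets UNIV (range (setexp_val B)) \<subseteq> sets borel"
    using sets.sigma_sets_subset[of "range (setexp_val B)" borel] setexp_val_sets[of B borel] by auto
qed

section \<open>Total variation\<close>

text \<open>Split the blocks by the sign of the difference. On either half the absolute values add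
  up to the difference of the two measures on one union, which the bound for single sets
  controls.\<close>

lemma partition_diff_le:
  assumes M: "finite_measure M" and N: "finite_measure N" and sets: "sets N = sets M"
    and le: "\<And>A. A \<in> sets M \<Longrightarrow> \<bar>measure M A - measure N A\<bar> \<le> \<epsilon>"
    and \<A>: "finite \<A>" "\<A> \<subseteq> sets M" "disjoint \<A>"
  shows "(\<Sum>A\<in>\<A>. \<bar>measure M A - measure N A\<bar>) \<le> 2 * \<epsilon>"
proof -
  interpret M: finite_measure M by fact
  interpret N: finite_measure N by fact
  let ?P = "{A\<in>\<A>. measure N A \<le> measure M A}"
  have un: "measure M (\<Union>\<B>) = (\<Sum>A\<in>\<B>. measure M A)" "measure N (\<Union>\<B>) = (\<Sum>A\<in>\<B>. measure N A)"
    "\<Union>\<B> \<in> sets M" if "\<B> \<subseteq> \<A>" for \<B>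
  proof -
    have b: "finite \<B>" "\<B> \<subseteq> sets M" "disjoint \<B>"
      using that \<A> by (auto intro: finite_subset pairwise_subset)
    then show "measure M (\<Union>\<B>) = (\<Sum>A\<in>\<B>. measure M A)" "measure N (\<Union>\<B>) = (\<Sum>A\<in>\<B>. measure N A)"
      using M.finite_measure_finite_Union[of \<B> "\<lambda>A. A"] N.finite_measure_finite_Union[of \<B> "\<lambda>A. A"] sets
      by (auto simp: disjoint_family_on_disjoint_image[of "\<lambda>A. A", simplified] disjoint_family_on_def disjointD)
    show "\<Union>\<B> \<in> sets M" using b by auto
  qed
  have "(\<Sum>A\<in>\<A>. \<bar>measure M A - measure N A\<bar>) =
      (\<Sum>A\<in>?P. \<bar>measure M A - measure N A\<bar>) + (\<Sum>A\<in>\<A> - ?P. \<bar>measure M A - measure N A\<bar>)"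
    using \<A>(1) by (subst sum.subset_diff[of ?P]) auto
  also have "(\<Sum>A\<in>?P. \<bar>measure M A - measure N A\<bar>) = measure M (\<Union>?P) - measure N (\<Union>?P)"
    using un[of ?P] by (simp add: sum_subtractf)
  also have "(\<Sum>A\<in>\<A> - ?P. \<bar>measure M A - measure N A\<bar>) = (\<Sum>A\<in>\<A> - ?P. measure N A - measure M A)"
    by (intro sum.cong refl) auto
  also have "\<dots> = measure N (\<Union>(\<A> - ?P)) - measure M (\<Union>(\<A> - ?P))"
    using un[of "\<A> - ?P"] by (simp add: sum_subtractf)
  also have "measure M (\<Union>?P) - measure N (\<Union>?P) + \<dots> \<le> \<epsilon> + \<epsilon>"
    using le[OF un(3), of ?P] le[OF un(3), of "\<A> - ?P"] by (intro add_mono) auto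
  finally show ?thesis by simp
qed

lemma total_variation_diff_le:
  assumes "finite_measure M" "finite_measure N" "sets N = sets M"
    and "\<And>A. A \<in> sets M \<Longrightarrow> \<bar>measure M A - measure N A\<bar> \<le> \<epsilon>"
  shows "total_variation_diff M N \<le> 2 * \<epsilon>"
  unfolding total_variation_diff_def
proof (rule cSUP_least)
  have "{} \<in> {\<A>. finite \<A> \<and> \<A> \<subseteq> sets M \<and> disjoint \<A>}" by simp
  then show "{\<A>. finite \<A> \<and> \<A> \<subseteq> sets M \<and> disjoint \<A>} \<noteq> {}" by blast
  fix \<A> assume "\<A> \<in> {\<A>. finite \<A> \<and> \<A> \<subseteq> sets M \<and> disjoint \<A>}"
  then show "(\<Sum>A\<in>\<A>. \<bar>measure M A - measure N A\<bar>) \<le> 2 * \<epsilon>"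
    using partition_diff_le[OF assms, of \<A>] by simp
qed

context
  fixes M N :: "'a measure"
  assumes M: "prob_space M" and N: "prob_space N" and sets: "sets N = sets M"
begin

lemma measure_diff_le_1: "\<bar>measure M A - measure N A\<bar> \<le> 1"
  using prob_space.prob_le_1[OF M, of A] prob_space.prob_le_1[OF N, of A]
    measure_nonneg[of M A] measure_nonneg[of N A] by linarith

lemma total_variation_diff_ge:
  assumes "finite \<A>" "\<A> \<subseteq> sets M" "disjoint \<A>"
  shows "(\<Sum>A\<in>\<A>. \<bar>measure M A - measure N A\<bar>) \<le> total_variation_diff M N"
  unfolding total_variation_diff_def
proof (rule cSUP_upper)
  show "\<A> \<in> {\<A>. finite \<A> \<and> \<A> \<subseteq> sets M \<and> disjoint \<A>}" using assms by simp
  show "bdd_above ((\<lambda>\<A>. \<Sum>A\<in>\<A>. \<bar>measure M A - measure N A\<bar>) ` {\<A>. finite \<A> \<and> \<A> \<subseteq> sets M \<and> disjoint \<A>})"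
  proof (rule bdd_aboveI2)
    fix \<A> assume "\<A> \<in> {\<A>. finite \<A> \<and> \<A> \<subseteq> sets M \<and> disjoint \<A>}"
    then show "(\<Sum>A\<in>\<A>. \<bar>measure M A - measure N A\<bar>) \<le> 2 * 1"
      using partition_diff_le[OF prob_space.finite_measure[OF M] prob_space.finite_measure[OF N] sets measure_diff_le_1, of \<A>]
      by simp
  qed
qed

lemma total_variation_diff_nonneg: "0 \<le> total_variation_diff M N"
  using total_variation_diff_ge[of "{}"] by simp

lemma total_variation_diff_le_2: "total_variation_diff M N \<le> 2"
  using total_variation_diff_le[OF prob_space.finite_measure[OF M] prob_space.finite_measure[OF N] sets measure_diff_le_1]
  by simp

text \<open>Test with the partition into \<open>A\<close> and its complement: both measures have
  mass 1, so the two blocks contribute equally. Together with \<open>total_variation_diff_le\<close>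
  the norm is twice the supremum of the discrepancies on sets.\<close>

lemma total_variation_diff_ge_double:
  assumes A: "A \<in> sets M"
  shows "2 * \<bar>measure M A - measure N A\<bar> \<le> total_variation_diff M N"
proof -
  have "space M \<noteq> {}" using prob_space.not_empty[OF M] .
  have sp: "space N = space M" using sets_eq_imp_space_eq[OF sets] .
  \<comment> \<open>The blocks must be distinct: the sum ranges over a set of blocks and would merge
    equal ones.\<close>
  have "A \<noteq> space M - A" using \<open>space M \<noteq> {}\<close> by blast
  then have "(\<Sum>B\<in>{A, space M - A}. \<bar>measure M B - measure N B\<bar>) =
      \<bar>measure M A - measure N A\<bar> + \<bar>measure M (space M - A) - measure N (space M - A)\<bar>"
    by simp
  also have "\<bar>measure M (space M - A) - measure N (space M - A)\<bar> = \<bar>measure M A - measure N A\<bar>"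
    using prob_space.prob_compl[OF M A] prob_space.prob_compl[OF N, of A] A sets sp by simp
  finally show ?thesis
    using total_variation_diff_ge[of "{A, space M - A}"] A
    by (simp add: pairwise_insert disjnt_def Diff_Int_distrib2 )
qed

text \<open>The level sets of \<open>g\<close> form a partition and no value exceeds 1, so the
  weighted discrepancies add up to at most the total variation.\<close>

lemma simple_integral_le_total_variation:
  assumes g: "simple_function M g" "\<And>x. x \<in> space M \<Longrightarrow> g x \<le> 1"
  shows "integral\<^sup>S M g \<le> integral\<^sup>S N g + ennreal (total_variation_diff M N)"
proof -
  have sp: "space N = space M" using sets_eq_imp_space_eq[OF sets] .
  let ?A = "\<lambda>y. g -` {y} \<inter> space M"
  let ?R = "g ` space M"
  have fin: "finite ?R" using g(1) by (simp add: simple_function_def)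
  have meas: "?A y \<in> sets M" for y
    using simple_functionD(2)[OF g(1)] .
  have emM: "emeasure M A = ennreal (measure M A)" "emeasure N A = ennreal (measure N A)" for A
    using M N by (simp_all add: finite_measure.emeasure_eq_measure prob_space.finite_measure)
  have summand: "y * emeasure M (?A y) \<le> y * emeasure N (?A y) + ennreal \<bar>measure M (?A y) - measure N (?A y)\<bar>"
    if "y \<in> ?R" for y
  proof -
    have "y \<le> 1" using that g(2) by auto
    have "emeasure M (?A y) \<le> emeasure N (?A y) + ennreal \<bar>measure M (?A y) - measure N (?A y)\<bar>"
    proof -
      have "ennreal (measure M (?A y)) \<le> ennreal (measure N (?A y) + \<bar>measure M (?A y) - measure N (?A y)\<bar>)"
        by (rule ennreal_leI) linarith
      then show ?thesis unfolding emM by (simp add: ennreal_plus)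
    qed
    then have "y * emeasure M (?A y) \<le> y * (emeasure N (?A y) + ennreal \<bar>measure M (?A y) - measure N (?A y)\<bar>)"
      by (rule mult_left_mono) simp
    also have "\<dots> = y * emeasure N (?A y) + y * ennreal \<bar>measure M (?A y) - measure N (?A y)\<bar>"
      by (rule distrib_left)
    also have "y * ennreal \<bar>measure M (?A y) - measure N (?A y)\<bar> \<le> 1 * ennreal \<bar>measure M (?A y) - measure N (?A y)\<bar>"
      using \<open>y \<le> 1\<close> by (rule mult_right_mono) simp
    finally show ?thesis by simp
  qed
  have "inj_on ?A ?R"
    by (auto simp: inj_on_def)
  have "integral\<^sup>S M g = (\<Sum>y\<in>?R. y * emeasure M (?A y))"
    by (simp add: simple_integral_def)
  also have "\<dots> \<le> (\<Sum>y\<in>?R. y * emeasure N (?A y) + ennreal \<bar>measure M (?A y) - measure N (?A y)\<bar>)"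
    by (intro sum_mono summand)
  also have "\<dots> = integral\<^sup>S N g + ennreal (\<Sum>y\<in>?R. \<bar>measure M (?A y) - measure N (?A y)\<bar>)"
    by (simp add: sum.distrib simple_integral_def sp)
  also have "(\<Sum>y\<in>?R. \<bar>measure M (?A y) - measure N (?A y)\<bar>) = (\<Sum>A\<in>?A ` ?R. \<bar>measure M A - measure N A\<bar>)"
    using \<open>inj_on ?A ?R\<close> by (simp add: sum.reindex)
  also have "ennreal \<dots> \<le> ennreal (total_variation_diff M N)"
    using fin meas by (intro ennreal_leI total_variation_diff_ge) (auto simp: pairwise_def disjnt_def)
  finally show ?thesis by simp
qed

text \<open>The form in which closeness of two laws enters the estimates for mixtures. It passes
  from simple functions to \<open>u\<close> because the integral is the supremum over the simple
  functions below \<open>u\<close>.\<close>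

lemma nn_integral_le_total_variation:
  assumes u: "\<And>x. x \<in> space M \<Longrightarrow> u x \<le> 1"
  shows "(\<integral>\<^sup>+x. u x \<partial>M) \<le> (\<integral>\<^sup>+x. u x \<partial>N) + ennreal (total_variation_diff M N)"
  unfolding nn_integral_def[of M u]
proof (rule SUP_least)
  fix g assume "g \<in> {g. simple_function M g \<and> g \<le> u}"
  then have g: "simple_function M g" "\<And>x. g x \<le> u x" by (auto simp: le_fun_def)
  have gN: "simple_function N g"
    using g(1) sets sets_eq_imp_space_eq[OF sets] by (simp add: simple_function_def)
  have "integral\<^sup>S M g \<le> integral\<^sup>S N g + ennreal (total_variation_diff M N)"
    by (rule simple_integral_le_total_variation[OF g(1)]) (use g(2) u order_trans in blast)
  also have "integral\<^sup>S N g \<le> integral\<^sup>N N u"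
    unfolding nn_integral_def using gN g(2) by (intro SUP_upper) (auto simp: le_fun_def)
  finally show "integral\<^sup>S M g \<le> integral\<^sup>N N u + ennreal (total_variation_diff M N)"
    by (simp add: add_right_mono)
qed

end

lemma total_variation_diff_commute:
  assumes "sets N = sets M" shows "total_variation_diff M N = total_variation_diff N M"
  unfolding total_variation_diff_def assms by (simp add: abs_minus_commute)

text \<open>Replaces the supremum over all finite partitions by one over the countable algebra; from
  this follows that the distance of two kernels is a measurable function.\<close>

lemma total_variation_diff_eq_SUP:
  fixes M N :: "'a::topological_space measure"
  assumes M: "prob_space M" "sets M = sets borel" and N: "prob_space N" "sets N = sets borel"
    and B: "sets borel = sigma_sets UNIV (range B)"
  shows "total_variation_diff M N =
    2 * (SUP e. \<bar>measure M (setexp_val B e) - measure N (setexp_val B e)\<bar>)"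
    (is "_ = 2 * ?S")
proof (rule antisym)
  have sets: "sets N = sets M" using M N by simp
  interpret M: prob_space M by fact
  interpret N: prob_space N by fact
  have bdd: "bdd_above (range (\<lambda>e. \<bar>measure M (setexp_val B e) - measure N (setexp_val B e)\<bar>))"
    using measure_diff_le_1[OF M(1) N(1) sets] by (intro bdd_aboveI[of _ 1]) auto
  have E: "setexp_val B e \<in> sets M" for e
    unfolding M(2) sigma_sets_setexp[OF B] by (rule sigma_sets.Basic) simp
  show "2 * ?S \<le> total_variation_diff M N"
  proof -
    have "\<bar>measure M (setexp_val B e) - measure N (setexp_val B e)\<bar> \<le> total_variation_diff M N / 2" for e
    proof -
      have half: "2 * a \<le> t \<Longrightarrow> a \<le> t / 2" for a t :: real by simp
      show ?thesis
        by (rule half[OF total_variation_diff_ge_double[OF M(1) N(1) sets E]])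
    qed
    then have "?S \<le> total_variation_diff M N / 2"
      by (rule cSUP_least[OF UNIV_not_empty])
    then show ?thesis by simp
  qed
  show "total_variation_diff M N \<le> 2 * ?S"
  proof (rule total_variation_diff_le[OF M.finite_measure_axioms N.finite_measure_axioms sets])
    fix A assume A: "A \<in> sets M"
    show "\<bar>measure M A - measure N A\<bar> \<le> ?S"
    proof (rule field_le_epsilon)
      fix \<epsilon> :: real assume "0 < \<epsilon>"
      \<comment> \<open>Approximation with respect to the sum of both measures yields one expression
        that is close to \<open>A\<close> for \<open>M\<close> and for \<open>N\<close> at
        once.\<close>
      define Q where "Q = measure_of UNIV (sets borel) (\<lambda>A. emeasure M A + emeasure N A)"
      have ca: "countably_additive (sets borel) (\<lambda>A. emeasure M A + emeasure N A)"
      proof (rule countably_additiveI)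
        fix F :: "nat \<Rightarrow> 'a set" assume F: "range F \<subseteq> sets borel" "disjoint_family F"
        show "(\<Sum>i. emeasure M (F i) + emeasure N (F i)) = emeasure M (\<Union>i. F i) + emeasure N (\<Union>i. F i)"
          using F M(2) N(2) by (simp add: suminf_emeasure flip: suminf_add)
      qed
      have Q_sets: "sets Q = sets borel"
        unfolding Q_def using sets.sigma_sets_eq[of "borel :: 'a measure"] by simp
      have Q: "emeasure Q X = emeasure M X + emeasure N X" if "X \<in> sets borel" for X
        by (rule emeasure_measure_of[OF Q_def]) (use that ca Q_sets in \<open>auto simp: positive_def\<close>)
      interpret Q: finite_measure Q
      proof (rule finite_measureI)
        have "space Q = UNIV" using sets_eq_imp_space_eq[OF Q_sets] by simp
        then show "emeasure Q (space Q) \<noteq> \<infinity>" using Q[of UNIV] by simp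
      qed
      obtain e where e: "measure Q (sym_diff A (setexp_val B e)) < \<epsilon>"
        using Q.approx_setexp[of B A \<epsilon>] Q_sets B A M(2) \<open>0 < \<epsilon>\<close> by auto
      let ?D = "sym_diff A (setexp_val B e)"
      have D: "?D \<in> sets borel" using A E M(2) by auto
      have QD: "measure Q ?D = measure M ?D + measure N ?D"
        unfolding measure_def Q[OF D]
        by (rule enn2real_plus) (simp_all add: less_top[symmetric])
      have diff: "\<bar>measure R A - measure R (setexp_val B e)\<bar> \<le> measure R ?D"
        if "finite_measure R" "sets R = sets borel" for R
      proof -
        interpret R: finite_measure R by fact
        have s: "A \<in> sets R" "setexp_val B e \<in> sets R" using A E M(2) that(2) by auto
        have "measure R A \<le> measure R (setexp_val B e \<union> ?D)" "measure R (setexp_val B e) \<le> measure R (A \<union> ?D)"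
          using s by (auto intro!: R.finite_measure_mono)
        moreover have "measure R (setexp_val B e \<union> ?D) \<le> measure R (setexp_val B e) + measure R ?D"
          "measure R (A \<union> ?D) \<le> measure R A + measure R ?D"
          using s by (auto intro!: measure_Un_le)
        ultimately show ?thesis by linarith
      qed
      have "\<bar>measure M A - measure N A\<bar> \<le> \<bar>measure M (setexp_val B e) - measure N (setexp_val B e)\<bar> + \<epsilon>"
        using diff[OF M.finite_measure_axioms M(2)] diff[OF N.finite_measure_axioms N(2)] QD e by linarith
      also have "\<bar>measure M (setexp_val B e) - measure N (setexp_val B e)\<bar> \<le> ?S"
        by (rule cSUP_upper[OF _ bdd]) simp
      finally show "\<bar>measure M A - measure N A\<bar> \<le> ?S + \<epsilon>" by simp
    qed
  qed
qed

lemma borel_measurable_total_variation_diff: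
  fixes p q :: "'b \<Rightarrow> 'a::second_countable_topology measure"
  assumes p: "p \<in> L \<rightarrow>\<^sub>M prob_algebra borel" and q: "q \<in> L \<rightarrow>\<^sub>M prob_algebra borel"
  shows "(\<lambda>x. total_variation_diff (p x) (q x)) \<in> borel_measurable L"
proof -
  obtain B :: "nat \<Rightarrow> 'a set" where B: "sets borel = sigma_sets UNIV (range B)"
    using ex_countable_generator by blast
  have pq: "prob_space (p x)" "sets (p x) = sets borel" "prob_space (q x)" "sets (q x) = sets borel"
    if "x \<in> space L" for x
    using measurable_space[OF p that] measurable_space[OF q that] by (auto simp: space_prob_algebra)
  have E: "setexp_val B e \<in> sets borel" for e
    unfolding sigma_sets_setexp[OF B] by (rule sigma_sets.Basic) simp
  have "(\<lambda>x. SUP e. \<bar>measure (p x) (setexp_val B e) - measure (q x) (setexp_val B e)\<bar>) \<in> borel_measurable L"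
  proof (rule borel_measurable_cSUP)
    show "(\<lambda>x. \<bar>measure (p x) (setexp_val B e) - measure (q x) (setexp_val B e)\<bar>) \<in> borel_measurable L" for e
      by (intro borel_measurable_abs borel_measurable_diff measurable_compose[OF p] measurable_compose[OF q]
          measurable_measure_prob_algebra E)
    show "bdd_above ((\<lambda>e. \<bar>measure (p x) (setexp_val B e) - measure (q x) (setexp_val B e)\<bar>) ` UNIV)"
      if "x \<in> space L" for x
      using measure_diff_le_1[OF pq(1,3)[OF that]] pq(2,4)[OF that] by (intro bdd_aboveI[of _ 1]) auto
  qed simp
  then have "(\<lambda>x. 2 * (SUP e. \<bar>measure (p x) (setexp_val B e) - measure (q x) (setexp_val B e)\<bar>)) \<in> borel_measurable L"
    by measurable
  then show ?thesis
    by (rule measurable_cong[THEN iffD2, rotated]) (simp add: total_variation_diff_eq_SUP[OF pq B])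
qed

section \<open>Averages of a nonsingular ergodic transformation\<close>

lemma (in sigma_finite_measure) finite_measure_real_density:
  assumes "finite_measure N" "absolutely_continuous M N" "sets N = sets M"
  obtains \<phi> :: "'a \<Rightarrow> real" where "integrable M \<phi>"
    "\<And>u. u \<in> borel_measurable M \<Longrightarrow> integral\<^sup>L N u = (\<integral>x. \<phi> x * u x \<partial>M)"
proof -
  obtain D :: "'a \<Rightarrow> real" where D: "D \<in> borel_measurable M" "AE x in M. RN_deriv M N x = ennreal (D x)" "\<And>x. 0 \<le> D x"
    using real_RN_deriv[OF assms] by metis
  have N: "N = density M D"
    using density_RN_deriv[OF assms(2,3)] density_cong[OF _ _ D(2)] D(1) by auto
  have "(\<integral>\<^sup>+x. ennreal (D x) \<partial>M) = emeasure N (space N)"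
    unfolding N using D(1) by (simp add: emeasure_density nn_integral_set_ennreal cong: nn_integral_cong)
  also have "\<dots> < \<infinity>"
    using finite_measure.emeasure_finite[OF assms(1)] by (simp add: less_top)
  finally have int: "integrable M D"
    using D by (intro integrableI_nonneg) auto
  have eq: "integral\<^sup>L N u = (\<integral>x. D x * u x \<partial>M)" if "u \<in> borel_measurable M" for u
    unfolding N using integral_density[OF that D(1)] D(3) by simp
  show thesis by (rule that[OF int eq])
qed

text \<open>Tychonoff's theorem for the functionals given by integration against \<open>a n\<close>:
  the value at \<phi> stays in a compact interval whose radius is the L1 norm of \<phi>. The limit
  is only a functional here; that it comes from a bounded function is shown in
  \<open>weak_star_cluster\<close>.\<close>

lemma weak_star_cluster_functional:
  fixes a :: "nat \<Rightarrow> 'a \<Rightarrow> real"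
  assumes a[measurable]: "\<And>n. a n \<in> borel_measurable M" and a01: "\<And>n x. 0 \<le> a n x" "\<And>n x. a n x \<le> 1"
    and I: "infinite (I :: nat set)"
  shows "\<exists>G L. G \<noteq> bot \<and> G \<le> sequentially \<and> eventually (\<lambda>n. n \<in> I) G \<and>
    (\<forall>\<phi>. integrable M \<phi> \<longrightarrow> ((\<lambda>n. \<integral>x. a n x * \<phi> x \<partial>M) \<longlongrightarrow> L \<phi>) G)"
proof -
  \<comment> \<open>The value 0 at non-integrable functions lets the product run over all functions;
    \<open>r\<close> gives the radii of the intervals.\<close>
  define \<Phi> where "\<Phi> n \<phi> = (if integrable M \<phi> then \<integral>x. a n x * \<phi> x \<partial>M else 0)" for n and \<phi> :: "'a \<Rightarrow> real"
  define r where "r \<phi> = (if integrable M \<phi> then \<integral>x. \<bar>\<phi> x\<bar> \<partial>M else 0)" for \<phi> :: "'a \<Rightarrow> real"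
  define S where "S = PiE UNIV (\<lambda>\<phi>. {- r \<phi>..r \<phi>})"
  have "compact S"
  proof -
    have "compactin (product_topology (\<lambda>_. euclidean) UNIV) S"
      unfolding S_def compactin_PiE by simp
    then show ?thesis
      unfolding euclidean_product_topology by simp
  qed
  have \<Phi>S: "\<Phi> n \<in> S" for n
  proof -
    have "\<bar>\<integral>x. a n x * \<phi> x \<partial>M\<bar> \<le> (\<integral>x. \<bar>\<phi> x\<bar> \<partial>M)" if \<phi>: "integrable M \<phi>" for \<phi>
    proof -
      have "\<bar>\<integral>x. a n x * \<phi> x \<partial>M\<bar> \<le> (\<integral>x. \<bar>a n x * \<phi> x\<bar> \<partial>M)"
        by (rule integral_abs_bound)
      also have "\<dots> \<le> (\<integral>x. \<bar>\<phi> x\<bar> \<partial>M)"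
        by (rule integral_mono') (use \<phi> a01 in \<open>auto simp: abs_mult intro!: mult_left_le_one_le\<close>)
      finally show ?thesis .
    qed
    then have "\<bar>\<Phi> n \<phi>\<bar> \<le> r \<phi>" for \<phi>
      unfolding \<Phi>_def r_def by simp
    then have b: "- r \<phi> \<le> \<Phi> n \<phi>" "\<Phi> n \<phi> \<le> r \<phi>" for \<phi>
      by (simp_all add: abs_le_iff minus_le_iff)
    show ?thesis
      unfolding S_def by (rule PiE_I) (use b in auto)
  qed
  \<comment> \<open>Restricts attention to the indices in \<open>I\<close>; the filter is proper
    because \<open>I\<close> is infinite.\<close>
  define F0 where "F0 = inf sequentially (principal I)"
  have F0: "F0 \<noteq> bot"
  proof
    assume "F0 = bot"
    then have "eventually (\<lambda>_. False) F0" by simp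
    then have "eventually (\<lambda>n. n \<notin> I) sequentially"
      unfolding F0_def eventually_inf_principal by simp
    then obtain N where "\<And>n. n \<ge> N \<Longrightarrow> n \<notin> I"
      unfolding eventually_sequentially by blast
    then have "I \<subseteq> {..<N}" by (meson lessThan_iff not_le subsetI)
    with I show False using finite_subset by blast
  qed
  have "filtermap \<Phi> F0 \<noteq> bot"
    using F0 by (simp add: filtermap_bot_iff)
  moreover have "eventually (\<lambda>x. x \<in> S) (filtermap \<Phi> F0)"
    using \<Phi>S by (simp add: eventually_filtermap)
  ultimately obtain L where L: "inf (nhds L) (filtermap \<Phi> F0) \<noteq> bot"
    using \<open>compact S\<close> unfolding compact_filter by blast
  \<comment> \<open>Adding the preimages of the neighbourhoods of \<open>L\<close> forces
    convergence along \<open>G\<close>; that \<open>L\<close> is a cluster point keeps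
    \<open>G\<close> proper.\<close>
  define G where "G = inf F0 (filtercomap \<Phi> (nhds L))"
  have G: "G \<noteq> bot"
  proof
    assume "G = bot"
    then have "eventually (\<lambda>_. False) G" by simp
    then obtain P Q where P: "eventually P F0" and Q: "eventually Q (filtercomap \<Phi> (nhds L))"
      and PQ: "\<And>n. P n \<Longrightarrow> Q n \<Longrightarrow> False"
      unfolding G_def eventually_inf by blast
    obtain R where R: "eventually R (nhds L)" "\<And>n. R (\<Phi> n) \<Longrightarrow> Q n"
      using Q unfolding eventually_filtercomap by blast
    have "eventually (\<lambda>y. \<not> R y) (filtermap \<Phi> F0)"
      unfolding eventually_filtermap using P by eventually_elim (use R(2) PQ in blast)
    with R(1) have "eventually (\<lambda>_. False) (inf (nhds L) (filtermap \<Phi> F0))"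
      unfolding eventually_inf by blast
    with L show False by (simp add: trivial_limit_def)
  qed
  have lim: "filterlim \<Phi> (nhds L) G"
    unfolding G_def by (rule filterlim_mono[OF filterlim_filtercomap]) auto
  have "((\<lambda>n. \<integral>x. a n x * \<phi> x \<partial>M) \<longlongrightarrow> L \<phi>) G" if \<phi>: "integrable M \<phi>" for \<phi>
  proof -
    have "((\<lambda>n. \<Phi> n \<phi>) \<longlongrightarrow> L \<phi>) G"
      by (rule continuous_on_tendsto_compose[OF continuous_on_product_coordinates[of \<phi>] lim]) auto
    then show ?thesis using \<phi> by (simp add: \<Phi>_def)
  qed
  moreover have "G \<le> sequentially"
    unfolding G_def F0_def by (simp add: le_infI1)
  moreover have "eventually (\<lambda>n. n \<in> I) G"
    by (rule filter_leD[of _ "principal I"]) (auto simp: G_def F0_def eventually_principal intro: le_infI1)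
  ultimately show ?thesis using G by - (rule exI[of _ G], rule exI[of _ L], simp)
qed

text \<open>
  The limit is taken along a filter obtained from the compactness of a product of intervals, so
  that separability of \<open>L\<^sup>1\<close> is not needed.
\<close>

lemma (in prob_space) weak_star_cluster:
  fixes a :: "nat \<Rightarrow> 'a \<Rightarrow> real"
  assumes a[measurable]: "\<And>n. a n \<in> borel_measurable M" and a01: "\<And>n x. 0 \<le> a n x" "\<And>n x. a n x \<le> 1"
    and I: "infinite (I :: nat set)"
  shows "\<exists>G f. G \<noteq> bot \<and> G \<le> sequentially \<and> eventually (\<lambda>n. n \<in> I) G \<and>
    f \<in> borel_measurable M \<and> (\<forall>x. 0 \<le> f x \<and> f x \<le> (1::real)) \<and>
    (\<forall>\<phi>. integrable M \<phi> \<longrightarrow> ((\<lambda>n. \<integral>x. a n x * \<phi> x \<partial>M) \<longlongrightarrow> (\<integral>x. f x * \<phi> x \<partial>M)) G)"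
proof -
  obtain G L where GL: "G \<noteq> bot \<and> G \<le> sequentially \<and> eventually (\<lambda>n. n \<in> I) G \<and>
    (\<forall>\<phi>. integrable M \<phi> \<longrightarrow> ((\<lambda>n. \<integral>x. a n x * \<phi> x \<partial>M) \<longlongrightarrow> L \<phi>) G)"
    using weak_star_cluster_functional[of a M I, OF a a01 I] by (elim exE) (rule that)
  then have G: "G \<noteq> bot" "G \<le> sequentially" "eventually (\<lambda>n. n \<in> I) G"
    and L: "\<And>\<phi>. integrable M \<phi> \<Longrightarrow> ((\<lambda>n. \<integral>x. a n x * \<phi> x \<partial>M) \<longlongrightarrow> L \<phi>) G"
    by simp_all
  have int_a: "integrable M (\<lambda>x. a n x * \<phi> x)" if \<phi>: "integrable M \<phi>" for n \<phi>
    using \<phi> by (rule Bochner_Integration.integrable_bound)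
      (use \<phi> a01 in \<open>auto simp: abs_mult intro!: mult_left_le_one_le\<close>)
  have L_add: "L (\<lambda>x. \<phi> x + \<psi> x) = L \<phi> + L \<psi>" if "integrable M \<phi>" "integrable M \<psi>" for \<phi> \<psi>
  proof -
    have "((\<lambda>n. \<integral>x. a n x * (\<phi> x + \<psi> x) \<partial>M) \<longlongrightarrow> L \<phi> + L \<psi>) G"
      using tendsto_add[OF L[OF that(1)] L[OF that(2)]] that
      by (simp add: distrib_left int_a)
    then show ?thesis
      by (rule tendsto_unique[OF G(1) L[OF Bochner_Integration.integrable_add[OF that]]])
  qed
  have L_scale: "L (\<lambda>x. c * \<phi> x) = c * L \<phi>" if "integrable M \<phi>" for \<phi> c
  proof -
    have "((\<lambda>n. \<integral>x. a n x * (c * \<phi> x) \<partial>M) \<longlongrightarrow> c * L \<phi>) G"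
      using tendsto_mult_left[OF L[OF that], of c] by (simp add: mult.left_commute)
    then show ?thesis
      by (rule tendsto_unique[OF G(1) L[OF integrable_mult_right[OF that]]])
  qed
  have L_bound: "\<bar>L \<phi>\<bar> \<le> (\<integral>x. \<bar>\<phi> x\<bar> \<partial>M)" if \<phi>: "integrable M \<phi>" for \<phi>
  proof (rule tendsto_upperbound[OF tendsto_rabs[OF L[OF \<phi>]] _ G(1)])
    have "\<bar>\<integral>x. a n x * \<phi> x \<partial>M\<bar> \<le> (\<integral>x. \<bar>\<phi> x\<bar> \<partial>M)" for n
    proof -
      have "\<bar>\<integral>x. a n x * \<phi> x \<partial>M\<bar> \<le> (\<integral>x. \<bar>a n x * \<phi> x\<bar> \<partial>M)"
        by (rule integral_abs_bound)
      also have "\<dots> \<le> (\<integral>x. \<bar>\<phi> x\<bar> \<partial>M)"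
        by (rule integral_mono') (use \<phi> a01 in \<open>auto simp: abs_mult intro!: mult_left_le_one_le\<close>)
      finally show ?thesis .
    qed
    then show "eventually (\<lambda>n. \<bar>\<integral>x. a n x * \<phi> x \<partial>M\<bar> \<le> (\<integral>x. \<bar>\<phi> x\<bar> \<partial>M)) G"
      by simp
  qed
  have L_nonneg: "0 \<le> L \<phi>" if \<phi>: "integrable M \<phi>" "\<And>x. 0 \<le> \<phi> x" for \<phi>
    by (rule tendsto_lowerbound[OF L[OF \<phi>(1)] _ G(1)]) (use \<phi>(2) a01 in \<open>auto intro!: always_eventually integral_nonneg\<close>)
  define \<nu> where "\<nu> A = ennreal (L (indicator A))" for A
  have int_ind: "integrable M (indicator A :: 'a \<Rightarrow> real)" if "A \<in> sets M" for A
    using that by (simp add: less_top[symmetric])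
  have L_le: "L (indicator A) \<le> prob A" if "A \<in> sets M" for A
    using L_bound[OF int_ind[OF that]] that by simp
  have ca: "countably_additive (sets M) \<nu>"
  proof (rule sets.empty_continuous_imp_countably_additive)
    have "L (indicator {}) = 0"
      using L_le[of "{}"] L_nonneg[OF int_ind[of "{}"]] by simp
    then show "positive (sets M) \<nu>"
      unfolding positive_def \<nu>_def by simp
    show "additive (sets M) \<nu>"
      unfolding additive_def
    proof safe
      fix A B assume AB: "A \<in> sets M" "B \<in> sets M" "A \<inter> B = {}"
      have "(indicator (A \<union> B) :: 'a \<Rightarrow> real) = (\<lambda>x. indicator A x + indicator B x)"
        using AB(3) by (auto simp: fun_eq_iff split: split_indicator)
      then have "L (indicator (A \<union> B)) = L (indicator A) + L (indicator B)"
        using L_add[OF int_ind int_ind] AB by simp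
      then show "\<nu> (A \<union> B) = \<nu> A + \<nu> B"
        unfolding \<nu>_def using AB L_nonneg[OF int_ind] by (simp add: ennreal_plus)
    qed
    show "\<forall>A\<in>sets M. \<nu> A \<noteq> \<infinity>"
      by (simp add: \<nu>_def)
    show "(\<lambda>i. \<nu> (A i)) \<longlonglongrightarrow> 0"
      if A: "range A \<subseteq> sets M" "decseq A" "(\<Inter>i. A i) = {}" for A
    proof -
      have "(\<lambda>i. prob (A i)) \<longlonglongrightarrow> 0"
        using finite_Lim_measure_decseq[OF A(1,2)] A(3) by simp
      have Ai: "A i \<in> sets M" for i using A(1) by auto
      have "(\<lambda>i. L (indicator (A i))) \<longlonglongrightarrow> 0"
      proof (rule tendsto_sandwich)
        show "eventually (\<lambda>i. 0 \<le> L (indicator (A i))) sequentially"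
          by (intro always_eventually allI L_nonneg int_ind Ai) simp
        show "eventually (\<lambda>i. L (indicator (A i)) \<le> prob (A i)) sequentially"
          by (intro always_eventually allI L_le Ai)
        show "(\<lambda>i. prob (A i)) \<longlonglongrightarrow> 0" by fact
      qed simp
      then show ?thesis
        unfolding \<nu>_def using tendsto_ennrealI[of "\<lambda>i. L (indicator (A i))" 0 sequentially] by simp
    qed
  qed
  define N where "N = measure_of (space M) (sets M) \<nu>"
  have N_sets: "sets N = sets M"
    unfolding N_def by simp
  have N: "emeasure N A = \<nu> A" if "A \<in> sets M" for A
  proof (rule emeasure_measure_of[OF N_def sets.space_closed _ _])
    show "positive (sets N) \<nu>" "countably_additive (sets N) \<nu>"
      using ca L_le[of "{}"] by (auto simp: N_sets positive_def \<nu>_def ennreal_eq_0_iff)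
    show "A \<in> sets N" using that N_sets by simp
  qed
  have N_le: "emeasure N A \<le> emeasure M A" if "A \<in> sets M" for A
    using L_le[OF that] that by (simp add: N \<nu>_def emeasure_eq_measure)
  have "absolutely_continuous M N"
    unfolding absolutely_continuous_def
  proof
    fix A assume "A \<in> null_sets M"
    then show "A \<in> null_sets N"
      using N_le[of A] by (auto simp: null_sets_def N_sets)
  qed
  then obtain h where h[measurable]: "h \<in> borel_measurable M" and hN: "density M h = N"
    using Radon_Nikodym[OF _ N_sets] by blast
  have h1: "AE x in M. h x \<le> 1"
  proof (rule ccontr)
    assume neg: "\<not> (AE x in M. h x \<le> 1)"
    \<comment> \<open>If \<open>h\<close> exceeded 1 on a set of positive measure, \<open>N\<close>
      would exceed \<open>M\<close> there, against the domination.\<close>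
    let ?B = "{x\<in>space M. 1 < h x}"
    have "emeasure N ?B \<le> emeasure M ?B"
      by (rule N_le) simp
    then have le: "(\<integral>\<^sup>+x\<in>?B. h x \<partial>M) \<le> emeasure M ?B"
      unfolding hN[symmetric] by (subst (asm) emeasure_density) auto
    have eq: "(\<integral>\<^sup>+x\<in>?B. h x \<partial>M) = (\<integral>\<^sup>+x. (h x - 1) * indicator ?B x \<partial>M) + emeasure M ?B"
    proof -
      have "(\<integral>\<^sup>+x\<in>?B. h x \<partial>M) = (\<integral>\<^sup>+x. (h x - 1) * indicator ?B x + indicator ?B x \<partial>M)"
        by (intro nn_integral_cong) (auto split: split_indicator simp: diff_add_cancel_ennreal less_imp_le)
      also have "\<dots> = (\<integral>\<^sup>+x. (h x - 1) * indicator ?B x \<partial>M) + emeasure M ?B"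
        by (subst nn_integral_add) auto
      finally show ?thesis .
    qed
    have "emeasure M ?B + (\<integral>\<^sup>+x. (h x - 1) * indicator ?B x \<partial>M) \<le> emeasure M ?B + 0"
      using le eq by (simp add: add.commute)
    then have "(\<integral>\<^sup>+x. (h x - 1) * indicator ?B x \<partial>M) = 0"
      unfolding ennreal_add_left_cancel_le using emeasure_finite[of ?B] by simp
    then have "AE x in M. (h x - 1) * indicator ?B x = 0"
      by (subst (asm) nn_integral_0_iff_AE) auto
    then have "AE x in M. h x \<le> 1"
      using AE_space
    proof eventually_elim
      case (elim x)
      show ?case
      proof (rule ccontr)
        assume "\<not> h x \<le> 1"
        with elim have "h x - 1 = 0" by (simp add: not_le)
        with \<open>\<not> h x \<le> 1\<close> show False by (metis diff_eq_0_iff_ennreal not_le)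
      qed
    qed
    with neg show False by simp
  qed
  \<comment> \<open>Truncation turns the almost everywhere bound on \<open>h\<close> into the
    pointwise bound of the claim.\<close>
  define f where "f x = enn2real (min (h x) 1)" for x
  have f[measurable]: "f \<in> borel_measurable M"
    unfolding f_def by measurable
  have f01: "0 \<le> f x" "f x \<le> 1" for x
    using enn2real_mono[of "min (h x) 1" 1] by (auto simp: f_def)
  have int_f: "integrable M (\<lambda>x. f x * \<phi> x)" if \<phi>: "integrable M \<phi>" for \<phi>
    using \<phi> by (rule Bochner_Integration.integrable_bound)
      (use \<phi> f01 in \<open>auto simp: abs_mult intro!: mult_left_le_one_le\<close>)
  have L_ind: "L (indicator A) = (\<integral>x. f x * indicator A x \<partial>M)" if A[measurable]: "A \<in> sets M" for A
  proof -
    have "ennreal (L (indicator A)) = (\<integral>\<^sup>+x. h x * indicator A x \<partial>M)"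
      using N[OF A] unfolding \<nu>_def hN[symmetric] by (simp add: emeasure_density)
    also have "\<dots> = (\<integral>\<^sup>+x. ennreal (f x * indicator A x) \<partial>M)"
      by (rule nn_integral_cong_AE, use h1 in eventually_elim)
        (auto split: split_indicator simp: f_def min_def ennreal_enn2real_if top_unique)
    also have "\<dots> = ennreal (\<integral>x. f x * indicator A x \<partial>M)"
      using f01 int_f[OF int_ind[OF A]] by (intro nn_integral_eq_integral) auto
    finally show ?thesis
      using L_nonneg[OF int_ind[OF A]] f01 by (subst (asm) ennreal_inj) (auto intro!: integral_nonneg)
  qed
  \<comment> \<open>Both sides are linear and agree on indicators; limits are handled by
    \<open>L_bound\<close> on the left and by dominated convergence on the right.\<close>
  have L_eq: "L \<phi> = (\<integral>x. f x * \<phi> x \<partial>M)" if "integrable M \<phi>" for \<phi>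
    using that
  proof (induction \<phi> rule: integrable_induct)
    case (base A c)
    then show ?case
      using L_scale[OF int_ind[OF base(1)], of c] L_ind[OF base(1)]
      by (simp add: mult.commute mult.left_commute)
  next
    case (add u v)
    then show ?case
      using L_add[OF add.hyps(1,2)] add.IH add.hyps int_f by (simp add: distrib_left)
  next
    case (lim u s)
    have u[measurable]: "u \<in> borel_measurable M" and s[measurable]: "\<And>i. s i \<in> borel_measurable M"
      using lim.hyps(1,4) by auto
    have "(\<lambda>i. L (s i)) \<longlonglongrightarrow> (\<integral>x. f x * u x \<partial>M)"
      unfolding lim.IH
    proof (rule integral_dominated_convergence[where w = "\<lambda>x. 2 * norm (u x)"])
      show "AE x in M. (\<lambda>i. f x * s i x) \<longlonglongrightarrow> f x * u x"
        using lim.hyps(2) by (auto intro!: tendsto_intros)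
      show "AE x in M. norm (f x * s i x) \<le> 2 * norm (u x)" for i
      proof (rule AE_I2)
        fix x assume "x \<in> space M"
        then have "\<bar>s i x\<bar> \<le> 2 * \<bar>u x\<bar>" using lim.hyps(3)[of x i] by simp
        moreover have "\<bar>f x * s i x\<bar> \<le> \<bar>s i x\<bar>"
          using f01[of x] by (simp add: abs_mult mult_left_le_one_le)
        ultimately show "norm (f x * s i x) \<le> 2 * norm (u x)" by simp
      qed
    qed (use lim.hyps(4) in auto)
    moreover have "(\<lambda>i. L (s i)) \<longlonglongrightarrow> L u"
    proof -
      have to_0: "(\<lambda>i. \<integral>x. \<bar>s i x - u x\<bar> \<partial>M) \<longlonglongrightarrow> (\<integral>x. 0 \<partial>M)"
      proof (rule integral_dominated_convergence[where w = "\<lambda>x. 3 * norm (u x)"])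
        show "AE x in M. (\<lambda>i. \<bar>s i x - u x\<bar>) \<longlonglongrightarrow> 0"
          using lim.hyps(2) by (auto intro!: tendsto_rabs_zero LIM_zero)
        show "AE x in M. norm \<bar>s i x - u x\<bar> \<le> 3 * norm (u x)" for i
        proof (rule AE_I2)
          fix x assume "x \<in> space M"
          from lim.hyps(3)[OF this, of i] show "norm \<bar>s i x - u x\<bar> \<le> 3 * norm (u x)" by simp
        qed
      qed (use lim.hyps(4) in auto)
      have le: "\<bar>L (s i) - L u\<bar> \<le> (\<integral>x. \<bar>s i x - u x\<bar> \<partial>M)" for i
      proof -
        have "L (s i) = L (\<lambda>x. (s i x - u x) + u x)" by simp
        also have "\<dots> = L (\<lambda>x. s i x - u x) + L u"
          using lim.hyps(1,4) by (intro L_add) auto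
        finally show ?thesis
          using L_bound[of "\<lambda>x. s i x - u x"] lim.hyps(1,4) by simp
      qed
      have "(\<lambda>i. L (s i) - L u) \<longlonglongrightarrow> 0"
        by (rule Lim_null_comparison[OF always_eventually to_0[simplified]]) (simp add: le)
      then show ?thesis
        by (rule LIM_zero_cancel)
    qed
    ultimately show ?case
      using LIMSEQ_unique by blast
  qed
  show ?thesis
    by (rule exI[of _ G], rule exI[of _ f]) (use G f f01 L L_eq in simp)
qed

lemma measurable_funpow:
  assumes "T \<in> M \<rightarrow>\<^sub>M M" shows "T ^^ k \<in> M \<rightarrow>\<^sub>M M"
  by (induction k) (use assms in \<open>auto intro: measurable_comp\<close>)

section \<open>Ergodic theory of a single transformation: invariant sets, invariant functions, visit
  frequencies\<close>

locale ergodic_nonsingular = prob_space M for M :: "'a measure" +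
  fixes T :: "'a \<Rightarrow> 'a"
  assumes T [measurable]: "T \<in> M \<rightarrow>\<^sub>M M"
    and nonsingular: "\<And>A. A \<in> null_sets M \<Longrightarrow> T -` A \<inter> space M \<in> null_sets M"
    and ergodic: "\<And>A. A \<in> sets M \<Longrightarrow> T -` A \<inter> space M = A \<Longrightarrow>
      A \<in> null_sets M \<or> space M - A \<in> null_sets M"
begin

lemma T_space: "x \<in> space M \<Longrightarrow> T x \<in> space M"
  by (rule measurable_space[OF T])

lemma AE_T:
  assumes "AE x in M. P x" shows "AE x in M. P (T x)"
proof -
  obtain N where N: "N \<in> null_sets M" "{x\<in>space M. \<not> P x} \<subseteq> N"
    using assms unfolding eventually_ae_filter by blast
  have "{x\<in>space M. \<not> P (T x)} \<subseteq> T -` N \<inter> space M"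
    using N(2) T_space by auto
  then show ?thesis
    using nonsingular[OF N(1)] unfolding eventually_ae_filter by blast
qed

text \<open>The assumption \<open>ergodic\<close> concerns strictly invariant sets only. The almost
  invariant \<open>E\<close> agrees off a null set with the set of points whose orbit visits
  \<open>E\<close> infinitely often, and that set is strictly invariant.\<close>

lemma AE_invariant_set:
  assumes E: "E \<in> sets M" and inv: "AE x in M. T x \<in> E \<longleftrightarrow> x \<in> E"
  shows "(AE x in M. x \<in> E) \<or> (AE x in M. x \<notin> E)"
proof -
  note measurable_funpow[OF T, measurable]
  \<comment> \<open>Nonsingularity carries the invariance along the orbit, so it holds for all
    powers of \<open>T\<close> off one null set.\<close>
  have all: "AE x in M. \<forall>k. (T ^^ k) x \<in> E \<longleftrightarrow> x \<in> E"
    unfolding AE_all_countable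
  proof
    fix k show "AE x in M. (T ^^ k) x \<in> E \<longleftrightarrow> x \<in> E"
    proof (induction k)
      case (Suc k)
      show ?case
        using AE_T[OF Suc] inv by eventually_elim (simp add: funpow_swap1)
    qed simp
  qed
  define E' where "E' = {x\<in>space M. \<forall>n. \<exists>k\<ge>n. (T ^^ k) x \<in> E}"
  have E'_sets: "E' \<in> sets M"
    unfolding E'_def using E by measurable
  have "T x \<in> E' \<longleftrightarrow> x \<in> E'" if "x \<in> space M" for x
  proof -
    have "(\<forall>n. \<exists>k\<ge>n. (T ^^ k) (T x) \<in> E) \<longleftrightarrow> (\<forall>n. \<exists>k\<ge>n. (T ^^ k) x \<in> E)"
    proof safe
      fix n assume "\<forall>n. \<exists>k\<ge>n. (T ^^ k) (T x) \<in> E"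
      then obtain k where "k \<ge> n" "(T ^^ k) (T x) \<in> E" by blast
      then show "\<exists>k\<ge>n. (T ^^ k) x \<in> E"
        by (intro exI[of _ "Suc k"]) (simp add: funpow_swap1)
    next
      fix n assume "\<forall>n. \<exists>k\<ge>n. (T ^^ k) x \<in> E"
      then obtain k where "k \<ge> Suc n" "(T ^^ k) x \<in> E" by blast
      then show "\<exists>k\<ge>n. (T ^^ k) (T x) \<in> E"
        by (intro exI[of _ "k - 1"]) (cases k, auto simp: funpow_swap1)
    qed
    with that T_space show ?thesis by (simp add: E'_def)
  qed
  then have "T -` E' \<inter> space M = E'"
    using E'_def by auto
  then have "E' \<in> null_sets M \<or> space M - E' \<in> null_sets M"
    by (rule ergodic[OF E'_sets])
  moreover have E'_E: "AE x in M. x \<in> E' \<longleftrightarrow> x \<in> E"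
    using all AE_space by eventually_elim (auto simp: E'_def)
  ultimately show ?thesis
  proof (elim disjE)
    assume "E' \<in> null_sets M"
    from AE_not_in[OF this] E'_E have "AE x in M. x \<notin> E" by eventually_elim simp
    then show ?thesis ..
  next
    assume "space M - E' \<in> null_sets M"
    from AE_not_in[OF this] E'_E AE_space have "AE x in M. x \<in> E" by eventually_elim simp
    then show ?thesis ..
  qed
qed

text \<open>The sets where \<open>f\<close> lies above or below its mean are almost invariant.
  Neither can have full measure, since the mean would then be strictly greater or smaller than
  itself, so both are null.\<close>

lemma AE_invariant_const:
  fixes f :: "'a \<Rightarrow> real"
  assumes f: "integrable M f" and inv: "AE x in M. f (T x) = f x"
  shows "AE x in M. f x = expectation f"
proof -
  let ?c = "expectation f"
  have [measurable]: "f \<in> borel_measurable M" using f by auto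
  have "AE x in M. \<not> ?c < f x"
  proof (rule ccontr)
    assume neg: "\<not> (AE x in M. \<not> ?c < f x)"
    have "AE x in M. T x \<in> {x\<in>space M. ?c < f x} \<longleftrightarrow> x \<in> {x\<in>space M. ?c < f x}"
      using inv AE_space by eventually_elim (simp add: T_space)
    then have "(AE x in M. x \<in> {x\<in>space M. ?c < f x}) \<or> (AE x in M. x \<notin> {x\<in>space M. ?c < f x})"
      by (rule AE_invariant_set[rotated]) measurable
    then have "AE x in M. ?c < f x"
    proof
      assume "AE x in M. x \<notin> {x\<in>space M. ?c < f x}"
      then have "AE x in M. \<not> ?c < f x" using AE_space by eventually_elim simp
      with neg show ?thesis by simp
    qed simp
    then have "expectation (\<lambda>_. ?c) < expectation f"
      by (intro integral_less_AE_space f) (simp_all add: emeasure_space_1)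
    then show False by (simp add: prob_space)
  qed
  moreover have "AE x in M. \<not> f x < ?c"
  proof (rule ccontr)
    assume neg: "\<not> (AE x in M. \<not> f x < ?c)"
    have "AE x in M. T x \<in> {x\<in>space M. f x < ?c} \<longleftrightarrow> x \<in> {x\<in>space M. f x < ?c}"
      using inv AE_space by eventually_elim (simp add: T_space)
    then have "(AE x in M. x \<in> {x\<in>space M. f x < ?c}) \<or> (AE x in M. x \<notin> {x\<in>space M. f x < ?c})"
      by (rule AE_invariant_set[rotated]) measurable
    then have "AE x in M. f x < ?c"
    proof
      assume "AE x in M. x \<notin> {x\<in>space M. f x < ?c}"
      then have "AE x in M. \<not> f x < ?c" using AE_space by eventually_elim simp
      with neg show ?thesis by simp
    qed simp
    then have "expectation f < expectation (\<lambda>_. ?c)"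
      by (intro integral_less_AE_space f) (simp_all add: emeasure_space_1)
    then show False by (simp add: prob_space)
  qed
  ultimately show ?thesis
    by eventually_elim simp
qed

definition visits :: "nat \<Rightarrow> 'a set \<Rightarrow> 'a \<Rightarrow> real" where
  "visits n B x = (\<Sum>k<n. indicator B ((T ^^ k) x)) / real n"

lemma borel_measurable_visits [measurable]:
  assumes [measurable]: "B \<in> sets M" shows "visits n B \<in> borel_measurable M"
proof -
  have [measurable]: "T ^^ k \<in> M \<rightarrow>\<^sub>M M" for k by (rule measurable_funpow[OF T])
  show ?thesis
    unfolding visits_def[abs_def] by measurable
qed

lemma visits_bounds: "0 \<le> visits n B x" "visits n B x \<le> 1"
proof -
  have "(\<Sum>k<n. indicator B ((T ^^ k) x)) \<le> (\<Sum>k<n. 1 :: real)"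
    by (intro sum_mono) (auto split: split_indicator)
  then show "visits n B x \<le> 1"
    unfolding visits_def by (cases "n = 0") (auto simp: divide_le_eq_1)
qed (auto simp: visits_def intro!: sum_nonneg divide_nonneg_nonneg)

lemma visits_T: "\<bar>visits n B (T x) - visits n B x\<bar> \<le> 1 / real n"
proof -
  have "(\<Sum>k<n. indicator B ((T ^^ k) (T x))) - (\<Sum>k<n. indicator B ((T ^^ k) x)) =
      indicator B ((T ^^ n) x) - (indicator B x :: real)"
    unfolding sum_subtractf[symmetric]
    using sum_lessThan_telescope[of "\<lambda>k. indicator B ((T ^^ k) x) :: real" n]
    by (simp add: funpow_swap1)
  then have "visits n B (T x) - visits n B x = (indicator B ((T ^^ n) x) - indicator B x) / real n"
    unfolding visits_def by (simp flip: diff_divide_distrib)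
  then show ?thesis
    by (auto split: split_indicator)
qed

text \<open>
  A weak* cluster point \<open>f\<close> of the visit frequencies satisfies \<open>f \<circ> T = f\<close>, because composition
  with the nonsingular map \<open>T\<close> is dual to the transfer operator on \<open>L\<^sup>1\<close>.
\<close>

lemma weak_star_limit_visits_invariant:
  assumes G: "G \<noteq> bot" "G \<le> sequentially" and B: "\<And>n. B n \<in> sets M"
    and f: "f \<in> borel_measurable M" "\<And>x. 0 \<le> f x" "\<And>x. f x \<le> (1::real)"
    and lim: "\<And>\<phi>. integrable M \<phi> \<Longrightarrow>
      ((\<lambda>n. \<integral>x. visits n (B n) x * \<phi> x \<partial>M) \<longlongrightarrow> (\<integral>x. f x * \<phi> x \<partial>M)) G"
  shows "AE x in M. f (T x) = f x"
proof (rule density_unique_real)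
  note f(1)[measurable] B[measurable]
  have bdd: "integrable M u" if "u \<in> borel_measurable M" "\<And>x. 0 \<le> u x" "\<And>x. u x \<le> 1" for u :: "'a \<Rightarrow> real"
    by (rule integrable_const_bound[where B = 1]) (use that in auto)
  show "integrable M f" "integrable M (\<lambda>x. f (T x))"
    using f by (auto intro!: bdd)
  fix A assume A[measurable]: "A \<in> sets M"
  \<comment> \<open>The density of this image measure with respect to \<open>M\<close> is the
    transfer operator applied to the indicator of \<open>A\<close>; it exists by
    nonsingularity.\<close>
  let ?N = "distr (density M (indicator A)) M T"
  interpret A: finite_measure "density M (indicator A)"
    by (rule finite_measureI) (simp add: emeasure_density less_top[symmetric])
  have T_A: "T \<in> density M (indicator A) \<rightarrow>\<^sub>M M"
    by simp
  have N: "finite_measure ?N" "sets ?N = sets M"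
    using A.finite_measure_distr[OF T_A] by simp_all
  have ac: "absolutely_continuous M ?N"
    unfolding absolutely_continuous_def
  proof
    fix S assume S: "S \<in> null_sets M"
    then have [measurable]: "S \<in> sets M" by auto
    have "emeasure ?N S = (\<integral>\<^sup>+x. indicator A x * indicator (T -` S \<inter> space M) x \<partial>M)"
      by (simp add: emeasure_distr[OF T_A] emeasure_density)
    also have "\<dots> \<le> (\<integral>\<^sup>+x. indicator (T -` S \<inter> space M) x \<partial>M)"
      by (intro nn_integral_mono) (auto split: split_indicator)
    also have "\<dots> = 0"
      using nonsingular[OF S] by auto
    finally show "S \<in> null_sets ?N" by (auto simp: null_sets_def)
  qed
  obtain \<phi> :: "'a \<Rightarrow> real" where \<phi>: "integrable M \<phi>" "\<And>u. u \<in> borel_measurable M \<Longrightarrow> integral\<^sup>L ?N u = (\<integral>x. \<phi> x * u x \<partial>M)"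
    by (rule finite_measure_real_density[OF N(1) ac N(2)]) (rule that)
  have dual: "(\<integral>x. u x * \<phi> x \<partial>M) = (\<integral>x. u (T x) * indicator A x \<partial>M)"
    if u[measurable]: "u \<in> borel_measurable M" for u :: "'a \<Rightarrow> real"
  proof -
    have "(\<integral>x. u x * \<phi> x \<partial>M) = integral\<^sup>L ?N u"
      using \<phi>(2)[OF u] by (simp add: mult.commute)
    also have "\<dots> = integral\<^sup>L (density M (indicator A)) (\<lambda>x. u (T x))"
      by (rule integral_distr[OF T_A u])
    also have "density M (indicator A) = density M (\<lambda>x. ennreal (indicator A x))"
      by (simp add: ennreal_indicator)
    also have "integral\<^sup>L \<dots> (\<lambda>x. u (T x)) = (\<integral>x. u (T x) * indicator A x \<partial>M)"
      by (subst integral_density) (auto simp: mult.commute)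
    finally show ?thesis .
  qed
  have int_A: "integrable M (indicator A :: 'a \<Rightarrow> real)"
    by (rule bdd) auto
  have "((\<lambda>n. \<integral>x. visits n (B n) (T x) * indicator A x \<partial>M) \<longlongrightarrow> (\<integral>x. f (T x) * indicator A x \<partial>M)) G"
    using lim[OF \<phi>(1)] by (simp add: dual)
  \<comment> \<open>Replacing \<open>x\<close> by \<open>T x\<close> changes a visit frequency by at
    most \<open>1 / n\<close>, which vanishes along \<open>G\<close> because \<open>G\<close>
    refines \<open>sequentially\<close>.\<close>
  moreover have "((\<lambda>n. \<integral>x. visits n (B n) (T x) * indicator A x \<partial>M) \<longlongrightarrow> (\<integral>x. f x * indicator A x \<partial>M)) G"
  proof -
    have "\<bar>(\<integral>x. visits n (B n) (T x) * indicator A x \<partial>M) - (\<integral>x. visits n (B n) x * indicator A x \<partial>M)\<bar> \<le> 1 / real n" for n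
    proof -
      have i: "integrable M (\<lambda>x. visits n (B n) (T x) * indicator A x)"
        "integrable M (\<lambda>x. visits n (B n) x * indicator A x)"
        using visits_bounds by (auto intro!: bdd mult_le_one split: split_indicator)
      have "\<bar>(\<integral>x. visits n (B n) (T x) * indicator A x \<partial>M) - (\<integral>x. visits n (B n) x * indicator A x \<partial>M)\<bar> =
          \<bar>\<integral>x. (visits n (B n) (T x) - visits n (B n) x) * indicator A x \<partial>M\<bar>"
        using i by (simp add: left_diff_distrib)
      also have "\<dots> \<le> (\<integral>x. \<bar>(visits n (B n) (T x) - visits n (B n) x) * indicator A x\<bar> \<partial>M)"
        by (rule integral_abs_bound)
      also have "\<dots> \<le> (\<integral>x. 1 / real n \<partial>M)"
        using visits_T by (intro integral_mono') (auto split: split_indicator)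
      finally show ?thesis by (simp add: prob_space)
    qed
    then have "(\<lambda>n. (\<integral>x. visits n (B n) (T x) * indicator A x \<partial>M) - (\<integral>x. visits n (B n) x * indicator A x \<partial>M)) \<longlonglongrightarrow> 0"
      by (intro Lim_null_comparison[OF _ lim_1_over_n]) auto
    then have "((\<lambda>n. (\<integral>x. visits n (B n) (T x) * indicator A x \<partial>M) - (\<integral>x. visits n (B n) x * indicator A x \<partial>M)) \<longlongrightarrow> 0) G"
      by (rule tendsto_mono[OF G(2)])
    from tendsto_add[OF this lim[OF int_A]] show ?thesis by simp
  qed
  ultimately have "(\<integral>x. f (T x) * indicator A x \<partial>M) = (\<integral>x. f x * indicator A x \<partial>M)"
    by (rule tendsto_unique[OF G(1)])
  then show "(\<integral>x\<in>A. f (T x) \<partial>M) = (\<integral>x\<in>A. f x \<partial>M)"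
    by (simp add: set_lebesgue_integral_def mult.commute)
qed

text \<open>The bound is uniform in \<open>B\<close>, as total variation requires; convergence for
  each fixed \<open>B\<close> would not give it. The sets that violate the bound may vary with
  \<open>n\<close>, so compactness is applied to \<open>visits n (B n)\<close> and not to averages
  of one function.\<close>

lemma averages_merge:
  assumes m1: "prob_space m1" "sets m1 = sets M" "absolutely_continuous M m1"
    and m2: "prob_space m2" "sets m2 = sets M" "absolutely_continuous M m2"
    and \<epsilon>: "0 < \<epsilon>"
  shows "\<exists>N. \<forall>n\<ge>N. \<forall>B\<in>sets M.
    \<bar>(\<Sum>k<n. measure m1 ((T ^^ k) -` B \<inter> space M)) - (\<Sum>k<n. measure m2 ((T ^^ k) -` B \<inter> space M))\<bar> \<le> \<epsilon> * real n"
proof (rule ccontr)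
  let ?d = "\<lambda>n B. (\<Sum>k<n. measure m1 ((T ^^ k) -` B \<inter> space M)) - (\<Sum>k<n. measure m2 ((T ^^ k) -` B \<inter> space M))"
  assume neg: "\<not> ?thesis"
  define I where "I = {n. \<exists>B\<in>sets M. \<epsilon> * real n < \<bar>?d n B\<bar>}"
  have "infinite I"
    unfolding infinite_nat_iff_unbounded_le I_def using neg by (auto simp: not_le)
  \<comment> \<open>A violating set where there is one; the empty set elsewhere keeps every
    \<open>B n\<close> measurable.\<close>
  define B where "B n = (if n \<in> I then SOME B. B \<in> sets M \<and> \<epsilon> * real n < \<bar>?d n B\<bar> else {})" for n
  have BI: "B n \<in> sets M \<and> \<epsilon> * real n < \<bar>?d n (B n)\<bar>" if "n \<in> I" for n
  proof -
    have "\<exists>B. B \<in> sets M \<and> \<epsilon> * real n < \<bar>?d n B\<bar>" using that unfolding I_def by blast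
    from someI_ex[OF this] show ?thesis using that by (simp add: B_def)
  qed
  have B: "B n \<in> sets M" for n
    using BI[of n] by (cases "n \<in> I") (auto simp: B_def)
  note B[measurable]
  have ex: "\<exists>G f. G \<noteq> bot \<and> G \<le> sequentially \<and> eventually (\<lambda>n. n \<in> I) G \<and>
    f \<in> borel_measurable M \<and> (\<forall>x. 0 \<le> f x \<and> f x \<le> (1::real)) \<and>
    (\<forall>\<phi>. integrable M \<phi> \<longrightarrow> ((\<lambda>n. \<integral>x. visits n (B n) x * \<phi> x \<partial>M) \<longlongrightarrow> (\<integral>x. f x * \<phi> x \<partial>M)) G)"
    by (rule weak_star_cluster[OF _ _ _ \<open>infinite I\<close>]) (use B visits_bounds in auto)
  obtain G f where Gf: "G \<noteq> bot \<and> G \<le> sequentially \<and> eventually (\<lambda>n. n \<in> I) G \<and>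
    f \<in> borel_measurable M \<and> (\<forall>x. 0 \<le> f x \<and> f x \<le> (1::real)) \<and>
    (\<forall>\<phi>. integrable M \<phi> \<longrightarrow> ((\<lambda>n. \<integral>x. visits n (B n) x * \<phi> x \<partial>M) \<longlongrightarrow> (\<integral>x. f x * \<phi> x \<partial>M)) G)"
    using ex by (elim exE) (rule that)
  then have G: "G \<noteq> bot" "G \<le> sequentially" "eventually (\<lambda>n. n \<in> I) G"
    and f[measurable]: "f \<in> borel_measurable M" and f01: "\<And>x. 0 \<le> f x \<and> f x \<le> (1::real)"
    and lim: "\<And>\<phi>. integrable M \<phi> \<Longrightarrow>
      ((\<lambda>n. \<integral>x. visits n (B n) x * \<phi> x \<partial>M) \<longlongrightarrow> (\<integral>x. f x * \<phi> x \<partial>M)) G"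
    by simp_all
  have "AE x in M. f (T x) = f x"
    by (rule weak_star_limit_visits_invariant[OF G(1,2) B f _ _ lim]) (use f01 in auto)
  moreover have "integrable M f"
    by (rule integrable_const_bound[where B = 1]) (use f01 in auto)
  ultimately have const: "AE x in M. f x = expectation f"
    by (intro AE_invariant_const)
  \<comment> \<open>The limit is the same for \<open>m1\<close> and \<open>m2\<close>, since
    \<open>f\<close> is almost everywhere constant and the density of \<open>m\<close> has integral
    1.\<close>
  have lim_m: "((\<lambda>n. (\<Sum>k<n. measure m ((T ^^ k) -` B n \<inter> space M)) / real n) \<longlongrightarrow> expectation f) G"
    if m: "prob_space m" "sets m = sets M" "absolutely_continuous M m" for m
  proof -
    interpret m: prob_space m by fact
    have [simp]: "space m = space M" using sets_eq_imp_space_eq[OF m(2)] .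
    obtain \<phi> :: "'a \<Rightarrow> real" where \<phi>: "integrable M \<phi>" "\<And>u. u \<in> borel_measurable M \<Longrightarrow> integral\<^sup>L m u = (\<integral>x. \<phi> x * u x \<partial>M)"
      by (rule finite_measure_real_density[OF m.finite_measure_axioms m(3,2)]) (rule that)
    have "(\<integral>x. visits n (B n) x * \<phi> x \<partial>M) = (\<Sum>k<n. measure m ((T ^^ k) -` B n \<inter> space M)) / real n" for n
    proof -
      have meas: "(T ^^ k) -` B n \<inter> space M \<in> sets m" for k
        using measurable_sets[OF measurable_funpow[OF T] B] m(2) by simp
      have "(\<integral>x. visits n (B n) x * \<phi> x \<partial>M) = integral\<^sup>L m (visits n (B n))"
        using \<phi>(2)[of "visits n (B n)"] by (simp add: mult.commute)
      also have "\<dots> = (\<integral>x. (\<Sum>k<n. indicator ((T ^^ k) -` B n \<inter> space M) x) / real n \<partial>m)"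
        by (intro Bochner_Integration.integral_cong refl) (simp add: visits_def indicator_def)
      also have "\<dots> = (\<Sum>k<n. measure m ((T ^^ k) -` B n \<inter> space M)) / real n"
        using meas by (simp add: m.emeasure_eq_measure Bochner_Integration.integral_sum)
      finally show ?thesis .
    qed
    moreover have "(\<integral>x. f x * \<phi> x \<partial>M) = expectation f"
    proof -
      have "(\<integral>x. f x * \<phi> x \<partial>M) = (\<integral>x. expectation f * \<phi> x \<partial>M)"
        using const \<phi>(1) by (intro integral_cong_AE) (auto)
      also have "\<dots> = expectation f * (\<integral>x. \<phi> x * 1 \<partial>M)"
        by simp
      also have "(\<integral>x. \<phi> x * 1 \<partial>M) = 1"
        using \<phi>(2)[of "\<lambda>_. 1"] m.prob_space by simp
      finally show ?thesis by simp
    qed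
    ultimately show ?thesis using lim[OF \<phi>(1)] by simp
  qed
  have "((\<lambda>n. ?d n (B n) / real n) \<longlongrightarrow> expectation f - expectation f) G"
    using tendsto_diff[OF lim_m[OF m1] lim_m[OF m2]] by (simp add: diff_divide_distrib)
  then have "eventually (\<lambda>n. \<bar>?d n (B n) / real n\<bar> < \<epsilon>) G"
    using \<epsilon> by (auto dest!: tendstoD simp: dist_real_def)
  with G(3) have "eventually (\<lambda>_. False) G"
  proof eventually_elim
    case (elim n)
    then have "\<epsilon> * real n < \<bar>?d n (B n)\<bar>" using BI by blast
    moreover from this have "0 < n" by (cases "n = 0") auto
    ultimately show ?case using elim(2) by (simp add: abs_divide pos_divide_less_eq)
  qed
  with G(1) show False by simp
qed

end

section \<open>Path laws of Markov chains\<close>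

abbreviation path_space :: "(nat \<Rightarrow> 'a::topological_space) measure" where
  "path_space \<equiv> \<Pi>\<^sub>M n\<in>UNIV. borel"

definition path_cylinder :: "'a set \<Rightarrow> 'a set list \<Rightarrow> (nat \<Rightarrow> 'a) set" where
  "path_cylinder A As = {\<omega>. \<omega> 0 \<in> A \<and> (\<forall>i<length As. \<omega> (Suc i) \<in> As ! i)}"

lemma space_path_space [simp]: "space path_space = UNIV"
  by (simp add: space_PiM)

lemma path_cylinder_sets [measurable]:
  fixes A :: "'a::topological_space set"
  assumes "A \<in> sets borel" "set As \<subseteq> sets borel"
  shows "path_cylinder A As \<in> sets path_space"
proof -
  have [measurable]: "As ! i \<in> sets borel" if "i < length As" for i
    using assms that by auto
  note assms(1)[measurable]
  have "Measurable.pred path_space (\<lambda>\<omega>. \<omega> 0 \<in> A \<and> (\<forall>i\<in>{..<length As}. \<omega> (Suc i) \<in> As ! i))"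
    by measurable
  then show ?thesis
    by (simp add: pred_def path_cylinder_def Ball_def)
qed

definition path_cylinders :: "(nat \<Rightarrow> 'a::topological_space) set set" where
  "path_cylinders = {path_cylinder A As | A As. A \<in> sets borel \<and> set As \<subseteq> sets borel}"

text \<open>One family of sets on a prefix \<open>i < n\<close> replaces the separate roles of time
  0 and of the list, which makes intersections of cylinders transparent.\<close>

lemma path_cylindersI:
  assumes B: "\<And>i. B i \<in> sets borel"
  shows "{\<omega>. \<forall>i<n. \<omega> i \<in> B i} \<in> path_cylinders"
proof (cases n)
  case 0
  have "{\<omega>. \<forall>i<n. \<omega> i \<in> B i} = path_cylinder UNIV []"
    by (auto simp: 0 path_cylinder_def)
  then show ?thesis
    unfolding path_cylinders_def by (intro CollectI exI[of _ UNIV] exI[of _ "[]"]) simp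
next
  case (Suc m)
  have "{\<omega>. \<forall>i<n. \<omega> i \<in> B i} = path_cylinder (B 0) (map (\<lambda>i. B (Suc i)) [0..<m])"
    unfolding path_cylinder_def Suc by (auto simp: less_Suc_eq_0_disj)
  then show ?thesis
    using B unfolding path_cylinders_def
    by (intro CollectI exI[of _ "B 0"] exI[of _ "map (\<lambda>i. B (Suc i)) [0..<m]"]) auto
qed

lemma path_cylindersE:
  assumes "c \<in> path_cylinders"
  obtains B n where "\<And>i. B i \<in> sets borel" "c = {\<omega>. \<forall>i<n. \<omega> i \<in> B i}"
proof -
  obtain A As where A: "c = path_cylinder A As" "A \<in> sets borel" "set As \<subseteq> sets borel"
    using assms unfolding path_cylinders_def by blast
  let ?B = "\<lambda>i. if i < Suc (length As) then (A # As) ! i else UNIV"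
  have "?B i \<in> sets borel" for i
    using A(2,3) by (auto simp: nth_Cons split: nat.split)
  moreover have "c = {\<omega>. \<forall>i<Suc (length As). \<omega> i \<in> ?B i}"
    unfolding A(1) path_cylinder_def by (auto simp: less_Suc_eq_0_disj)
  ultimately show thesis by (rule that)
qed

lemma Int_stable_path_cylinders: "Int_stable path_cylinders"
proof (rule Int_stableI)
  fix a b :: "(nat \<Rightarrow> 'a::topological_space) set"
  assume "a \<in> path_cylinders" "b \<in> path_cylinders"
  obtain A m where A: "\<And>i. A i \<in> sets borel" "a = {\<omega>. \<forall>i<m. \<omega> i \<in> A i}"
    by (rule path_cylindersE[OF \<open>a \<in> path_cylinders\<close>]) (rule that)
  obtain B n where B: "\<And>i. B i \<in> sets borel" "b = {\<omega>. \<forall>i<n. \<omega> i \<in> B i}"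
    by (rule path_cylindersE[OF \<open>b \<in> path_cylinders\<close>]) (rule that)
  \<comment> \<open>The shorter prefix is padded with \<open>UNIV\<close>.\<close>
  let ?C = "\<lambda>i. (if i < m then A i else UNIV) \<inter> (if i < n then B i else UNIV)"
  have "?C i \<in> sets borel" for i
    using A(1) B(1) by simp
  moreover have "a \<inter> b = {\<omega>. \<forall>i<max m n. \<omega> i \<in> ?C i}"
  proof (intro set_eqI iffI)
    fix \<omega> assume \<omega>: "\<omega> \<in> {\<omega>. \<forall>i<max m n. \<omega> i \<in> ?C i}"
    have "\<omega> i \<in> A i" if "i < m" for i
    proof -
      have "\<omega> i \<in> ?C i" using \<omega> that by (simp add: less_max_iff_disj)
      with that show ?thesis by simp
    qed
    moreover have "\<omega> i \<in> B i" if "i < n" for i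
    proof -
      have "\<omega> i \<in> ?C i" using \<omega> that by (simp add: less_max_iff_disj)
      with that show ?thesis by simp
    qed
    ultimately show "\<omega> \<in> a \<inter> b" using A(2) B(2) by simp
  qed (use A(2) B(2) in simp)
  ultimately show "a \<inter> b \<in> path_cylinders"
    using path_cylindersI[of ?C "max m n"] by simp
qed

lemma sets_path_space: "sets path_space = sigma_sets UNIV path_cylinders"
proof
  have "path_cylinders \<subseteq> sets (path_space :: (nat \<Rightarrow> 'a) measure)"
    unfolding path_cylinders_def by (auto intro: path_cylinder_sets)
  then show "sigma_sets UNIV path_cylinders \<subseteq> sets (path_space :: (nat \<Rightarrow> 'a) measure)"
    using sets.sigma_sets_subset[of path_cylinders "path_space :: (nat \<Rightarrow> 'a) measure"] by simp
  have "{f. f i \<in> A} \<in> path_cylinders" if "A \<in> sets borel" for i and A :: "'a set"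
  proof -
    have "{f. f i \<in> A} = {\<omega>. \<forall>j<Suc i. \<omega> j \<in> (if j = i then A else UNIV)}" by auto
    moreover have "(if j = i then A else UNIV) \<in> sets borel" for j using that by simp
    ultimately show ?thesis
      using path_cylindersI[of "\<lambda>j. if j = i then A else UNIV" "Suc i"] by simp
  qed
  then show "sets (path_space :: (nat \<Rightarrow> 'a) measure) \<subseteq> sigma_sets UNIV path_cylinders"
    unfolding sets_PiM_single by (auto intro!: sigma_sets_mono)
qed

text \<open>The initial measure, hence the path measure, may be infinite; the sets
  \<open>S i\<close>, imposed at time 0, provide the exhaustion that uniqueness on a \<pi>-system
  needs.\<close>

lemma path_measure_eqI:
  fixes M N :: "(nat \<Rightarrow> 'a::topological_space) measure"
  assumes M: "sets M = sets path_space" and N: "sets N = sets path_space"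
    and eq: "\<And>A As. A \<in> sets borel \<Longrightarrow> set As \<subseteq> sets borel \<Longrightarrow>
      emeasure M (path_cylinder A As) = emeasure N (path_cylinder A As)"
    and S: "\<And>i::nat. S i \<in> sets borel" "(\<Union>i. S i) = UNIV"
      "\<And>i. emeasure M (path_cylinder (S i) []) \<noteq> \<infinity>"
  shows "M = N"
proof (rule measure_eqI_generator_eq[OF Int_stable_path_cylinders])
  show "(\<Union>i. path_cylinder (S i) []) = UNIV"
    using S(2) unfolding path_cylinder_def by auto
  show "range (\<lambda>i. path_cylinder (S i) []) \<subseteq> path_cylinders"
    using S(1) unfolding path_cylinders_def by fastforce
  show "emeasure M X = emeasure N X" if "X \<in> path_cylinders" for X
    using that eq unfolding path_cylinders_def by blast
  show "sets M = sigma_sets UNIV path_cylinders" "sets N = sigma_sets UNIV path_cylinders"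
    using M N by (simp_all only: sets_path_space)
  show "emeasure M (path_cylinder (S i) []) \<noteq> \<infinity>" for i
    by (rule S(3))
qed simp

lemma path_measure_eqI_finite:
  fixes M N :: "(nat \<Rightarrow> 'a::topological_space) measure"
  assumes "sets M = sets path_space" "sets N = sets path_space"
    and "\<And>A As. A \<in> sets borel \<Longrightarrow> set As \<subseteq> sets borel \<Longrightarrow>
      emeasure M (path_cylinder A As) = emeasure N (path_cylinder A As)"
    and "finite_measure M"
  shows "M = N"
proof (rule path_measure_eqI[where S = "\<lambda>_. UNIV", OF assms(1,2,3)])
  show "emeasure M (path_cylinder UNIV []) \<noteq> \<infinity>"
    using finite_measure.emeasure_finite[OF assms(4)] by simp
qed simp_all

section \<open>Existence of path laws for a Borel kernel\<close>

lemma borel_measurable_cylinder_prob: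
  assumes p[measurable]: "p \<in> borel \<rightarrow>\<^sub>M prob_algebra borel" and As: "set As \<subseteq> sets borel"
  shows "cylinder_prob p As \<in> borel_measurable borel"
  using As
proof (induction As)
  case Nil
  have "cylinder_prob p [] = (\<lambda>_. 1)" by (simp add: fun_eq_iff)
  then show ?case by simp
next
  case (Cons A As)
  then have [measurable]: "A \<in> sets borel" "cylinder_prob p As \<in> borel_measurable borel"
    by auto
  have [measurable]: "p \<in> borel \<rightarrow>\<^sub>M subprob_algebra borel"
    by (rule measurable_prob_algebraD[OF p])
  show ?case
    by (simp add: measurable_compose[OF _ nn_integral_measurable_subprob_algebra])
qed

text \<open>The laws from all starting points form one kernel, so that
  \<open>\<nu> \<bind> K\<close> is the path law with initial measure \<nu>; the coordinate at time
  0 is the starting point itself.\<close>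

definition is_markov_law ::
    "('a::topological_space \<Rightarrow> 'a measure) \<Rightarrow> ('a \<Rightarrow> (nat \<Rightarrow> 'a) measure) \<Rightarrow> bool" where
  "is_markov_law p K \<longleftrightarrow> K \<in> borel \<rightarrow>\<^sub>M prob_algebra path_space \<and>
     (\<forall>g A As. A \<in> sets borel \<longrightarrow> set As \<subseteq> sets borel \<longrightarrow>
        emeasure (K g) (path_cylinder A As) = indicator A g * cylinder_prob p As g)"

text \<open>The Ionescu-Tulcea theorem provides the measure on infinite paths; the work is to
  identify its cylinder probabilities with the recursion \<open>cylinder_prob\<close>.\<close>

lemma ex_markov_law_from:
  fixes p :: "'a::topological_space \<Rightarrow> 'a measure" and g :: 'a
  assumes p[measurable]: "p \<in> borel \<rightarrow>\<^sub>M prob_algebra borel"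
  shows "\<exists>L. prob_space L \<and> sets L = sets path_space \<and>
    (\<forall>A As. A \<in> sets borel \<longrightarrow> set As \<subseteq> sets borel \<longrightarrow>
        emeasure L (path_cylinder A As) = indicator A g * cylinder_prob p As g)"
proof -
  have ps[measurable]: "p \<in> borel \<rightarrow>\<^sub>M subprob_algebra borel"
    by (rule measurable_prob_algebraD[OF p])
  have pprob: "prob_space (p h)" for h
    using measurable_space[OF p, of h] by (auto simp: space_prob_algebra)
  \<comment> \<open>Coordinate 0 is the point mass at \<open>g\<close>, so coordinate
    \<open>n\<close> is drawn by the transition out of coordinate \<open>n - 1\<close>.\<close>
  define P where "P = (\<lambda>n (\<omega> :: nat \<Rightarrow> 'a). if n = 0 then return borel g else p (\<omega> (n - 1)))"
  have P_meas: "P i \<in> PiM {0..<i} (\<lambda>_. borel) \<rightarrow>\<^sub>M subprob_algebra borel" for i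
  proof -
    show "P i \<in> PiM {0..<i} (\<lambda>_. borel) \<rightarrow>\<^sub>M subprob_algebra borel"
    proof (cases i)
      case 0
      then show ?thesis
        by (simp add: P_def space_subprob_algebra prob_space_return prob_space_imp_subprob_space)
    next
      case (Suc m)
      then have "(\<lambda>\<omega>. p (\<omega> m)) \<in> PiM {0..<i} (\<lambda>_. borel) \<rightarrow>\<^sub>M subprob_algebra borel"
        by (intro measurable_compose[OF _ ps] measurable_component_singleton) auto
      then show ?thesis by (simp add: P_def Suc)
    qed
  qed
  have P_prob: "prob_space (P i x)" for i x
    by (simp add: P_def prob_space_return pprob)
  interpret I: Ionescu_Tulcea P "\<lambda>_. borel :: 'a measure"
    using P_meas P_prob by (rule Ionescu_Tulcea.intro)
  let ?S = "\<lambda>n::nat. PiM {0..<n} (\<lambda>_. borel :: 'a measure)"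
  let ?E = "\<lambda>n X As. {\<omega> \<in> space (?S (n + length As)).
     restrict \<omega> {0..<n} \<in> X \<and> (\<forall>i<length As. \<omega> (n + i) \<in> As ! i)}"
  have E_sets: "?E n X As \<in> sets (?S (n + length As))"
    if X[measurable]: "X \<in> sets (?S n)" and As: "set As \<subseteq> sets borel" for n X As
  proof -
    have [measurable]: "As ! i \<in> sets borel" if "i < length As" for i
      using As that by auto
    have "(\<lambda>\<omega>. restrict \<omega> {0..<n}) \<in> ?S (n + length As) \<rightarrow>\<^sub>M ?S n"
      by (intro measurable_restrict_subset) auto
    then have [measurable]: "Measurable.pred (?S (n + length As)) (\<lambda>\<omega>. restrict \<omega> {0..<n} \<in> X)"
      using X by measurable
    have [measurable]: "Measurable.pred (?S (n + length As)) (\<lambda>\<omega>. \<omega> (n + i) \<in> As ! i)"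
      if i: "i < length As" for i
    proof -
      have "(\<lambda>\<omega>. \<omega> (n + i)) \<in> ?S (n + length As) \<rightarrow>\<^sub>M borel"
        by (rule measurable_component_singleton) (use i in simp)
      then show ?thesis using i by measurable
    qed
    have "Measurable.pred (?S (n + length As)) (\<lambda>\<omega>. restrict \<omega> {0..<n} \<in> X \<and>
       (\<forall>i\<in>{..<length As}. \<omega> (n + i) \<in> As ! i))"
      by measurable
    then show ?thesis by (simp add: pred_def)
  qed
  \<comment> \<open>Given the first \<open>n > 0\<close> coordinates, the next ones depend on the
    last of them only. In the induction the head of the list is absorbed into the prefix set
    \<open>?Y\<close>, so the hypothesis is used at \<open>Suc n\<close>.\<close>
  have C: "emeasure (I.C n (length As) \<omega>) (?E n X As) = indicator X \<omega> * cylinder_prob p As (\<omega> (n - 1))"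
    if "0 < n" "\<omega> \<in> space (?S n)" "X \<in> sets (?S n)" "set As \<subseteq> sets borel" for n X As \<omega>
    using that
  proof (induction As arbitrary: n X \<omega>)
    case Nil
    have "?E n X [] = X"
      using sets.sets_into_space[OF Nil(3)] by (auto simp: space_PiM PiE_def extensional_restrict)
    then show ?case using Nil by (simp del: restrict_apply)
  next
    case (Cons B As)
    let ?Y = "{\<omega>1 \<in> space (?S (Suc n)). restrict \<omega>1 {0..<n} \<in> X \<and> \<omega>1 n \<in> B}"
    have B[measurable]: "B \<in> sets borel" and As: "set As \<subseteq> sets borel" using Cons.prems by auto
    note \<omega>[simp] = Cons.prems(2)
    have Y: "?Y \<in> sets (?S (Suc n))"
      using E_sets[of X n "[B]"] Cons.prems by simp
    note [measurable] = borel_measurable_cylinder_prob[OF p As]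
    have Eeq: "?E n X (B # As) = ?E (Suc n) ?Y As"
      by (auto simp: space_PiM PiE_def less_Suc_eq_0_disj extensional_restrict
          restrict_restrict Int_absorb1 nth_Cons split: nat.splits)
    have "I.C n (length (B # As)) \<omega> = I.C n 1 \<omega> \<bind> I.C (Suc n) (length As)"
      using I.split_C[of \<omega> n 1 "length As"] by simp
    also have "I.C n 1 \<omega> = I.eP n \<omega>"
      by (simp add: bind_return[OF I.measurable_eP])
    finally have split: "I.C n (length (B # As)) \<omega> = I.eP n \<omega> \<bind> I.C (Suc n) (length As)" .
    have "emeasure (I.C n (length (B # As)) \<omega>) (?E n X (B # As)) =
      (\<integral>\<^sup>+\<omega>1. emeasure (I.C (Suc n) (length As) \<omega>1) (?E (Suc n) ?Y As) \<partial>I.eP n \<omega>)"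
      unfolding Eeq split
      using E_sets[OF Y As] prob_space.not_empty[OF I.prob_space_eP[OF \<omega>]] I.measurable_C[of "Suc n" "length As"]
      by (subst emeasure_bind[where N = "?S (Suc n + length As)"])
        (auto simp: measurable_cong_sets[OF I.sets_eP[OF \<omega>] refl])
    also have "\<dots> = (\<integral>\<^sup>+\<omega>1. indicator ?Y \<omega>1 * cylinder_prob p As (\<omega>1 n) \<partial>I.eP n \<omega>)"
    proof (intro nn_integral_cong)
      fix \<omega>1 assume "\<omega>1 \<in> space (I.eP n \<omega>)"
      then have "\<omega>1 \<in> space (?S (Suc n))"
        by (simp only: I.space_eP[OF \<omega>])
      from Cons.IH[OF _ this Y As] show "emeasure (I.C (Suc n) (length As) \<omega>1) (?E (Suc n) ?Y As) =
          indicator ?Y \<omega>1 * cylinder_prob p As (\<omega>1 n)"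
        by (simp del: restrict_apply)
    qed
    also have "\<dots> = (\<integral>\<^sup>+x. indicator ?Y (fun_upd \<omega> n x) * cylinder_prob p As x \<partial>P n \<omega>)"
      using Y by (subst I.nn_integral_eP) auto
    also have "\<dots> = (\<integral>\<^sup>+x. indicator X \<omega> * (cylinder_prob p As x * indicator B x) \<partial>P n \<omega>)"
    proof (intro nn_integral_cong)
      fix x
      have "fun_upd \<omega> n x \<in> space (?S (Suc n))"
        using \<omega> by (auto simp: space_PiM PiE_def extensional_def)
      moreover have "restrict (fun_upd \<omega> n x) {0..<n} = \<omega>"
        using \<omega> by (auto simp: space_PiM PiE_def extensional_def restrict_def)
      ultimately show "indicator ?Y (fun_upd \<omega> n x) * cylinder_prob p As x =
        indicator X \<omega> * (cylinder_prob p As x * indicator B x)"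
        by (auto split: split_indicator)
    qed
    also have "\<dots> = indicator X \<omega> * cylinder_prob p (B # As) (\<omega> (n - 1))"
    proof -
      have "sets (p (\<omega> (n - 1))) = sets borel"
        using measurable_space[OF p, of "\<omega> (n - 1)"] by (auto simp: space_prob_algebra)
      then have "(\<lambda>x. cylinder_prob p As x * indicator B x) \<in> borel_measurable (p (\<omega> (n - 1)))"
        by (simp cong: measurable_cong_sets)
      then show ?thesis
        using Cons.prems(1) by (simp add: P_def nn_integral_cmult)
    qed
    finally show ?case .
  qed
  \<comment> \<open>The unique point of the product over no coordinates, from which the construction
    starts.\<close>
  let ?u = "\<lambda>_::nat. undefined :: 'a"
  have u: "?u \<in> space (?S 0)"
    by (simp add: space_PiM)
  have cyl: "emeasure I.PF.lim (path_cylinder A As) = indicator A g * cylinder_prob p As g"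
    if A: "A \<in> sets borel" and As: "set As \<subseteq> sets borel" for A As
  proof -
    let ?J = "{0..<Suc (length As)}"
    let ?X = "{\<omega> \<in> space (?S 1). \<omega> 0 \<in> A}"
    have [measurable]: "(\<lambda>\<omega>. \<omega> 0) \<in> ?S 1 \<rightarrow>\<^sub>M borel"
      by (rule measurable_component_singleton) simp
    have X: "?X \<in> sets (?S 1)"
      using A by measurable
    have XJ: "?E 1 ?X As \<in> sets (PiM ?J (\<lambda>_. borel))"
      using E_sets[OF X As] by simp
    note [measurable] = borel_measurable_cylinder_prob[OF p As]
    have "path_cylinder A As = prod_emb UNIV (\<lambda>_. borel) ?J (?E 1 ?X As)"
      unfolding path_cylinder_def prod_emb_def
      by (auto simp: space_PiM PiE_def extensional_def restrict_def)
    then have "emeasure I.PF.lim (path_cylinder A As) = emeasure (I.CI ?J) (?E 1 ?X As)"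
      using I.lim[of ?J "?E 1 ?X As"] XJ by simp
    also have "\<dots> = emeasure (I.C 0 (Suc (length As)) ?u) (?E 1 ?X As)"
    proof -
      have "prod_emb ?J (\<lambda>_. borel) ?J (?E 1 ?X As) = ?E 1 ?X As"
        using XJ by (intro prod_emb_id) (auto dest: sets.sets_into_space simp: space_PiM)
      then show ?thesis
        using I.emeasure_CI[of ?J "Suc (length As)" "?E 1 ?X As"] XJ by simp
    qed
    also have "I.C 0 (Suc (length As)) ?u = I.C 0 1 ?u \<bind> I.C 1 (length As)"
      using I.split_C[of ?u 0 1 "length As"] u by simp
    also have "I.C 0 1 ?u = I.eP 0 ?u"
      using bind_return[OF I.measurable_eP u] u by simp
    also have "emeasure (I.eP 0 ?u \<bind> I.C 1 (length As)) (?E 1 ?X As) =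
       (\<integral>\<^sup>+\<omega>1. emeasure (I.C 1 (length As) \<omega>1) (?E 1 ?X As) \<partial>I.eP 0 ?u)"
      using E_sets[OF X As] prob_space.not_empty[OF I.prob_space_eP[OF u]] I.measurable_C[of 1 "length As"]
      by (subst emeasure_bind[where N = "?S (1 + length As)"])
        (auto simp: measurable_cong_sets[OF I.sets_eP[OF u] refl])
    also have "\<dots> = (\<integral>\<^sup>+\<omega>1. indicator ?X \<omega>1 * cylinder_prob p As (\<omega>1 0) \<partial>I.eP 0 ?u)"
    proof (intro nn_integral_cong)
      fix \<omega>1 assume "\<omega>1 \<in> space (I.eP 0 ?u)"
      then have "\<omega>1 \<in> space (?S 1)"
        by (simp only: I.space_eP[OF u] One_nat_def)
      from C[OF _ this X As] show "emeasure (I.C 1 (length As) \<omega>1) (?E 1 ?X As) =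
          indicator ?X \<omega>1 * cylinder_prob p As (\<omega>1 0)"
        by (simp del: restrict_apply)
    qed
    also have "\<dots> = (\<integral>\<^sup>+x. indicator ?X (fun_upd ?u 0 x) * cylinder_prob p As x \<partial>P 0 ?u)"
      using X u by (subst I.nn_integral_eP) auto
    also have "\<dots> = (\<integral>\<^sup>+x. indicator A x * cylinder_prob p As x \<partial>return borel g)"
      unfolding P_def if_P[OF refl] by (intro nn_integral_cong)
        (auto simp: space_PiM PiE_def extensional_def split: split_indicator)
    also have "\<dots> = indicator A g * cylinder_prob p As g"
      using A by (subst nn_integral_return) auto
    finally show ?thesis .
  qed
  have sets_lim: "sets I.PF.lim = sets path_space"
    by simp
  have "prob_space I.PF.lim"
  proof
    show "emeasure I.PF.lim (space I.PF.lim) = 1"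
      using cyl[of UNIV "[]"] sets_eq_imp_space_eq[OF sets_lim] by (simp add: path_cylinder_def)
  qed
  with cyl sets_lim show ?thesis
    by (intro exI[of _ I.PF.lim]) auto
qed

lemma ex_markov_law:
  fixes p :: "'a::topological_space \<Rightarrow> 'a measure"
  assumes p[measurable]: "p \<in> borel \<rightarrow>\<^sub>M prob_algebra borel"
  shows "\<exists>K. is_markov_law p K"
proof -
  obtain K where K: "\<And>g. prob_space (K g)" "\<And>g. sets (K g) = sets path_space"
    "\<And>g A As. A \<in> sets borel \<Longrightarrow> set As \<subseteq> sets borel \<Longrightarrow>
        emeasure (K g) (path_cylinder A As) = indicator A g * cylinder_prob p As g"
    using ex_markov_law_from[OF p] by metis
  have "K \<in> borel \<rightarrow>\<^sub>M prob_algebra path_space"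
  proof (rule measurable_prob_algebra_generated[OF sets_path_space Int_stable_path_cylinders])
    fix A :: "(nat \<Rightarrow> 'a) set" assume "A \<in> path_cylinders"
    then obtain B Bs where B: "A = path_cylinder B Bs" "B \<in> sets borel" "set Bs \<subseteq> sets borel"
      unfolding path_cylinders_def by blast
    note B(2)[measurable] borel_measurable_cylinder_prob[OF p B(3), measurable]
    show "(\<lambda>a. emeasure (K a) A) \<in> borel_measurable borel"
      unfolding B(1) K(3)[OF B(2,3)] by measurable
  qed (use K in auto)
  with K(3) show ?thesis
    unfolding is_markov_law_def by blast
qed

section \<open>The shift, the tail \<sigma>-algebra and the Markov property\<close>

definition kernel_op :: "('a \<Rightarrow> 'a measure) \<Rightarrow> ('a \<Rightarrow> ennreal) \<Rightarrow> 'a \<Rightarrow> ennreal" where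
  "kernel_op p f g = (\<integral>\<^sup>+h. f h \<partial>p g)"

definition path_shift :: "(nat \<Rightarrow> 'a) \<Rightarrow> nat \<Rightarrow> 'a" where
  "path_shift \<omega> = (\<lambda>n. \<omega> (Suc n))"

lemma funpow_path_shift: "(path_shift ^^ k) \<omega> = (\<lambda>n. \<omega> (k + n))"
  by (induction k arbitrary: \<omega>) (simp_all add: path_shift_def fun_eq_iff)

lemma surj_funpow_path_shift: "surj (path_shift ^^ k)"
proof (rule surjI)
  \<comment> \<open>Truncated subtraction fills the first \<open>k\<close> coordinates with
    \<open>\<omega> 0\<close>; the shift removes them again.\<close>
  fix \<omega> show "(path_shift ^^ k) (\<lambda>n. \<omega> (n - k)) = \<omega>"
    by (simp add: funpow_path_shift)
qed

lemma measurable_path_shift [measurable]: "path_shift \<in> path_space \<rightarrow>\<^sub>M path_space"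
  unfolding path_shift_def by (rule measurable_PiM_single') auto

lemma path_shift_vimage_sets: "D \<in> sets path_space \<Longrightarrow> (path_shift ^^ k) -` D \<in> sets path_space"
  using measurable_sets[OF measurable_funpow[OF measurable_path_shift]] by fastforce

text \<open>Events from time \<open>n\<close> on are pullbacks under the \<open>n\<close>-fold
  shift, and conversely by \<open>vimage_in_tail_sigma\<close>. A tail event thus amounts to a
  sequence of path events, one for each time from which it is viewed.\<close>

lemma tail_sigma_vimage:
  assumes "F \<in> sigma_sets UNIV {{\<omega> :: nat \<Rightarrow> 'a::topological_space. \<omega> k \<in> A} | k A. n \<le> k \<and> A \<in> sets borel}"
  shows "\<exists>D\<in>sets path_space. F = (path_shift ^^ n) -` D"
  using assms
proof (induction F)
  case (Basic F)
  then obtain k A where kA: "F = {\<omega>. \<omega> k \<in> A}" "n \<le> k" "A \<in> sets borel"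
    by blast
  have "{\<omega>. \<omega> (k - n) \<in> A} \<in> sets path_space"
    using kA(3) measurable_sets[OF measurable_component_singleton[of "k - n" UNIV "\<lambda>_. borel"], of A]
    by (simp add: vimage_def)
  moreover have "F = (path_shift ^^ n) -` {\<omega>. \<omega> (k - n) \<in> A}"
    using kA by (auto simp: funpow_path_shift)
  ultimately show ?case by blast
next
  case Empty
  then show ?case by (intro bexI[of _ "{}"]) auto
next
  case (Compl F)
  then obtain D where "D \<in> sets path_space" "F = (path_shift ^^ n) -` D" by blast
  then show ?case
    using sets.compl_sets[of D path_space] by (intro bexI[of _ "UNIV - D"]) auto
next
  case (Union F)
  then obtain D where "\<And>i. D i \<in> sets path_space" "\<And>i. F i = (path_shift ^^ n) -` D i" by metis
  then show ?case
    by (intro bexI[of _ "\<Union>i. D i"]) (auto simp: vimage_UN)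
qed

lemma vimage_in_tail_sigma:
  assumes "D \<in> sets (path_space :: (nat \<Rightarrow> 'a::topological_space) measure)"
  shows "(path_shift ^^ n) -` D \<in> sigma_sets UNIV {{\<omega>. \<omega> k \<in> A} | k A. n \<le> k \<and> A \<in> sets borel}"
    (is "_ \<in> ?S")
proof -
  have "D \<in> sigma_sets UNIV {{\<omega>. \<omega> i \<in> A} | i A. A \<in> sets borel}"
    using assms unfolding sets_PiM_single by simp
  then show ?thesis
  proof (induction D)
    case (Basic D)
    then obtain i A where "D = {\<omega>. \<omega> i \<in> A}" "A \<in> sets borel" by blast
    then have "(path_shift ^^ n) -` D \<in> {{\<omega>. \<omega> k \<in> A} | k A. n \<le> k \<and> A \<in> sets borel}"
      by (auto simp: funpow_path_shift intro!: exI[of _ "n + i"] exI[of _ A])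
    then show ?case by (rule sigma_sets.Basic)
  next
    case Empty
    then show ?case by (simp add: sigma_sets.Empty)
  next
    case (Compl D)
    then show ?case
      using sigma_sets.Compl by (simp add: vimage_Diff)
  next
    case (Union D)
    then show ?case
      using sigma_sets.Union[of "\<lambda>i. (path_shift ^^ n) -` D i"] by (simp add: vimage_UN)
  qed
qed

lemma is_markov_lawD:
  assumes "is_markov_law p K"
  shows "K \<in> borel \<rightarrow>\<^sub>M prob_algebra path_space" "K \<in> borel \<rightarrow>\<^sub>M subprob_algebra path_space"
    "prob_space (K g)" "sets (K g) = sets path_space" "space (K g) = UNIV"
    "A \<in> sets borel \<Longrightarrow> set As \<subseteq> sets borel \<Longrightarrow>
        emeasure (K g) (path_cylinder A As) = indicator A g * cylinder_prob p As g"
proof -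
  show K: "K \<in> borel \<rightarrow>\<^sub>M prob_algebra path_space"
    using assms by (simp add: is_markov_law_def)
  show "K \<in> borel \<rightarrow>\<^sub>M subprob_algebra path_space"
    by (rule measurable_prob_algebraD[OF K])
  show "prob_space (K g)" and s: "sets (K g) = sets path_space"
    using measurable_space[OF K, of g] by (auto simp: space_prob_algebra)
  show "space (K g) = UNIV"
    using sets_eq_imp_space_eq[OF s] by simp
qed (use assms in \<open>simp add: is_markov_law_def\<close>)

lemma prob_kernelD:
  assumes "p \<in> N \<rightarrow>\<^sub>M prob_algebra M" "g \<in> space N"
  shows "prob_space (p g)" "sets (p g) = sets M" "space (p g) = space M"
  using measurable_space[OF assms] by (auto simp: space_prob_algebra dest: sets_eq_imp_space_eq)

context
  fixes p :: "'a::topological_space \<Rightarrow> 'a measure" and K :: "'a \<Rightarrow> (nat \<Rightarrow> 'a) measure"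
  assumes p: "p \<in> borel \<rightarrow>\<^sub>M prob_algebra borel" and K: "is_markov_law p K"
begin

lemma markov_law_start:
  assumes A: "A \<in> sets borel" and D: "D \<in> sets path_space"
  shows "emeasure (K g) ({\<omega>. \<omega> 0 \<in> A} \<inter> D) = indicator A g * emeasure (K g) D"
proof -
  interpret prob_space "K g" by (rule is_markov_lawD[OF K])
  have eq: "{\<omega>. \<omega> 0 \<in> B} = path_cylinder B []" for B :: "'a set"
    by (simp add: path_cylinder_def)
  have ev: "{\<omega>. \<omega> 0 \<in> B} \<in> sets (K g)" "emeasure (K g) {\<omega>. \<omega> 0 \<in> B} = indicator B g"
    if "B \<in> sets borel" for B
    unfolding eq using that path_cylinder_sets[of B "[]"] is_markov_lawD(4,6)[OF K] by auto
  have D': "D \<in> sets (K g)" using D is_markov_lawD(4)[OF K] by simp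
  show ?thesis
  proof (cases "g \<in> A")
    case True
    have "{\<omega>. \<omega> 0 \<in> - A} \<in> null_sets (K g)"
      using ev[of "- A"] A True by (auto simp: null_sets_def)
    then have "AE \<omega> in K g. \<omega> \<in> {\<omega>. \<omega> 0 \<in> A} \<inter> D \<longleftrightarrow> \<omega> \<in> D"
      by (rule eventually_mono[OF AE_not_in]) auto
    then have "emeasure (K g) ({\<omega>. \<omega> 0 \<in> A} \<inter> D) = emeasure (K g) D"
      using ev(1)[OF A] D' by (intro emeasure_eq_AE) auto
    with True show ?thesis by simp
  next
    case False
    have "emeasure (K g) ({\<omega>. \<omega> 0 \<in> A} \<inter> D) \<le> emeasure (K g) {\<omega>. \<omega> 0 \<in> A}"
      using ev(1)[OF A] by (intro emeasure_mono) auto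
    with False ev(2)[OF A] show ?thesis by simp
  qed
qed

lemma markov_law_shift: "distr (K g) path_space path_shift = p g \<bind> K"
proof (rule path_measure_eqI_finite)
  have sK: "path_shift \<in> K g \<rightarrow>\<^sub>M path_space"
    by (simp add: measurable_path_shift measurable_cong_sets[OF is_markov_lawD(4)[OF K] refl])
  note pg = prob_kernelD[OF p, of g, simplified]
  have Kp: "K \<in> p g \<rightarrow>\<^sub>M subprob_algebra path_space"
    using is_markov_lawD(2)[OF K] by (simp add: measurable_cong_sets[OF pg(2) refl])
  show "sets (p g \<bind> K) = sets path_space"
    using pg by (intro sets_bind_measurable[OF Kp]) auto
  show "finite_measure (distr (K g) path_space path_shift)"
    by (rule prob_space.finite_measure[OF prob_space.prob_space_distr[OF is_markov_lawD(3)[OF K] sK]])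
  fix A :: "'a set" and As :: "'a set list" assume A: "A \<in> sets borel" and As: "set As \<subseteq> sets borel"
  have "emeasure (distr (K g) path_space path_shift) (path_cylinder A As) =
      emeasure (K g) (path_cylinder UNIV (A # As))"
  proof -
    have "path_shift -` path_cylinder A As = path_cylinder UNIV (A # As)"
      unfolding path_cylinder_def path_shift_def by (auto simp: less_Suc_eq_0_disj)
    then show ?thesis
      using sK path_cylinder_sets[OF A As] by (simp add: emeasure_distr is_markov_lawD(5)[OF K])
  qed
  also have "\<dots> = (\<integral>\<^sup>+h. emeasure (K h) (path_cylinder A As) \<partial>p g)"
    using A As is_markov_lawD(6)[OF K] by (simp add: mult.commute)
  also have "\<dots> = emeasure (p g \<bind> K) (path_cylinder A As)"
    using pg by (intro emeasure_bind[symmetric, OF _ Kp path_cylinder_sets[OF A As]]) auto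
  finally show "emeasure (distr (K g) path_space path_shift) (path_cylinder A As) =
      emeasure (p g \<bind> K) (path_cylinder A As)" .
qed simp

lemma markov_law_vimage_shift:
  assumes D: "D \<in> sets path_space"
  shows "emeasure (K g) (path_shift -` D) = (\<integral>\<^sup>+h. emeasure (K h) D \<partial>p g)"
proof -
  have sK: "path_shift \<in> K g \<rightarrow>\<^sub>M path_space"
    by (simp add: measurable_path_shift measurable_cong_sets[OF is_markov_lawD(4)[OF K] refl])
  note pg = prob_kernelD[OF p, of g, simplified]
  have Kp: "K \<in> p g \<rightarrow>\<^sub>M subprob_algebra path_space"
    using is_markov_lawD(2)[OF K] by (simp add: measurable_cong_sets[OF pg(2) refl])
  have "emeasure (K g) (path_shift -` D) = emeasure (distr (K g) path_space path_shift) D"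
    using D by (simp add: emeasure_distr[OF sK] is_markov_lawD(5)[OF K])
  also have "\<dots> = (\<integral>\<^sup>+h. emeasure (K h) D \<partial>p g)"
    unfolding markov_law_shift using pg by (intro emeasure_bind[OF _ Kp D]) auto
  finally show ?thesis .
qed

text \<open>Turns the probability of a late event into a power of the transition operator, to which
  the oscillation estimates on \<open>kernel_op p\<close> apply.\<close>

lemma markov_law_vimage_funpow:
  assumes D: "D \<in> sets path_space"
  shows "emeasure (K g) ((path_shift ^^ k) -` D) = (kernel_op p ^^ k) (\<lambda>h. emeasure (K h) D) g"
proof (induction k arbitrary: g)
  case (Suc k)
  have "(path_shift ^^ Suc k) -` D = path_shift -` ((path_shift ^^ k) -` D)"
    by (simp add: funpow_Suc_right vimage_comp del: funpow.simps)
  then have "emeasure (K g) ((path_shift ^^ Suc k) -` D) =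
      (\<integral>\<^sup>+h. emeasure (K h) ((path_shift ^^ k) -` D) \<partial>p g)"
    using markov_law_vimage_shift[OF path_shift_vimage_sets[OF D, of k], of g] by simp
  also have "\<dots> = kernel_op p ((kernel_op p ^^ k) (\<lambda>h. emeasure (K h) D)) g"
    by (subst kernel_op_def) (simp only: Suc)
  also have "\<dots> = (kernel_op p ^^ Suc k) (\<lambda>h. emeasure (K h) D) g"
    by simp
  finally show ?case .
qed simp

lemma borel_measurable_emeasure_markov_law:
  assumes D: "D \<in> sets path_space" shows "(\<lambda>g. emeasure (K g) D) \<in> borel_measurable borel"
  by (rule measurable_emeasure_kernel[OF is_markov_lawD(2)[OF K] D])

lemma emeasure_bind_law:
  assumes \<nu>: "sets \<nu> = sets borel" and D: "D \<in> sets path_space"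
  shows "emeasure (\<nu> \<bind> K) D = (\<integral>\<^sup>+g. emeasure (K g) D \<partial>\<nu>)"
  using is_markov_lawD(2)[OF K] sets_eq_imp_space_eq[OF \<nu>]
  by (intro emeasure_bind[OF _ _ D]) (simp_all add: measurable_cong_sets[OF \<nu> refl])

lemma sets_bind_law: "sets \<nu> = sets borel \<Longrightarrow> sets (\<nu> \<bind> K) = sets path_space"
  using is_markov_lawD(2)[OF K] sets_eq_imp_space_eq[of \<nu> borel]
  by (intro sets_bind_measurable) (simp_all cong: measurable_cong_sets)

text \<open>The null sets of the path measure depend on \<nu> only through its null sets; hence a
  \<sigma>-finite initial measure can be exchanged for an equivalent probability measure.\<close>

lemma null_sets_bind_law:
  assumes \<nu>: "sets \<nu> = sets borel"
  shows "D \<in> null_sets (\<nu> \<bind> K) \<longleftrightarrow> D \<in> sets path_space \<and> (AE g in \<nu>. emeasure (K g) D = 0)"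
proof -
  have "(\<integral>\<^sup>+g. emeasure (K g) D \<partial>\<nu>) = 0 \<longleftrightarrow> (AE g in \<nu>. emeasure (K g) D = 0)" if "D \<in> sets path_space"
    using borel_measurable_emeasure_markov_law[OF that]
    by (intro nn_integral_0_iff_AE) (simp add: measurable_cong_sets[OF \<nu> refl])
  then show ?thesis
    by (auto simp: null_sets_def sets_bind_law[OF \<nu>] emeasure_bind_law[OF \<nu>])
qed

text \<open>
  By the Markov property the probability of a tail event does not depend on the starting point,
  also after conditioning on an initial segment of the path; so a tail event is independent of all
  cylinders, hence of itself.
\<close>

lemma tail_zero_one:
  fixes \<mu> :: "'a measure"
  assumes \<mu>: "sets \<mu> = sets borel" and ac: "\<And>g. absolutely_continuous \<mu> (p g)"
    and G: "AE g in \<mu>. g \<in> G"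
    and osc: "\<And>g g' \<epsilon>. g \<in> G \<Longrightarrow> g' \<in> G \<Longrightarrow> 0 < (\<epsilon>::real) \<Longrightarrow>
      \<exists>k. \<forall>f\<in>borel_measurable borel. (\<forall>h. f h \<le> 1) \<longrightarrow>
        (kernel_op p ^^ k) f g \<le> (kernel_op p ^^ k) f g' + ennreal \<epsilon>"
    and F: "F \<in> (\<Inter>n. sigma_sets UNIV {{\<omega>. \<omega> k \<in> A} | k A. n \<le> k \<and> A \<in> sets borel})"
  shows "(AE g in \<mu>. emeasure (K g) F = 0) \<or> (AE g in \<mu>. emeasure (K g) F = 1)"
proof (cases "G = {}")
  case True
  show ?thesis
    by (rule disjI1, rule eventually_mono[OF G]) (simp add: True)
next
  case False
  then obtain g0 where g0: "g0 \<in> G" by blast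
  have "\<exists>D\<in>sets path_space. F = (path_shift ^^ n) -` D" for n
    using F by (intro tail_sigma_vimage) auto
  then obtain D where D: "\<And>n. D n \<in> sets path_space" "\<And>n. F = (path_shift ^^ n) -` D n"
    by metis
  have F_sets: "F \<in> sets path_space"
    using D(1)[of 0] D(2)[of 0] by simp
  \<comment> \<open>Both sides have the same preimage \<open>F\<close> under the
    \<open>n\<close>-fold shift, and the shift is surjective.\<close>
  have D_vimage: "D n = (path_shift ^^ k) -` D (n + k)" for n k
  proof -
    have "(path_shift ^^ n) -` D n = (path_shift ^^ n) -` ((path_shift ^^ k) -` D (n + k))"
      using D(2)[of n] D(2)[of "n + k"] by (simp add: vimage_comp add.commute[of n k] flip: funpow_add)
    then show ?thesis
      using surj_funpow_path_shift[of n] by (metis surj_image_vimage_eq)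
  qed
  \<comment> \<open>The event \<open>D n\<close> is \<open>D (n + k)\<close> seen \<open>k\<close>
    steps earlier, so its probability is a \<open>k\<close>th power of the operator, with
    \<open>k\<close> free to depend on \<open>g\<close>, \<open>g'\<close> and \<epsilon>.\<close>
  have le: "emeasure (K g) (D n) \<le> emeasure (K g') (D n)" if g: "g \<in> G" "g' \<in> G" for g g' n
  proof (rule ennreal_le_epsilon)
    fix \<epsilon> :: real assume "0 < \<epsilon>"
    then obtain k where k: "\<And>f. f \<in> borel_measurable borel \<Longrightarrow> (\<And>h. f h \<le> 1) \<Longrightarrow>
        (kernel_op p ^^ k) f g \<le> (kernel_op p ^^ k) f g' + ennreal \<epsilon>"
      using osc[OF g] by blast
    have "(kernel_op p ^^ k) (\<lambda>h. emeasure (K h) (D (n + k))) g \<le>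
        (kernel_op p ^^ k) (\<lambda>h. emeasure (K h) (D (n + k))) g' + ennreal \<epsilon>"
      using borel_measurable_emeasure_markov_law[OF D(1)] prob_space.measure_le_1[OF is_markov_lawD(3)[OF K]]
      by (intro k) auto
    then show "emeasure (K g) (D n) \<le> emeasure (K g') (D n) + ennreal \<epsilon>"
      unfolding D_vimage[of n k] markov_law_vimage_funpow[OF D(1)] .
  qed
  define c where "c n = emeasure (K g0) (D n)" for n
  have c: "emeasure (K g) (D n) = c n" if "g \<in> G" for g n
    unfolding c_def by (intro antisym le g0 that)
  \<comment> \<open>One step from any point leads almost surely into \<open>G\<close>, since the
    steps are absolutely continuous.\<close>
  have AEp: "AE h in p g. h \<in> G" for g
    using absolutely_continuous_AE[OF _ ac G] prob_kernelD(2)[OF p] \<mu> by simp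
  have step: "emeasure (K g) (path_cylinder A As \<inter> (path_shift ^^ length As) -` D n) =
      emeasure (K g) (path_cylinder A As) * c n"
    if "g \<in> G" "A \<in> sets borel" "set As \<subseteq> sets borel" for g A As n
    using that
  proof (induction As arbitrary: A g)
    case Nil
    have eq: "path_cylinder A [] = {\<omega>. \<omega> 0 \<in> A}" by (simp add: path_cylinder_def)
    then show ?case
      using markov_law_start[OF Nil(2) D(1)[of n], of g] is_markov_lawD(6)[OF K Nil(2), of "[]" g] c[OF Nil(1)]
      by simp
  next
    case (Cons B As)
    have BAs: "B \<in> sets borel" "set As \<subseteq> sets borel" using Cons.prems by auto
    have cyl: "path_cylinder A (B # As) = {\<omega>. \<omega> 0 \<in> A} \<inter> path_shift -` path_cylinder B As"
      unfolding path_cylinder_def path_shift_def by (auto simp: less_Suc_eq_0_disj)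
    let ?X = "path_cylinder B As \<inter> (path_shift ^^ length As) -` D n"
    have X: "?X \<in> sets path_space"
      using path_cylinder_sets[OF BAs] path_shift_vimage_sets[OF D(1)] by auto
    have X': "path_shift -` ?X \<in> sets path_space"
      using path_shift_vimage_sets[OF X, of 1] by simp
    have "path_cylinder A (B # As) \<inter> (path_shift ^^ length (B # As)) -` D n =
        {\<omega>. \<omega> 0 \<in> A} \<inter> path_shift -` ?X"
      unfolding cyl by (auto simp: funpow_swap1)
    then have "emeasure (K g) (path_cylinder A (B # As) \<inter> (path_shift ^^ length (B # As)) -` D n) =
        indicator A g * emeasure (K g) (path_shift -` ?X)"
      using markov_law_start[OF Cons.prems(2) X', of g] by (simp only:)
    also have "emeasure (K g) (path_shift -` ?X) = (\<integral>\<^sup>+h. emeasure (K h) ?X \<partial>p g)"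
      by (rule markov_law_vimage_shift[OF X])
    also have "(\<integral>\<^sup>+h. emeasure (K h) (path_cylinder B As \<inter> (path_shift ^^ length As) -` D n) \<partial>p g) =
        (\<integral>\<^sup>+h. emeasure (K h) (path_cylinder B As) * c n \<partial>p g)"
      by (rule nn_integral_cong_AE, rule eventually_mono[OF AEp[of g]]) (rule Cons.IH[OF _ BAs])
    also have "\<dots> = (\<integral>\<^sup>+h. emeasure (K h) (path_cylinder B As) \<partial>p g) * c n"
      using borel_measurable_emeasure_markov_law[OF path_cylinder_sets[OF BAs]] prob_kernelD(2)[OF p, of g]
      by (intro nn_integral_multc) (simp cong: measurable_cong_sets)
    also have "(\<integral>\<^sup>+h. emeasure (K h) (path_cylinder B As) \<partial>p g) = emeasure (K g) (path_shift -` path_cylinder B As)"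
      by (rule markov_law_vimage_shift[symmetric, OF path_cylinder_sets[OF BAs]])
    finally show ?case
      unfolding cyl using markov_law_start[OF Cons.prems(2) path_shift_vimage_sets[OF path_cylinder_sets[OF BAs], of 1], of g]
      by (simp add: mult.assoc)
  qed
  \<comment> \<open>The whole path space, written as a cylinder of length \<open>n\<close>, turns
    the left side of \<open>step\<close> into the probability of \<open>F\<close>.\<close>
  have c_eq: "c n = c 0" for n
  proof -
    have "path_cylinder UNIV (replicate n UNIV) = (UNIV :: (nat \<Rightarrow> 'a) set)"
      by (auto simp: path_cylinder_def)
    moreover have "set (replicate n UNIV) \<subseteq> sets (borel :: 'a measure)"
      by (simp add: set_replicate_conv_if)
    ultimately have "emeasure (K g0) ((path_shift ^^ n) -` D n) = c n"
      using step[OF g0, of UNIV "replicate n UNIV" n] prob_space.emeasure_space_1[OF is_markov_lawD(3)[OF K, of g0]]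
      by (simp add: is_markov_lawD(5)[OF K])
    then show ?thesis
      using D(2)[of n] D(2)[of 0] by (simp add: c_def)
  qed
  interpret prob_space "K g0" by (rule is_markov_lawD[OF K])
  have [measurable]: "F \<in> sets (K g0)" using F_sets is_markov_lawD(4)[OF K] by simp
  have "density (K g0) (indicator F) = density (K g0) (\<lambda>_. c 0)"
  proof (rule path_measure_eqI_finite)
    show "finite_measure (density (K g0) (indicator F))"
      by (rule finite_measureI) (simp add: emeasure_density)
    fix A :: "'a set" and As :: "'a set list" assume A: "A \<in> sets borel" and As: "set As \<subseteq> sets borel"
    have X: "path_cylinder A As \<in> sets (K g0)"
      using path_cylinder_sets[OF A As] is_markov_lawD(4)[OF K] by simp
    have "emeasure (density (K g0) (indicator F)) (path_cylinder A As) = emeasure (K g0) (path_cylinder A As \<inter> F)"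
      using X by (simp add: emeasure_density Int_commute flip: indicator_inter_arith)
    also have "\<dots> = emeasure (K g0) (path_cylinder A As) * c 0"
      using step[OF g0 A As, of "length As"] D(2)[of "length As"] c_eq[of "length As"] by simp
    also have "\<dots> = emeasure (density (K g0) (\<lambda>_. c 0)) (path_cylinder A As)"
      using X by (simp add: emeasure_density nn_integral_cmult mult.commute)
    finally show "emeasure (density (K g0) (indicator F)) (path_cylinder A As) =
      emeasure (density (K g0) (\<lambda>_. c 0)) (path_cylinder A As)" .
  qed (use is_markov_lawD(4)[OF K] in auto)
  then have "emeasure (density (K g0) (indicator F)) F = emeasure (density (K g0) (\<lambda>_. c 0)) F"
    by simp
  moreover have "emeasure (K g0) F = c 0"
    using D(2)[of 0] by (simp add: c_def)
  ultimately have cc: "c 0 = c 0 * c 0"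
    by (simp add: emeasure_density nn_integral_cmult flip: indicator_inter_arith)
  have "c 0 \<noteq> \<top>"
    using emeasure_finite[of "D 0"] by (simp add: c_def)
  have c01: "c 0 = 0 \<or> c 0 = 1"
    using cc \<open>c 0 \<noteq> \<top>\<close> by (metis ennreal_mult_cancel_left mult.right_neutral)
  have AEc: "AE g in \<mu>. emeasure (K g) F = c 0"
    using G by eventually_elim (use c[of _ 0] D(2)[of 0] in simp)
  from c01 show ?thesis
  proof
    assume "c 0 = 0" with AEc show ?thesis by simp
  next
    assume "c 0 = 1" with AEc show ?thesis by simp
  qed
qed

end

section \<open>Passing from a transition kernel to a Borel version of it\<close>

lemma cylinder_prob_cong_AE:
  assumes \<mu>: "\<And>g. sets (\<pi> g) = sets \<mu>" and ac: "\<And>g. absolutely_continuous \<mu> (\<pi> g)"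
    and eq: "AE g in \<mu>. \<pi> g = p g"
  shows "AE g in \<mu>. cylinder_prob \<pi> As g = cylinder_prob p As g"
proof (induction As)
  case (Cons A As)
  \<comment> \<open>No step charges the exceptional null set of the induction hypothesis, so the
    exceptions do not spread as the cylinder grows.\<close>
  have AE: "AE h in \<pi> g. cylinder_prob \<pi> As h = cylinder_prob p As h" for g
    by (rule absolutely_continuous_AE[OF \<mu> ac Cons])
  show ?case
    using eq
  proof eventually_elim
    case (elim g)
    have "(\<integral>\<^sup>+h\<in>A. cylinder_prob \<pi> As h \<partial>\<pi> g) = (\<integral>\<^sup>+h\<in>A. cylinder_prob p As h \<partial>\<pi> g)"
      by (rule nn_integral_cong_AE) (use AE[of g] in eventually_elim, simp)
    with elim show ?case by simp
  qed
qed simp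

text \<open>Here \<pi> are the true transition probabilities, measurable only for the completion,
  and \<open>p\<close> is a Borel version of them, for which the path laws form a kernel. Both
  induce the same path measure \<open>\<mu> \<bind> K\<close>.\<close>

locale markov_version =
  fixes \<mu> :: "'a::topological_space measure" and p \<pi> :: "'a \<Rightarrow> 'a measure"
    and K :: "'a \<Rightarrow> (nat \<Rightarrow> 'a) measure"
  assumes sigma_finite_\<mu>: "sigma_finite_measure \<mu>" and sets_\<mu>: "sets \<mu> = sets borel"
    and p: "p \<in> borel \<rightarrow>\<^sub>M prob_algebra borel" and ac_p: "\<And>g. absolutely_continuous \<mu> (p g)"
    and \<pi>: "markov_kernel \<mu> \<pi>" and ac_\<pi>: "\<And>g. absolutely_continuous \<mu> (\<pi> g)"
    and \<pi>_eq: "AE g in \<mu>. \<pi> g = p g"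
    and K: "is_markov_law p K"
begin

lemma space_\<mu>: "space \<mu> = UNIV"
  using sets_eq_imp_space_eq[OF sets_\<mu>] by simp

lemmas emeasure_bind_K = emeasure_bind_law[OF p K sets_\<mu>]
lemmas sets_bind_K = sets_bind_law[OF p K sets_\<mu>]
lemmas null_sets_bind_K = null_sets_bind_law[OF p K sets_\<mu>]

lemma cylinder_bind_K:
  assumes A: "A \<in> sets borel" and As: "set As \<subseteq> sets borel"
  shows "emeasure (\<mu> \<bind> K) (path_cylinder A As) = (\<integral>\<^sup>+g\<in>A. cylinder_prob \<pi> As g \<partial>\<mu>)"
proof -
  have "AE g in \<mu>. cylinder_prob \<pi> As g = cylinder_prob p As g"
    using \<pi> ac_\<pi> \<pi>_eq by (intro cylinder_prob_cong_AE) (auto simp: markov_kernel_def sets_\<mu>)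
  then have "(\<integral>\<^sup>+g. emeasure (K g) (path_cylinder A As) \<partial>\<mu>) = (\<integral>\<^sup>+g\<in>A. cylinder_prob \<pi> As g \<partial>\<mu>)"
    by (intro nn_integral_cong_AE, eventually_elim)
      (simp add: is_markov_lawD(6)[OF K A As] mult.commute)
  then show ?thesis
    by (simp add: emeasure_bind_K[OF path_cylinder_sets[OF A As]])
qed

lemma markov_path_measure_bind: "markov_path_measure \<mu> \<pi> (\<mu> \<bind> K)"
  unfolding markov_path_measure_def
  using \<pi> sets_bind_K cylinder_bind_K by (simp add: path_cylinder_def)

text \<open>Triviality is asserted for some path measure; uniqueness moves it to
  \<open>\<mu> \<bind> K\<close>.\<close>

lemma markov_path_measure_unique:
  assumes P: "markov_path_measure \<mu> \<pi> P"
  shows "P = \<mu> \<bind> K"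
proof -
  have cyl: "emeasure P (path_cylinder A As) = (\<integral>\<^sup>+g\<in>A. cylinder_prob \<pi> As g \<partial>\<mu>)"
    if "A \<in> sets borel" "set As \<subseteq> sets borel" for A As
    using P that unfolding markov_path_measure_def path_cylinder_def by blast
  interpret sigma_finite_measure \<mu> by (rule sigma_finite_\<mu>)
  obtain S :: "nat \<Rightarrow> 'a set" where S: "range S \<subseteq> sets \<mu>" "(\<Union>i. S i) = space \<mu>" "\<And>i. emeasure \<mu> (S i) \<noteq> \<infinity>"
    using sigma_finite by metis
  show ?thesis
  proof (rule path_measure_eqI)
    show "S i \<in> sets borel" for i
      using S(1) sets_\<mu> by auto
    then show "emeasure P (path_cylinder (S i) []) \<noteq> \<infinity>" for i
      using cyl[of "S i" "[]"] S(3)[of i] S(1) sets_\<mu> by simp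
    show "(\<Union>i. S i) = UNIV"
      using S(2) space_\<mu> by simp
    show "sets P = sets path_space"
      using P by (simp add: markov_path_measure_def)
  qed (simp_all add: sets_bind_K cyl cylinder_bind_K)
qed

lemma trivial_tail_boundaryI:
  assumes G: "AE g in \<mu>. g \<in> G"
    and osc: "\<And>g g' \<epsilon>. g \<in> G \<Longrightarrow> g' \<in> G \<Longrightarrow> 0 < (\<epsilon>::real) \<Longrightarrow>
      \<exists>k. \<forall>f\<in>borel_measurable borel. (\<forall>h. f h \<le> 1) \<longrightarrow>
        (kernel_op p ^^ k) f g \<le> (kernel_op p ^^ k) f g' + ennreal \<epsilon>"
  shows "trivial_tail_boundary \<mu> \<pi>"
  unfolding trivial_tail_boundary_def trivial_mod0_def
proof (intro exI conjI ballI)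
  show "markov_path_measure \<mu> \<pi> (\<mu> \<bind> K)" by (rule markov_path_measure_bind)
  let ?P = "\<mu> \<bind> K"
  have space: "space ?P = UNIV"
    using sets_eq_imp_space_eq[OF sets_bind_K] by simp
  fix E assume "E \<in> tail_events ?P"
  then obtain F where F: "F \<in> (\<Inter>n. sigma_sets UNIV {{\<omega>. \<omega> k \<in> A} | k A. n \<le> k \<and> A \<in> sets borel})"
    and EF: "sym_diff E F \<in> null_sets (completion ?P)"
    unfolding tail_events_def by blast
  obtain D where "D \<in> sets path_space" "F = (path_shift ^^ 0) -` D"
    using tail_sigma_vimage[of F 0] F by blast
  then have F_sets: "F \<in> sets path_space" by simp
  from tail_zero_one[OF p K sets_\<mu> ac_p G osc F]
  show "E \<in> null_sets (completion ?P) \<or> space ?P - E \<in> null_sets (completion ?P)"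
  proof
    assume "AE g in \<mu>. emeasure (K g) F = 0"
    then have "F \<in> null_sets (completion ?P)"
      using null_sets_bind_K F_sets by (auto intro: null_sets_completionI)
    from null_sets.Un[OF this EF] have "E \<in> null_sets (completion ?P)"
      by (rule null_sets_completion_subset[rotated]) auto
    then show ?thesis ..
  next
    assume 1: "AE g in \<mu>. emeasure (K g) F = 1"
    have "emeasure (K g) (UNIV - F) = 0" if "emeasure (K g) F = 1" for g
    proof -
      have "F \<in> sets (K g)" using F_sets is_markov_lawD(4)[OF K] by simp
      then show ?thesis
        using that prob_space.emeasure_space_1[OF is_markov_lawD(3)[OF K], of g]
          emeasure_compl[of F "K g"] by (simp add: is_markov_lawD(5)[OF K])
    qed
    with 1 have "AE g in \<mu>. emeasure (K g) (UNIV - F) = 0"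
      by (auto elim: eventually_mono)
    then have "UNIV - F \<in> null_sets (completion ?P)"
      using null_sets_bind_K F_sets sets.compl_sets[of F path_space] by (auto intro: null_sets_completionI)
    from null_sets.Un[OF this EF] have "UNIV - E \<in> null_sets (completion ?P)"
      by (rule null_sets_completion_subset[rotated]) auto
    then show ?thesis unfolding space by blast
  qed
qed

lemma liouville_shift_invariant:
  assumes L: "liouville_chain \<mu> \<pi>" and A: "A \<in> sets path_space" "path_shift -` A = A"
  shows "A \<in> null_sets (\<mu> \<bind> K) \<or> UNIV - A \<in> null_sets (\<mu> \<bind> K)"
proof -
  let ?P = "\<mu> \<bind> K"
  have space: "space ?P = UNIV"
    using sets_eq_imp_space_eq[OF sets_bind_K] by simp
  have triv: "trivial_mod0 ?P (exit_events ?P)"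
    using L markov_path_measure_unique unfolding liouville_chain_def by metis
  \<comment> \<open>A strictly invariant set equals its preimages under all powers of the shift,
    hence depends on arbitrarily late coordinates only.\<close>
  have "A \<in> sigma_sets UNIV {{\<omega>. \<omega> k \<in> B} | k B. n \<le> k \<and> B \<in> sets borel}" for n
  proof -
    have "(path_shift ^^ n) -` A = A"
    proof (induction n)
      case (Suc n)
      have "(path_shift ^^ Suc n) -` A = path_shift -` ((path_shift ^^ n) -` A)"
        by (simp add: funpow_Suc_right vimage_comp del: funpow.simps)
      then show ?case by (simp only: Suc A(2))
    qed simp
    with vimage_in_tail_sigma[OF A(1), of n] show ?thesis by simp
  qed
  then have "A \<in> tail_events ?P"
    unfolding tail_events_def by (intro CollectI bexI[of _ A]) auto
  then have "A \<in> exit_events ?P"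
    using A(2) unfolding exit_events_def path_shift_def by simp
  with triv have "A \<in> null_sets (completion ?P) \<or> UNIV - A \<in> null_sets (completion ?P)"
    unfolding trivial_mod0_def space by blast
  moreover have "A \<in> sets ?P" "UNIV - A \<in> sets ?P"
    using A(1) sets.compl_sets[OF A(1)] sets_bind_K by auto
  ultimately show ?thesis
    by (simp add: null_sets_completion_iff)
qed

end

lemma (in sigma_finite_measure) equivalent_prob_density:
  assumes "emeasure M (space M) \<noteq> 0"
  obtains w :: "'a \<Rightarrow> ennreal" where "w \<in> borel_measurable M" "\<And>x. x \<in> space M \<Longrightarrow> 0 < w x"
    "\<And>x. x \<in> space M \<Longrightarrow> w x < \<infinity>"
    "prob_space (density M w)" "\<And>P. (AE x in density M w. P x) \<longleftrightarrow> (AE x in M. P x)"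
proof -
  obtain h where h[measurable]: "h \<in> borel_measurable M" and fin: "integral\<^sup>N M h \<noteq> \<infinity>"
    and pos: "\<And>x. x \<in> space M \<Longrightarrow> 0 < h x \<and> h x < \<infinity>"
    using Ex_finite_integrable_function by blast
  let ?c = "integral\<^sup>N M h"
  have c0: "?c \<noteq> 0"
  proof
    assume "?c = 0"
    then have "AE x in M. h x = 0" by (subst (asm) nn_integral_0_iff_AE) auto
    then have "AE x in M. False" using AE_space by eventually_elim (use pos in fastforce)
    then show False using emeasure_eq_0_AE[of "\<lambda>_. True" M] assms by simp
  qed
  define w where "w x = h x / ?c" for x
  have w[measurable]: "w \<in> borel_measurable M" unfolding w_def by measurable
  have wpos: "0 < w x" "w x < \<infinity>" if "x \<in> space M" for x
    using pos[OF that] c0 fin unfolding w_def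
    by (auto simp: ennreal_zero_less_divide less_top[symmetric] ennreal_divide_eq_top_iff)
  show thesis
  proof (rule that[OF w wpos])
    show "prob_space (density M w)"
    proof
      have "emeasure (density M w) (space (density M w)) = (\<integral>\<^sup>+x. w x \<partial>M)"
        by (simp add: emeasure_density cong: nn_integral_cong_simp)
      also have "\<dots> = ?c / ?c" unfolding w_def by (rule nn_integral_divide) simp
      also have "\<dots> = 1" using c0 fin by (simp add: ennreal_divide_self less_top[symmetric])
      finally show "emeasure (density M w) (space (density M w)) = 1" .
    qed
    show "(AE x in density M w. P x) \<longleftrightarrow> (AE x in M. P x)" for P
      unfolding AE_density[OF w]
      by (rule AE_cong) (use wpos(1) in auto)
  qed auto
qed

section \<open>Iterated laws, and the merging of their averages for a Liouville chain\<close>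

definition markov_iter :: "('a \<Rightarrow> 'a measure) \<Rightarrow> nat \<Rightarrow> 'a measure \<Rightarrow> 'a measure" where
  "markov_iter p k \<nu> = ((\<lambda>\<nu>. \<nu> \<bind> p) ^^ k) \<nu>"

lemma markov_iter_0 [simp]: "markov_iter p 0 \<nu> = \<nu>"
  and markov_iter_Suc [simp]: "markov_iter p (Suc k) \<nu> = markov_iter p k \<nu> \<bind> p"
  by (simp_all add: markov_iter_def)

lemma markov_iter_in_prob_algebra:
  assumes "p \<in> borel \<rightarrow>\<^sub>M prob_algebra borel" "\<nu> \<in> space (prob_algebra borel)"
  shows "markov_iter p k \<nu> \<in> space (prob_algebra borel)"
proof (induction k)
  case (Suc k)
  show ?case
    using prob_space_bind'[OF Suc assms(1)] sets_bind'[OF Suc assms(1)] by (simp add: space_prob_algebra)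
qed (use assms in simp)

lemma borel_measurable_kernel_op:
  assumes "p \<in> borel \<rightarrow>\<^sub>M prob_algebra borel" "f \<in> borel_measurable borel"
  shows "kernel_op p f \<in> borel_measurable borel"
  unfolding kernel_op_def[abs_def]
  by (rule measurable_compose[OF measurable_prob_algebraD[OF assms(1)] nn_integral_measurable_subprob_algebra[OF assms(2)]])

lemma nn_integral_markov_iter:
  assumes p: "p \<in> borel \<rightarrow>\<^sub>M prob_algebra borel" and \<nu>: "\<nu> \<in> space (prob_algebra borel)"
    and f: "f \<in> borel_measurable borel"
  shows "(\<integral>\<^sup>+g. f g \<partial>markov_iter p k \<nu>) = (\<integral>\<^sup>+g. (kernel_op p ^^ k) f g \<partial>\<nu>)"
  using f
proof (induction k arbitrary: f)
  case (Suc k)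
  have s: "sets (markov_iter p k \<nu>) = sets borel"
    using markov_iter_in_prob_algebra[OF p \<nu>, of k] by (simp add: space_prob_algebra)
  have "(\<integral>\<^sup>+g. f g \<partial>markov_iter p (Suc k) \<nu>) = (\<integral>\<^sup>+g. kernel_op p f g \<partial>markov_iter p k \<nu>)"
    unfolding markov_iter_Suc kernel_op_def
    using measurable_prob_algebraD[OF p]
    by (intro nn_integral_bind[OF Suc.prems]) (simp add: measurable_cong_sets[OF s refl])
  also have "\<dots> = (\<integral>\<^sup>+g. (kernel_op p ^^ k) (kernel_op p f) g \<partial>\<nu>)"
    by (rule Suc.IH[OF borel_measurable_kernel_op[OF p Suc.prems]])
  finally show ?case
    by (simp add: funpow_Suc_right del: funpow.simps)
qed simp

lemma emeasure_markov_iter: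
  assumes p: "p \<in> borel \<rightarrow>\<^sub>M prob_algebra borel" and K: "is_markov_law p K"
    and \<nu>: "\<nu> \<in> space (prob_algebra borel)" and B: "B \<in> sets borel"
  shows "emeasure (\<nu> \<bind> K) ((path_shift ^^ k) -` {\<omega>. \<omega> 0 \<in> B}) = emeasure (markov_iter p k \<nu>) B"
proof -
  have s: "sets \<nu> = sets borel" "sets (markov_iter p k \<nu>) = sets borel"
    using \<nu> markov_iter_in_prob_algebra[OF p \<nu>, of k] by (simp_all add: space_prob_algebra)
  have eq: "{\<omega>. \<omega> 0 \<in> B} = path_cylinder B []"
    by (simp add: path_cylinder_def)
  have cyl: "{\<omega>. \<omega> 0 \<in> B} \<in> sets path_space"
    unfolding eq by (rule path_cylinder_sets[OF B]) simp
  have "(\<lambda>h. emeasure (K h) {\<omega>. \<omega> 0 \<in> B}) = indicator B"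
    unfolding eq using is_markov_lawD(6)[OF K B, of "[]"] by (simp add: fun_eq_iff)
  then have "emeasure (\<nu> \<bind> K) ((path_shift ^^ k) -` {\<omega>. \<omega> 0 \<in> B}) = (\<integral>\<^sup>+g. (kernel_op p ^^ k) (indicator B) g \<partial>\<nu>)"
    unfolding emeasure_bind_law[OF p K s(1) path_shift_vimage_sets[OF cyl]] markov_law_vimage_funpow[OF p K cyl]
    by simp
  also have "\<dots> = (\<integral>\<^sup>+g. indicator B g \<partial>markov_iter p k \<nu>)"
    by (rule nn_integral_markov_iter[symmetric, OF p \<nu>]) (use B in simp)
  finally show ?thesis
    using B s(2) by simp
qed

lemma ac_prob_measuresD:
  assumes "\<nu> \<in> ac_prob_measures \<mu>"
  shows "prob_space \<nu>" "sets \<nu> = sets borel" "absolutely_continuous \<mu> \<nu>" "\<nu> \<in> space (prob_algebra borel)"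
  using assms by (auto simp: ac_prob_measures_def space_prob_algebra)

context markov_version
begin

lemma emeasure_\<mu>_nonzero: "emeasure \<mu> (space \<mu>) \<noteq> 0"
proof
  assume "emeasure \<mu> (space \<mu>) = 0"
  then have "emeasure (p undefined) (space \<mu>) = 0"
    using absolutely_continuousD[OF ac_p] by blast
  moreover have "emeasure (p undefined) (space \<mu>) = 1"
    using prob_space.emeasure_space_1[OF prob_kernelD(1)[OF p, of undefined]]
      prob_kernelD(3)[OF p, of undefined] space_\<mu> by simp
  ultimately show False by simp
qed

text \<open>Instance of \<open>averages_merge\<close> for the shift on path space: the two measures
  are the path laws from \<open>\<nu>1\<close> and \<open>\<nu>2\<close>, and the test sets
  constrain the coordinate at time 0. Since \<mu> may be infinite, an equivalent probability measure
  serves as initial law.\<close>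

lemma liouville_averages_merge:
  assumes L: "liouville_chain \<mu> \<pi>"
    and \<nu>1: "\<nu>1 \<in> ac_prob_measures \<mu>" and \<nu>2: "\<nu>2 \<in> ac_prob_measures \<mu>" and \<epsilon>: "0 < \<epsilon>"
  shows "\<exists>N. \<forall>n\<ge>N. \<forall>B\<in>sets borel.
    \<bar>(\<Sum>k<n. measure (markov_iter p k \<nu>1) B) - (\<Sum>k<n. measure (markov_iter p k \<nu>2) B)\<bar> \<le> \<epsilon> * real n"
proof -
  interpret sigma_finite_measure \<mu> by (rule sigma_finite_\<mu>)
  obtain w where w: "w \<in> borel_measurable \<mu>" "prob_space (density \<mu> w)"
    "\<And>P. (AE x in density \<mu> w. P x) \<longleftrightarrow> (AE x in \<mu>. P x)"
    by (rule equivalent_prob_density[OF emeasure_\<mu>_nonzero]) (rule that)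
  let ?m = "density \<mu> w"
  let ?M = "?m \<bind> K"
  have m: "?m \<in> space (prob_algebra borel)" "sets ?m = sets borel"
    using w(2) sets_\<mu> by (auto simp: space_prob_algebra)
  have null: "D \<in> null_sets ?M \<longleftrightarrow> D \<in> null_sets (\<mu> \<bind> K)" for D
    unfolding null_sets_bind_K null_sets_bind_law[OF p K m(2)] w(3) ..
  have sets_M: "sets ?M = sets path_space"
    by (rule sets_bind_law[OF p K m(2)])
  have space_M: "space ?M = UNIV"
    using sets_eq_imp_space_eq[OF sets_M] by simp
  interpret M: ergodic_nonsingular ?M path_shift
  proof (intro ergodic_nonsingular.intro ergodic_nonsingular_axioms.intro)
    show "prob_space ?M"
      by (rule prob_space_bind'[OF m(1) is_markov_lawD(1)[OF K]])
    show "path_shift \<in> ?M \<rightarrow>\<^sub>M ?M"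
      by (simp add: measurable_cong_sets[OF sets_M sets_M])
    show "path_shift -` A \<inter> space ?M \<in> null_sets ?M" if "A \<in> null_sets ?M" for A
    proof -
      have A: "A \<in> sets path_space" "AE g in \<mu>. emeasure (K g) A = 0"
        using that unfolding null null_sets_bind_K by auto
      \<comment> \<open>Whatever the start, the position after one step has an absolutely continuous
        law, so a null event stays null when it is required one step later.\<close>
      have "emeasure (K g) (path_shift -` A) = 0" for g
      proof -
        have "AE h in p g. emeasure (K h) A = 0"
          using prob_kernelD(2)[OF p] sets_\<mu> by (intro absolutely_continuous_AE[OF _ ac_p A(2)]) simp
        then show ?thesis
          unfolding markov_law_vimage_shift[OF p K A(1)] by (simp cong: nn_integral_cong_AE)
      qed
      moreover have "path_shift -` A \<in> sets path_space"
        using path_shift_vimage_sets[OF A(1), of 1] by simp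
      ultimately show ?thesis
        unfolding null null_sets_bind_K space_M by simp
    qed
    show "A \<in> null_sets ?M \<or> space ?M - A \<in> null_sets ?M"
      if "A \<in> sets ?M" "path_shift -` A \<inter> space ?M = A" for A
      using liouville_shift_invariant[OF L, of A] that unfolding null space_M sets_M by simp
  qed
  have law: "prob_space (\<nu> \<bind> K) \<and> sets (\<nu> \<bind> K) = sets ?M \<and> absolutely_continuous ?M (\<nu> \<bind> K)"
    if "\<nu> \<in> ac_prob_measures \<mu>" for \<nu>
  proof (intro conjI)
    note \<nu> = ac_prob_measuresD[OF that]
    show "prob_space (\<nu> \<bind> K)"
      by (rule prob_space_bind'[OF \<nu>(4) is_markov_lawD(1)[OF K]])
    show "sets (\<nu> \<bind> K) = sets ?M"
      using sets_bind_law[OF p K \<nu>(2)] sets_M by simp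
    show "absolutely_continuous ?M (\<nu> \<bind> K)"
      unfolding absolutely_continuous_def
    proof
      fix D assume "D \<in> null_sets ?M"
      then have D: "D \<in> sets path_space" "AE g in \<mu>. emeasure (K g) D = 0"
        unfolding null null_sets_bind_K by auto
      then show "D \<in> null_sets (\<nu> \<bind> K)"
        unfolding null_sets_bind_law[OF p K \<nu>(2)]
        using absolutely_continuous_AE[OF _ \<nu>(3) D(2)] \<nu>(2) sets_\<mu> by simp
    qed
  qed
  have meas: "measure (\<nu> \<bind> K) ((path_shift ^^ k) -` {\<omega>. \<omega> 0 \<in> B} \<inter> space ?M) = measure (markov_iter p k \<nu>) B"
    if "\<nu> \<in> ac_prob_measures \<mu>" "B \<in> sets borel" for \<nu> k B
    using emeasure_markov_iter[OF p K ac_prob_measuresD(4)[OF that(1)] that(2), of k]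
    by (simp add: measure_def space_M)
  obtain N where N: "\<And>n D. n \<ge> N \<Longrightarrow> D \<in> sets ?M \<Longrightarrow>
    \<bar>(\<Sum>k<n. measure (\<nu>1 \<bind> K) ((path_shift ^^ k) -` D \<inter> space ?M)) -
      (\<Sum>k<n. measure (\<nu>2 \<bind> K) ((path_shift ^^ k) -` D \<inter> space ?M))\<bar> \<le> \<epsilon> * real n"
    using M.averages_merge[of "\<nu>1 \<bind> K" "\<nu>2 \<bind> K" \<epsilon>] law[OF \<nu>1] law[OF \<nu>2] \<epsilon> by metis
  show ?thesis
  proof (intro exI[of _ N] allI impI ballI)
    fix n B assume n: "N \<le> n" and B: "B \<in> sets (borel :: 'a measure)"
    have "{\<omega>. \<omega> 0 \<in> B} \<in> sets ?M"
      unfolding sets_M using path_cylinder_sets[OF B, of "[]"] by (simp add: path_cylinder_def)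
    from N[OF n this] show "\<bar>(\<Sum>k<n. measure (markov_iter p k \<nu>1) B) -
        (\<Sum>k<n. measure (markov_iter p k \<nu>2) B)\<bar> \<le> \<epsilon> * real n"
      unfolding meas[OF \<nu>1 B] meas[OF \<nu>2 B] .
  qed
qed

end

section \<open>Versions of kernels\<close>

lemma completion_measurable_AE:
  assumes f': "f' \<in> M \<rightarrow>\<^sub>M N" and eq: "AE x in M. f x = f' x"
    and sp: "\<And>x. x \<in> space M \<Longrightarrow> f x \<in> space N"
  shows "f \<in> completion M \<rightarrow>\<^sub>M N"
proof (rule measurableI)
  show "f x \<in> space N" if "x \<in> space (completion M)" for x
    using sp that by simp
  fix A assume A: "A \<in> sets N"
  obtain Z where Z: "Z \<in> null_sets M" "{x\<in>space M. f x \<noteq> f' x} \<subseteq> Z"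
    using eq unfolding eventually_ae_filter by blast
  have "f' -` A \<inter> space M - Z \<in> sets M"
    using measurable_sets[OF f' A] Z(1) by auto
  moreover have "f -` A \<inter> space M = (f' -` A \<inter> space M - Z) \<union> (f -` A \<inter> space M \<inter> Z)"
    using Z(2) by auto
  ultimately show "f -` A \<inter> space (completion M) \<in> sets (completion M)"
    using Z(1) by (auto intro: sets_completionI[of _ "f' -` A \<inter> space M - Z" "f -` A \<inter> space M \<inter> Z" Z])
qed

lemma measurable_completion_null_preserving:
  assumes T: "T \<in> M \<rightarrow>\<^sub>M N" and null: "\<And>A. A \<in> null_sets N \<Longrightarrow> T -` A \<inter> space M \<in> null_sets M"
  shows "T \<in> completion M \<rightarrow>\<^sub>M completion N"
proof (rule measurableI)
  show "T x \<in> space (completion N)" if "x \<in> space (completion M)" for x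
    using measurable_space[OF T] that by simp
  fix A assume "A \<in> sets (completion N)"
  then obtain S Z Z' where A: "A = S \<union> Z" "Z \<subseteq> Z'" "Z' \<in> null_sets N" "S \<in> sets N"
    by (rule sets_completionE)
  show "T -` A \<inter> space (completion M) \<in> sets (completion M)"
    by (rule sets_completionI[of _ "T -` S \<inter> space M" "T -` Z \<inter> space M" "T -` Z' \<inter> space M"])
      (use A null measurable_sets[OF T A(4)] in auto)
qed

text \<open>A kernel is tested on the countable algebra, where each value has a measurable version;
  so one null set \<open>Z\<close> covers all exceptions. On \<open>Z\<close> the kernel is set to
  \<open>c\<close>, and properties shared by the values of \<open>f\<close> and by \<open>c\<close>,
  such as absolute continuity, then hold at every point.\<close>

lemma completion_prob_kernel_version:
  fixes f :: "'b \<Rightarrow> 'a::second_countable_topology measure"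
  assumes f: "f \<in> completion M \<rightarrow>\<^sub>M prob_algebra borel" and c: "c \<in> space (prob_algebra borel)"
  shows "\<exists>p. p \<in> M \<rightarrow>\<^sub>M prob_algebra borel \<and> (AE z in M. p z = f z) \<and>
    (\<forall>z\<in>space M. p z = f z \<or> p z = c)"
proof -
  obtain B :: "nat \<Rightarrow> 'a set" where B: "sets borel = sigma_sets UNIV (range B)"
    using ex_countable_generator by blast
  note G = sigma_sets_setexp[OF B]
  have E: "setexp_val B e \<in> sets borel" for e
    unfolding G by (rule sigma_sets.Basic) simp
  have fz: "prob_space (f z)" "sets (f z) = sets borel" if "z \<in> space M" for z
    using measurable_space[OF f, of z] that by (auto simp: space_prob_algebra)
  have cz: "prob_space c" "sets c = sets borel"
    using c by (auto simp: space_prob_algebra)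
  have "\<exists>u\<in>borel_measurable M. AE z in M. emeasure (f z) (setexp_val B e) = u z" for e
    by (rule completion_ex_borel_measurable)
      (rule measurable_emeasure_kernel[OF measurable_prob_algebraD[OF f] E])
  then obtain u where u: "\<And>e. u e \<in> borel_measurable M"
    "\<And>e. AE z in M. emeasure (f z) (setexp_val B e) = u e z" by metis
  have "AE z in M. \<forall>e. emeasure (f z) (setexp_val B e) = u e z"
    using u(2) by (simp add: AE_all_countable)
  then obtain Z where Z: "Z \<in> null_sets M" "{z\<in>space M. \<not> (\<forall>e. emeasure (f z) (setexp_val B e) = u e z)} \<subseteq> Z"
    unfolding eventually_ae_filter by blast
  have [measurable]: "Z \<in> sets M" using Z(1) by auto
  define p where "p z = (if z \<in> Z then c else f z)" for z
  have "p \<in> M \<rightarrow>\<^sub>M prob_algebra borel"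
  proof (rule measurable_prob_algebra_generated[OF G Int_stable_setexp])
    show "prob_space (p z)" "sets (p z) = sets borel" if "z \<in> space M" for z
      using fz[OF that] cz by (auto simp: p_def)
    fix A assume "A \<in> range (setexp_val B)"
    then obtain e where e: "A = setexp_val B e" by blast
    have "(\<lambda>z. if z \<in> Z then emeasure c A else u e z) \<in> borel_measurable M"
      using u(1)[of e] by measurable
    then show "(\<lambda>z. emeasure (p z) A) \<in> borel_measurable M"
      by (rule measurable_cong[THEN iffD2, rotated]) (use Z(2) in \<open>auto simp: p_def e\<close>)
  qed simp
  moreover have "AE z in M. p z = f z"
    using AE_not_in[OF Z(1)] by eventually_elim (simp add: p_def)
  moreover have "\<forall>z\<in>space M. p z = f z \<or> p z = c"
    by (simp add: p_def)
  ultimately show ?thesis by (intro exI[of _ p] conjI)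
qed

section \<open>Haar measure and actions\<close>

context
  fixes \<mu> :: "'g::{topological_group_add, second_countable_topology, t2_space} measure"
  assumes lc: "locally compact (UNIV :: 'g set)" and haar: "left_haar_measure \<mu>"
begin

lemma haar_sets: "sets \<mu> = sets borel" and haar_space: "space \<mu> = UNIV"
  and haar_nonzero: "emeasure \<mu> (space \<mu>) \<noteq> 0"
proof -
  show s: "sets \<mu> = sets borel" using haar by (simp add: left_haar_measure_def)
  show "space \<mu> = UNIV" using sets_eq_imp_space_eq[OF s] by simp
  then show "emeasure \<mu> (space \<mu>) \<noteq> 0" using haar by (simp add: left_haar_measure_def)
qed

text \<open>Every point has an open neighbourhood inside a compact set, hence of finite measure; by
  Lindelof countably many of them cover the group.\<close>

lemma haar_sigma_finite: "sigma_finite_measure \<mu>"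
proof -
  have "\<exists>U. open U \<and> x \<in> U \<and> emeasure \<mu> U \<noteq> \<infinity>" for x :: 'g
  proof -
    obtain U K where UK: "openin (top_of_set UNIV) U" "compact K" "x \<in> U" "U \<subseteq> K"
      using lc unfolding locally_def by (metis UNIV_I openin_subtopology_self subset_UNIV)
    have "emeasure \<mu> U \<le> emeasure \<mu> K"
      using UK haar_sets compact_imp_closed[OF UK(2)] by (intro emeasure_mono) auto
    also have "\<dots> < \<infinity>"
      using haar UK(2) by (simp add: left_haar_measure_def)
    finally show ?thesis using UK by auto
  qed
  then obtain U where U: "\<And>x :: 'g. open (U x)" "\<And>x. x \<in> U x" "\<And>x. emeasure \<mu> (U x) \<noteq> \<infinity>"
    by metis
  obtain \<F> where \<F>: "\<F> \<subseteq> range U" "countable \<F>" "\<Union>\<F> = \<Union>(range U)"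
    using Lindelof[of "range U"] U(1) by (metis imageE)
  show ?thesis
  proof
    show "\<exists>A. countable A \<and> A \<subseteq> sets \<mu> \<and> \<Union>A = space \<mu> \<and> (\<forall>a\<in>A. emeasure \<mu> a \<noteq> \<infinity>)"
      using \<F> U haar_sets haar_space by (intro exI[of _ \<F>]) auto
  qed
qed

lemma measurable_left_translation [measurable]: "(\<lambda>h. g + h) \<in> borel \<rightarrow>\<^sub>M (borel :: 'g measure)"
  by (intro borel_measurable_continuous_onI continuous_intros)

lemma measurable_group_uminus [measurable]: "uminus \<in> borel \<rightarrow>\<^sub>M (borel :: 'g measure)"
  by (intro borel_measurable_continuous_onI continuous_intros)

lemma measurable_group_plus [measurable]: "(\<lambda>(g, h). g + h) \<in> borel \<Otimes>\<^sub>M borel \<rightarrow>\<^sub>M (borel :: 'g measure)"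
  unfolding borel_prod case_prod_beta
  by (intro borel_measurable_continuous_onI continuous_intros)

lemma haar_left_invariant:
  assumes "A \<in> sets borel"
  shows "emeasure \<mu> ((\<lambda>h. g + h) -` A) = emeasure \<mu> A"
proof -
  have "emeasure \<mu> A = emeasure (distr \<mu> borel (\<lambda>h. g + h)) A"
    using haar by (simp add: left_haar_measure_def)
  also have "\<dots> = emeasure \<mu> ((\<lambda>h. g + h) -` A)"
    using assms by (subst emeasure_distr) (simp_all add: haar_space measurable_cong_sets[OF haar_sets refl])
  finally show ?thesis by simp
qed

lemma absolutely_continuous_translate:
  assumes \<theta>: "sets \<theta> = sets borel" and ac: "absolutely_continuous \<mu> \<theta>"
  shows "absolutely_continuous \<mu> (translate_measure g \<theta>)"
  unfolding absolutely_continuous_def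
proof
  fix A assume "A \<in> null_sets \<mu>"
  then have A: "A \<in> sets borel" "emeasure \<mu> A = 0" using haar_sets by auto
  have m: "(\<lambda>h. g + h) \<in> \<theta> \<rightarrow>\<^sub>M borel"
    by (simp add: measurable_cong_sets[OF \<theta> refl])
  have sp: "space \<theta> = UNIV" using sets_eq_imp_space_eq[OF \<theta>] by simp
  have "(\<lambda>h. g + h) -` A \<in> sets \<mu>"
    using measurable_sets[OF measurable_left_translation A(1), of g] haar_sets by simp
  then have "emeasure \<theta> ((\<lambda>h. g + h) -` A) = 0"
    using absolutely_continuousD[OF ac] haar_left_invariant[OF A(1), of g] A(2) by simp
  then show "A \<in> null_sets (translate_measure g \<theta>)"
    using A(1) by (auto simp: null_sets_def translate_measure_def emeasure_distr[OF m] sp)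
qed

text \<open>Fubini for the set of pairs \<open>(g, h)\<close> with \<open>- h + g \<in> A\<close>:
  for fixed \<open>h\<close> its section is a left translate of \<open>A\<close>, hence null; for
  fixed \<open>g\<close> it is a left translate of \<open>- A\<close>. Equating the two iterated
  integrals gives the claim without the modular function.\<close>

lemma haar_uminus_null:
  assumes A: "A \<in> null_sets \<mu>"
  shows "uminus -` A \<in> null_sets \<mu>"
proof -
  interpret sigma_finite_measure \<mu> by (rule haar_sigma_finite)
  interpret P: pair_sigma_finite \<mu> \<mu> ..
  have Ab: "A \<in> sets borel" "emeasure \<mu> A = 0" using A haar_sets by auto
  let ?S = "{z \<in> space (\<mu> \<Otimes>\<^sub>M \<mu>). - fst z + snd z \<in> uminus -` A}"
  have uA: "uminus -` A \<in> sets borel"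
    using measurable_sets[OF measurable_group_uminus Ab(1)] by simp
  have "(\<lambda>z. - fst z + snd z) \<in> borel \<Otimes>\<^sub>M borel \<rightarrow>\<^sub>M (borel :: 'g measure)"
    unfolding borel_prod by (intro borel_measurable_continuous_onI continuous_intros)
  then have "(\<lambda>z. - fst z + snd z) \<in> \<mu> \<Otimes>\<^sub>M \<mu> \<rightarrow>\<^sub>M borel"
    by (simp cong: measurable_cong_sets sets_pair_measure_cong add: haar_sets)
  from measurable_sets[OF this uA] have S: "?S \<in> sets (\<mu> \<Otimes>\<^sub>M \<mu>)"
    by (simp add: vimage_def Int_def conj_commute)
  have "emeasure (\<mu> \<Otimes>\<^sub>M \<mu>) ?S = (\<integral>\<^sup>+h. emeasure \<mu> ((\<lambda>g. (g, h)) -` ?S) \<partial>\<mu>)"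
    by (rule P.emeasure_pair_measure_alt2[OF S])
  also have "\<dots> = (\<integral>\<^sup>+h. 0 \<partial>\<mu>)"
  proof (intro nn_integral_cong)
    fix h
    have "(\<lambda>g. (g, h)) -` ?S = (\<lambda>g. - h + g) -` A"
      by (auto simp: space_pair_measure haar_space minus_add)
    then show "emeasure \<mu> ((\<lambda>g. (g, h)) -` ?S) = 0"
      using haar_left_invariant[OF Ab(1)] Ab(2) by simp
  qed
  finally have "emeasure (\<mu> \<Otimes>\<^sub>M \<mu>) ?S = 0" by simp
  moreover have "emeasure (\<mu> \<Otimes>\<^sub>M \<mu>) ?S = (\<integral>\<^sup>+g. emeasure \<mu> (Pair g -` ?S) \<partial>\<mu>)"
    by (rule emeasure_pair_measure_alt[OF S])
  moreover have "emeasure \<mu> (Pair g -` ?S) = emeasure \<mu> (uminus -` A)" for g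
  proof -
    have "Pair g -` ?S = (\<lambda>h. - g + h) -` (uminus -` A)"
      by (auto simp: space_pair_measure haar_space)
    then show ?thesis
      using haar_left_invariant[OF uA] by simp
  qed
  ultimately have "emeasure \<mu> (uminus -` A) * emeasure \<mu> (space \<mu>) = 0"
    by simp
  then show ?thesis
    using haar_nonzero uA haar_sets by (auto simp: null_sets_def)
qed

end

section \<open>Quasi-invariant actions: Fubini arguments on the product of group and space\<close>

locale haar_action =
  fixes \<mu> :: "'g::{topological_group_add, second_countable_topology, t2_space} measure"
    and \<kappa> :: "'x measure" and act :: "'g \<Rightarrow> 'x \<Rightarrow> 'x"
  assumes lc: "locally compact (UNIV :: 'g set)" and haar: "left_haar_measure \<mu>"
    and sigma_finite_\<kappa>: "sigma_finite_measure \<kappa>" and complete_\<kappa>: "complete_measure \<kappa>"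
    and act: "measure_class_preserving_action \<mu> \<kappa> act"
begin

lemmas sets_\<mu> = haar_sets[OF lc haar]
lemmas space_\<mu> = haar_space[OF lc haar]
lemmas \<mu>_nonzero = haar_nonzero[OF lc haar]
lemmas sigma_finite_\<mu> = haar_sigma_finite[OF lc haar]

sublocale G: sigma_finite_measure \<mu> by (rule sigma_finite_\<mu>)
sublocale X: sigma_finite_measure \<kappa> by (rule sigma_finite_\<kappa>)
sublocale P: pair_sigma_finite \<mu> \<kappa> ..

lemma sets_pair: "sets (\<mu> \<Otimes>\<^sub>M \<kappa>) = sets (borel \<Otimes>\<^sub>M \<kappa>)"
  by (rule sets_pair_measure_cong[OF sets_\<mu> refl])

lemma space_pair: "space (\<mu> \<Otimes>\<^sub>M \<kappa>) = UNIV \<times> space \<kappa>"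
  by (simp add: space_pair_measure space_\<mu>)

lemma act_measurable: "act g \<in> \<kappa> \<rightarrow>\<^sub>M \<kappa>"
  using act by (simp add: measure_class_preserving_action_def)

lemma act_space: "x \<in> space \<kappa> \<Longrightarrow> act g x \<in> space \<kappa>"
  by (rule measurable_space[OF act_measurable])

lemma act_add: "x \<in> space \<kappa> \<Longrightarrow> act (g + h) x = act g (act h x)"
  using act by (simp add: measure_class_preserving_action_def)

lemma act_null:
  assumes "A \<in> null_sets \<kappa>" shows "act g -` A \<inter> space \<kappa> \<in> null_sets \<kappa>"
proof -
  have "A \<in> null_sets (distr \<kappa> \<kappa> (act g))"
    using act assms by (simp add: measure_class_preserving_action_def)
  then show ?thesis
    by (simp add: null_sets_distr_iff[OF act_measurable])
qed

text \<open>The action is measurable only for the completed product, so composing it with inversion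
  requires that inversion preserves the null sets of the product; on sections this is
  \<open>haar_uminus_null\<close>.\<close>

lemma measurable_inverse_action: "(\<lambda>(g, x). act (- g) x) \<in> completion (\<mu> \<Otimes>\<^sub>M \<kappa>) \<rightarrow>\<^sub>M \<kappa>"
proof -
  let ?T = "\<lambda>(g, x). (- g, x)"
  have u: "uminus \<in> \<mu> \<rightarrow>\<^sub>M \<mu>"
    by (simp add: measurable_cong_sets[OF sets_\<mu> sets_\<mu>] measurable_group_uminus[OF lc haar])
  have T: "?T \<in> \<mu> \<Otimes>\<^sub>M \<kappa> \<rightarrow>\<^sub>M \<mu> \<Otimes>\<^sub>M \<kappa>"
    using u by measurable
  have "?T \<in> completion (\<mu> \<Otimes>\<^sub>M \<kappa>) \<rightarrow>\<^sub>M completion (\<mu> \<Otimes>\<^sub>M \<kappa>)"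
  proof (rule measurable_completion_null_preserving[OF T])
    fix A assume A: "A \<in> null_sets (\<mu> \<Otimes>\<^sub>M \<kappa>)"
    then have As: "A \<in> sets (\<mu> \<Otimes>\<^sub>M \<kappa>)" by auto
    have TA: "?T -` A \<inter> space (\<mu> \<Otimes>\<^sub>M \<kappa>) \<in> sets (\<mu> \<Otimes>\<^sub>M \<kappa>)"
      by (rule measurable_sets[OF T As])
    have "(\<integral>\<^sup>+x. emeasure \<mu> ((\<lambda>g. (g, x)) -` A) \<partial>\<kappa>) = 0"
      using P.emeasure_pair_measure_alt2[OF As] A by auto
    then have "AE x in \<kappa>. emeasure \<mu> ((\<lambda>g. (g, x)) -` A) = 0"
      by (subst (asm) nn_integral_0_iff_AE) (auto intro: P.measurable_emeasure_Pair2[OF As])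
    then have "AE x in \<kappa>. emeasure \<mu> ((\<lambda>g. (g, x)) -` (?T -` A \<inter> space (\<mu> \<Otimes>\<^sub>M \<kappa>))) = 0"
      using AE_space
    proof eventually_elim
      case (elim x)
      have "(\<lambda>g. (g, x)) -` A \<in> null_sets \<mu>"
        using elim sets_Pair2[OF As] by (auto simp: null_sets_def)
      from haar_uminus_null[OF lc haar this]
      have "uminus -` ((\<lambda>g. (g, x)) -` A) \<in> null_sets \<mu>" .
      moreover have "(\<lambda>g. (g, x)) -` (?T -` A \<inter> space (\<mu> \<Otimes>\<^sub>M \<kappa>)) = uminus -` ((\<lambda>g. (g, x)) -` A)"
        using elim by (auto simp: space_pair)
      ultimately show ?case by auto
    qed
    then have "emeasure (\<mu> \<Otimes>\<^sub>M \<kappa>) (?T -` A \<inter> space (\<mu> \<Otimes>\<^sub>M \<kappa>)) = 0"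
      unfolding P.emeasure_pair_measure_alt2[OF TA] by (simp cong: nn_integral_cong_AE)
    with TA show "?T -` A \<inter> space (\<mu> \<Otimes>\<^sub>M \<kappa>) \<in> null_sets (\<mu> \<Otimes>\<^sub>M \<kappa>)"
      by (simp add: null_sets_def)
  qed
  moreover have "(\<lambda>(g, x). act g x) \<in> completion (\<mu> \<Otimes>\<^sub>M \<kappa>) \<rightarrow>\<^sub>M \<kappa>"
    using act by (simp add: measure_class_preserving_action_def)
  ultimately have "(\<lambda>z. (\<lambda>(g, x). act g x) (?T z)) \<in> completion (\<mu> \<Otimes>\<^sub>M \<kappa>) \<rightarrow>\<^sub>M \<kappa>"
    by (rule measurable_compose)
  then show ?thesis by (simp add: case_prod_beta)
qed

text \<open>For fixed \<open>g\<close> the exceptional set has as section the preimage of a null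
  set, which is null by quasi-invariance. The exceptional set is measurable only for the completion,
  so Fubini is applied to its measurable part \<open>A\<close>, and the remainder is covered by
  \<open>Z'\<close>.\<close>

lemma AE_inverse_action:
  assumes "AE x in \<kappa>. Q x"
  shows "AE z in \<mu> \<Otimes>\<^sub>M \<kappa>. Q (act (- fst z) (snd z))"
proof -
  obtain N where N: "N \<in> null_sets \<kappa>" "{x\<in>space \<kappa>. \<not> Q x} \<subseteq> N"
    using assms unfolding eventually_ae_filter by blast
  let ?S = "(\<lambda>(g, x). act (- g) x) -` N \<inter> space (completion (\<mu> \<Otimes>\<^sub>M \<kappa>))"
  have S: "?S \<in> sets (completion (\<mu> \<Otimes>\<^sub>M \<kappa>))"
    using N(1) by (intro measurable_sets[OF measurable_inverse_action]) auto
  then obtain A Z Z' where A: "?S = A \<union> Z" "Z \<subseteq> Z'" "Z' \<in> null_sets (\<mu> \<Otimes>\<^sub>M \<kappa>)" "A \<in> sets (\<mu> \<Otimes>\<^sub>M \<kappa>)"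
    by (rule sets_completionE)
  have "emeasure \<kappa> (Pair g -` A) = 0" for g
  proof -
    have "Pair g -` A \<subseteq> act (- g) -` N \<inter> space \<kappa>"
    proof
      fix b assume "b \<in> Pair g -` A"
      then have "(g, b) \<in> ?S" using A(1) by blast
      then show "b \<in> act (- g) -` N \<inter> space \<kappa>" by (simp add: space_pair)
    qed
    then have "emeasure \<kappa> (Pair g -` A) \<le> emeasure \<kappa> (act (- g) -` N \<inter> space \<kappa>)"
      using act_null[OF N(1)] by (intro emeasure_mono) auto
    also have "\<dots> = 0" using act_null[OF N(1)] by auto
    finally show ?thesis by simp
  qed
  then have "A \<in> null_sets (\<mu> \<Otimes>\<^sub>M \<kappa>)"
    using A(4) X.emeasure_pair_measure_alt[OF A(4)] by (simp add: null_sets_def)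
  then have "AE z in \<mu> \<Otimes>\<^sub>M \<kappa>. z \<notin> A" "AE z in \<mu> \<Otimes>\<^sub>M \<kappa>. z \<notin> Z'"
    using A(3) by (auto intro: AE_not_in)
  then show ?thesis
    using AE_space
  proof eventually_elim
    case (elim z)
    then have "z \<notin> ?S" unfolding A(1) using A(2) by blast
    then have "act (- fst z) (snd z) \<notin> N" using elim(3) by (auto simp: case_prod_beta)
    then show ?case using N(2) act_space[of "snd z" "- fst z"] elim(3) by (auto simp: space_pair)
  qed
qed

lemma AE_pair_sections:
  assumes "AE z in \<mu> \<Otimes>\<^sub>M \<kappa>. Q z"
  shows "AE x in \<kappa>. AE g in \<mu>. Q (g, x)"
proof -
  obtain N where N: "N \<in> null_sets (\<mu> \<Otimes>\<^sub>M \<kappa>)" "{z\<in>space (\<mu> \<Otimes>\<^sub>M \<kappa>). \<not> Q z} \<subseteq> N"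
    using assms unfolding eventually_ae_filter by blast
  then have Ns: "N \<in> sets (\<mu> \<Otimes>\<^sub>M \<kappa>)" by auto
  have "(\<integral>\<^sup>+x. emeasure \<mu> ((\<lambda>g. (g, x)) -` N) \<partial>\<kappa>) = 0"
    using P.emeasure_pair_measure_alt2[OF Ns] N(1) by auto
  then have "AE x in \<kappa>. emeasure \<mu> ((\<lambda>g. (g, x)) -` N) = 0"
    by (subst (asm) nn_integral_0_iff_AE) (auto intro: P.measurable_emeasure_Pair2[OF Ns])
  then show ?thesis
    using AE_space
  proof eventually_elim
    case (elim x)
    have "(\<lambda>g. (g, x)) -` N \<in> null_sets \<mu>"
      using elim sets_Pair2[OF Ns] by (auto simp: null_sets_def)
    from AE_not_in[OF this] show ?case
      by eventually_elim (use N(2) elim(2) in \<open>auto simp: space_pair\<close>)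
  qed
qed

lemma AE_snd:
  assumes "AE x in \<kappa>. Q x" shows "AE z in \<mu> \<Otimes>\<^sub>M \<kappa>. Q (snd z)"
proof -
  obtain N where N: "N \<in> null_sets \<kappa>" "{x\<in>space \<kappa>. \<not> Q x} \<subseteq> N"
    using assms unfolding eventually_ae_filter by blast
  have "UNIV \<times> N \<in> null_sets (\<mu> \<Otimes>\<^sub>M \<kappa>)"
    using N(1) X.times_in_null_sets2[of UNIV \<mu> N] sets.top[of \<mu>] space_\<mu> by simp
  from AE_not_in[OF this] show ?thesis
    using AE_space by eventually_elim (use N(2) in \<open>auto simp: space_pair\<close>)
qed

end

section \<open>Mixtures of kernels\<close>

text \<open>
  The chain picks a letter \<open>i\<close> with probability \<open>1 / 2 ^ (i + 1)\<close> and moves by \<open>P i\<close>.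
  The sub-Markov operator \<open>Q n\<close> only allows the letters below \<open>n\<close>. Decomposing at the first
  occurrence of the letter \<open>n\<close> shows that \<open>Q (n + 1) ^ k - Q n ^ k\<close> is close to a constant
  functional, because after a step \<open>P n\<close> the starting point is almost forgotten.
\<close>

locale letter_mixture =
  fixes P :: "nat \<Rightarrow> 'a::topological_space \<Rightarrow> 'a measure" and \<Theta> :: "nat \<Rightarrow> 'a measure"
    and D :: "nat \<Rightarrow> 'a \<Rightarrow> ennreal" and p :: "'a \<Rightarrow> 'a measure"
  assumes P: "\<And>i. P i \<in> borel \<rightarrow>\<^sub>M prob_algebra borel"
    and D: "\<And>i. D i \<in> borel_measurable borel"
    and P_le: "\<And>i u g. u \<in> borel_measurable borel \<Longrightarrow> (\<And>h. u h \<le> 1) \<Longrightarrow>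
      (\<integral>\<^sup>+h. u h \<partial>P i g) \<le> (\<integral>\<^sup>+h. u h \<partial>\<Theta> i) + D i g"
    and \<Theta>_le: "\<And>i u g. u \<in> borel_measurable borel \<Longrightarrow> (\<And>h. u h \<le> 1) \<Longrightarrow>
      (\<integral>\<^sup>+h. u h \<partial>\<Theta> i) \<le> (\<integral>\<^sup>+h. u h \<partial>P i g) + D i g"
    and p: "\<And>f g. f \<in> borel_measurable borel \<Longrightarrow>
      kernel_op p f g = (\<Sum>i. ennreal ((1/2) ^ Suc i) * (\<integral>\<^sup>+h. f h \<partial>P i g))"
begin

definition t :: "nat \<Rightarrow> ennreal" where "t i = ennreal ((1/2) ^ Suc i)"

lemma p_eq: "f \<in> borel_measurable borel \<Longrightarrow> kernel_op p f g = (\<Sum>i. t i * (\<integral>\<^sup>+h. f h \<partial>P i g))"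
  unfolding t_def by (rule p)

definition Q :: "nat \<Rightarrow> ('a \<Rightarrow> ennreal) \<Rightarrow> 'a \<Rightarrow> ennreal" where
  "Q n f g = (\<Sum>i<n. t i * (\<integral>\<^sup>+h. f h \<partial>P i g))"

lemma P_sets: "sets (P i g) = sets borel" and P_prob: "prob_space (P i g)"
  using prob_kernelD[OF P, of g i] by auto

lemma P_borel: "f \<in> borel_measurable borel \<Longrightarrow> f \<in> borel_measurable (P i g)"
  by (simp add: measurable_cong_sets[OF P_sets refl])

lemma Q_meas:
  assumes f: "f \<in> borel_measurable borel" shows "Q n f \<in> borel_measurable borel"
proof -
  have [measurable]: "(\<lambda>g. \<integral>\<^sup>+h. f h \<partial>P i g) \<in> borel_measurable borel" for i
    by (rule measurable_compose[OF measurable_prob_algebraD[OF P] nn_integral_measurable_subprob_algebra[OF f]])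
  show ?thesis unfolding Q_def[abs_def] by measurable
qed

lemma Q_pow_meas: "f \<in> borel_measurable borel \<Longrightarrow> (Q n ^^ k) f \<in> borel_measurable borel"
  by (induction k) (auto intro: Q_meas)

lemma Q_mono: "(\<And>h. f h \<le> f' h) \<Longrightarrow> Q n f g \<le> Q n f' g"
  unfolding Q_def by (intro sum_mono mult_left_mono nn_integral_mono) auto

lemma Q_add:
  assumes "f \<in> borel_measurable borel" "f' \<in> borel_measurable borel"
  shows "Q n (\<lambda>h. f h + f' h) g = Q n f g + Q n f' g"
  unfolding Q_def using assms
  by (simp add: nn_integral_add P_borel distrib_left sum.distrib)

lemma Q_sum:
  assumes "\<And>j::nat. f j \<in> borel_measurable borel"
  shows "Q n (\<lambda>h. \<Sum>j<k. f j h) g = (\<Sum>j<k. Q n (f j) g)"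
proof (induction k)
  case 0
  show ?case by (simp add: Q_def)
next
  case (Suc k)
  have "(\<lambda>h. \<Sum>j<k. f j h) \<in> borel_measurable borel" using assms by measurable
  then show ?case using Suc assms by (simp add: Q_add)
qed

lemma sum_t: "(\<Sum>i<n. t i) = ennreal (1 - (1/2) ^ n)"
proof -
  have "(\<Sum>i<n. (1/2::real) ^ Suc i) = 1 - (1/2) ^ n"
    by (induction n) (auto simp: field_simps)
  moreover have "(\<Sum>i<n. t i) = ennreal (\<Sum>i<n. (1/2::real) ^ Suc i)"
    unfolding t_def by (rule sum_ennreal) simp
  ultimately show ?thesis by simp
qed

lemma Q_const: "Q n (\<lambda>_. c) g = ennreal (1 - (1/2) ^ n) * c"
proof -
  have "(\<integral>\<^sup>+h. c \<partial>P i g) = c" for i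
    by (simp add: prob_space.emeasure_space_1[OF P_prob])
  then show ?thesis
    unfolding Q_def sum_t[symmetric] by (simp only: sum_distrib_right)
qed

lemma q_le_1: "ennreal (1 - (1/2) ^ n) \<le> 1"
  by simp

lemma Q_pow_le:
  assumes f: "\<And>h. f h \<le> 1" shows "(Q n ^^ k) f g \<le> ennreal ((1 - (1/2) ^ n) ^ k)"
proof (induction k arbitrary: g)
  case 0
  then show ?case using f by simp
next
  case (Suc k)
  have "(Q n ^^ Suc k) f g \<le> Q n (\<lambda>_. ennreal ((1 - (1/2) ^ n) ^ k)) g"
    using Q_mono[OF Suc] by simp
  also have "\<dots> = ennreal ((1 - (1/2) ^ n) ^ Suc k)"
    unfolding Q_const by (simp add: ennreal_mult power_le_one)
  finally show ?case .
qed

lemma Q_pow_le_1: "(\<And>h. f h \<le> 1) \<Longrightarrow> (Q n ^^ k) f g \<le> 1"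
  by (rule order_trans[OF Q_pow_le]) (auto simp: power_le_one)

lemma Q_Suc: "Q (Suc n) u g = Q n u g + t n * (\<integral>\<^sup>+h. u h \<partial>P n g)"
  by (simp add: Q_def)

lemma t_le_1: "t n \<le> 1"
  unfolding t_def by (subst ennreal_le_1) (rule power_le_one, simp_all)

lemma t_mult_le: "t n * (a + b) \<le> t n * a + b"
  using mult_right_mono[OF t_le_1[of n], of b] by (simp add: distrib_left add_left_mono)

text \<open>If \<open>n\<close> first occurs after \<open>j\<close> smaller letters, the walk up to
  then is described by \<open>Q n ^^ j\<close>, and forgetting the position costs at most
  \<open>D n\<close> there. What follows starts from \<open>\<Theta> n\<close>, independently of
  \<open>g\<close>, and is collected in \<open>c\<close>. Two inequalities stand for a bound on a
  difference, since \<open>ennreal\<close> has no negative values.\<close>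

lemma first_occurrence:
  assumes f: "f \<in> borel_measurable borel" and f1: "\<And>h. f h \<le> 1"
  shows "\<exists>c. \<forall>g.
    (Q (Suc n) ^^ k) f g \<le> (Q n ^^ k) f g + c + (\<Sum>j<k. (Q n ^^ j) (D n) g) \<and>
    (Q n ^^ k) f g + c \<le> (Q (Suc n) ^^ k) f g + (\<Sum>j<k. (Q n ^^ j) (D n) g)"
proof (induction k)
  case 0
  show ?case by (rule exI[of _ 0]) simp
next
  case (Suc k)
  let ?u = "(Q (Suc n) ^^ k) f" and ?v = "(Q n ^^ k) f"
  let ?S = "\<lambda>k g. \<Sum>j<k. (Q n ^^ j) (D n) g"
  let ?q = "ennreal (1 - (1/2) ^ n)"
  obtain c where c: "\<And>g. ?u g \<le> ?v g + c + ?S k g" "\<And>g. ?v g + c \<le> ?u g + ?S k g"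
    using Suc by blast
  have u[measurable]: "?u \<in> borel_measurable borel" and v[measurable]: "?v \<in> borel_measurable borel"
    and Dj[measurable]: "\<And>j. (Q n ^^ j) (D n) \<in> borel_measurable borel"
    using Q_pow_meas f D by auto
  have S[measurable]: "?S k \<in> borel_measurable borel" by measurable
  have u1: "?u h \<le> 1" for h by (rule Q_pow_le_1[OF f1])
  have QS: "Q n (?S k) g + D n g = ?S (Suc k) g" for g
    unfolding Q_sum[OF Dj] sum.lessThan_Suc_shift by (simp add: add.commute)
  let ?I = "\<integral>\<^sup>+h. ?u h \<partial>\<Theta> n"
  have QSuc: "(Q (Suc n) ^^ Suc k) f g = Q n ?u g + t n * (\<integral>\<^sup>+h. ?u h \<partial>P n g)" for g
    using Q_Suc[of n ?u g] by simp
  \<comment> \<open>The new constant: a first letter below \<open>n\<close>, of total weight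
    \<open>?q\<close>, keeps \<open>c\<close>, while a first letter \<open>n\<close> restarts the
    walk from \<open>\<Theta> n\<close> and contributes \<open>t n * ?I\<close>.\<close>
  have "(Q (Suc n) ^^ Suc k) f g \<le> (Q n ^^ Suc k) f g + (?q * c + t n * ?I) + ?S (Suc k) g" for g
  proof -
    have "(Q (Suc n) ^^ Suc k) f g = Q n ?u g + t n * (\<integral>\<^sup>+h. ?u h \<partial>P n g)"
      by (rule QSuc)
    also have "\<dots> \<le> Q n (\<lambda>h. ?v h + c + ?S k h) g + (t n * ?I + D n g)"
    proof (rule add_mono)
      show "Q n ?u g \<le> Q n (\<lambda>h. ?v h + c + ?S k h) g"
        by (rule Q_mono[OF c(1)])
      show "t n * (\<integral>\<^sup>+h. ?u h \<partial>P n g) \<le> t n * ?I + D n g"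
        by (rule order_trans[OF mult_left_mono[OF P_le[OF u u1]] t_mult_le]) simp
    qed
    also have "Q n (\<lambda>h. ?v h + c + ?S k h) g = Q n ?v g + ?q * c + Q n (?S k) g"
      by (simp add: Q_add Q_const)
    finally show ?thesis
      unfolding QS[symmetric] by (simp add: ac_simps)
  qed
  moreover have "(Q n ^^ Suc k) f g + (?q * c + t n * ?I) \<le> (Q (Suc n) ^^ Suc k) f g + ?S (Suc k) g" for g
  proof -
    have "(Q n ^^ Suc k) f g + (?q * c + t n * ?I) = Q n (\<lambda>h. ?v h + c) g + t n * ?I"
      by (simp add: Q_add Q_const add.assoc)
    also have "\<dots> \<le> Q n (\<lambda>h. ?u h + ?S k h) g + (t n * (\<integral>\<^sup>+h. ?u h \<partial>P n g) + D n g)"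
    proof (rule add_mono)
      show "Q n (\<lambda>h. ?v h + c) g \<le> Q n (\<lambda>h. ?u h + ?S k h) g"
        by (rule Q_mono[OF c(2)])
      show "t n * ?I \<le> t n * (\<integral>\<^sup>+h. ?u h \<partial>P n g) + D n g"
        by (rule order_trans[OF mult_left_mono[OF \<Theta>_le[OF u u1]] t_mult_le]) simp
    qed
    also have "Q n (\<lambda>h. ?u h + ?S k h) g = Q n ?u g + Q n (?S k) g"
      by (simp add: Q_add)
    finally show ?thesis
      unfolding QS[symmetric] QSuc by (simp add: ac_simps)
  qed
  ultimately show ?case
    by (intro exI[of _ "?q * c + t n * ?I"] allI conjI)
qed

text \<open>By \<open>(1 - x) ^ k \<le> exp (- (k * x))\<close> a word of this length uses only
  letters below \<open>n\<close> with probability at most \<open>exp (- n)\<close>.\<close>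

definition K :: "nat \<Rightarrow> nat" where "K n = n * 2 ^ n"

lemma K_mono: "m \<le> n \<Longrightarrow> K m \<le> K n"
  unfolding K_def by (intro mult_mono power_increasing) auto

text \<open>Bounds the cost of forgetting at the first letter \<open>n\<close>, over the
  \<open>K n\<close> possible times of its occurrence. The good starting points are those where the
  sum over \<open>n\<close> is finite.\<close>

definition J :: "nat \<Rightarrow> 'a \<Rightarrow> ennreal" where
  "J n g = (\<Sum>j<K n. (Q n ^^ j) (D n) g)"

text \<open>Adds the letters from \<open>N\<close> to \<open>M - 1\<close> one at a time by
  \<open>first_occurrence\<close>. The same \<open>k \<le> K N\<close> serves for all of them
  because \<open>K\<close> is monotone.\<close>

lemma telescope:
  assumes f: "f \<in> borel_measurable borel" and f1: "\<And>h. f h \<le> 1"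
    and k: "k \<le> K N" and "N \<le> M"
  shows "\<exists>c. \<forall>g. (Q M ^^ k) f g \<le> (Q N ^^ k) f g + c + (\<Sum>n\<in>{N..<M}. J n g) \<and>
    (Q N ^^ k) f g + c \<le> (Q M ^^ k) f g + (\<Sum>n\<in>{N..<M}. J n g)"
  using \<open>N \<le> M\<close>
proof (induction M rule: dec_induct)
  case base
  show ?case by (rule exI[of _ 0]) simp
next
  case (step M)
  obtain c where c: "\<And>g. (Q M ^^ k) f g \<le> (Q N ^^ k) f g + c + (\<Sum>n\<in>{N..<M}. J n g)"
    "\<And>g. (Q N ^^ k) f g + c \<le> (Q M ^^ k) f g + (\<Sum>n\<in>{N..<M}. J n g)"
    using step.IH by blast
  obtain d where d: "\<And>g. (Q (Suc M) ^^ k) f g \<le> (Q M ^^ k) f g + d + (\<Sum>j<k. (Q M ^^ j) (D M) g)"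
    "\<And>g. (Q M ^^ k) f g + d \<le> (Q (Suc M) ^^ k) f g + (\<Sum>j<k. (Q M ^^ j) (D M) g)"
    using first_occurrence[OF f f1, where n = M and k = k] by blast
  have J: "(\<Sum>j<k. (Q M ^^ j) (D M) g) \<le> J M g" for g
    unfolding J_def using k K_mono[OF step(1)] by (intro sum_mono2) auto
  have sum: "(\<Sum>n\<in>{N..<Suc M}. J n g) = (\<Sum>n\<in>{N..<M}. J n g) + J M g" for g
    using step(1) by (simp add: atLeastLessThanSuc add.commute)
  have "(Q (Suc M) ^^ k) f g \<le> (Q N ^^ k) f g + (c + d) + (\<Sum>n\<in>{N..<Suc M}. J n g)" for g
  proof -
    have "(Q (Suc M) ^^ k) f g \<le> (Q M ^^ k) f g + d + J M g"
      by (rule order_trans[OF d(1) add_left_mono[OF J]])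
    also have "\<dots> \<le> ((Q N ^^ k) f g + c + (\<Sum>n\<in>{N..<M}. J n g)) + d + J M g"
      by (intro add_right_mono c(1))
    finally show ?thesis unfolding sum by (simp add: ac_simps)
  qed
  moreover have "(Q N ^^ k) f g + (c + d) \<le> (Q (Suc M) ^^ k) f g + (\<Sum>n\<in>{N..<Suc M}. J n g)" for g
  proof -
    have "(Q N ^^ k) f g + (c + d) = (Q N ^^ k) f g + c + d" by (simp add: add.assoc)
    also have "\<dots> \<le> (Q M ^^ k) f g + (\<Sum>n\<in>{N..<M}. J n g) + d"
      by (intro add_right_mono c(2))
    also have "\<dots> = ((Q M ^^ k) f g + d) + (\<Sum>n\<in>{N..<M}. J n g)" by (simp add: ac_simps)
    also have "\<dots> \<le> ((Q (Suc M) ^^ k) f g + J M g) + (\<Sum>n\<in>{N..<M}. J n g)"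
      by (intro add_right_mono order_trans[OF d(2) add_left_mono[OF J]])
    finally show ?thesis unfolding sum by (simp add: ac_simps)
  qed
  ultimately show ?case by (intro exI[of _ "c + d"] allI conjI)
qed

lemma Q_le_p: "f \<in> borel_measurable borel \<Longrightarrow> Q n f g \<le> kernel_op p f g"
  unfolding p_eq Q_def by (rule sum_le_suminf) auto

lemma p_le_Q:
  assumes f: "f \<in> borel_measurable borel" and f1: "\<And>h. f h \<le> 1"
  shows "kernel_op p f g \<le> Q n f g + ennreal ((1/2) ^ n)"
  unfolding p_eq[OF f]
proof (rule suminf_le_const)
  show "summable (\<lambda>i. t i * (\<integral>\<^sup>+h. f h \<partial>P i g))" by simp
  fix m
  have int: "(\<integral>\<^sup>+h. f h \<partial>P i g) \<le> 1" for i
  proof -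
    have "(\<integral>\<^sup>+h. f h \<partial>P i g) \<le> (\<integral>\<^sup>+h. 1 \<partial>P i g)" by (intro nn_integral_mono f1)
    then show ?thesis using prob_space.emeasure_space_1[OF P_prob] by simp
  qed
  have tail: "(\<Sum>i\<in>{n..<n + m}. t i) \<le> ennreal ((1/2) ^ n)"
  proof -
    have "(\<Sum>i\<in>{n..<n + m}. (1/2::real) ^ Suc i) = (1/2) ^ n - (1/2) ^ (n + m)"
    proof (induction m)
      case (Suc m)
      have "{n..<n + Suc m} = insert (n + m) {n..<n + m}" by auto
      with Suc show ?case by simp
    qed simp
    moreover have "(\<Sum>i\<in>{n..<n + m}. t i) = ennreal (\<Sum>i\<in>{n..<n + m}. (1/2::real) ^ Suc i)"
      unfolding t_def by (rule sum_ennreal) simp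
    ultimately have "(\<Sum>i\<in>{n..<n + m}. t i) = ennreal ((1/2) ^ n - (1/2) ^ (n + m))"
      by simp
    then show ?thesis by (simp add: ennreal_leI)
  qed
  have "(\<Sum>i<m. t i * (\<integral>\<^sup>+h. f h \<partial>P i g)) \<le> (\<Sum>i<n + m. t i * (\<integral>\<^sup>+h. f h \<partial>P i g))"
    by (intro sum_mono2) auto
  also have "\<dots> = Q n f g + (\<Sum>i\<in>{n..<n + m}. t i * (\<integral>\<^sup>+h. f h \<partial>P i g))"
    unfolding Q_def lessThan_atLeast0 by (rule sum.atLeastLessThan_concat[symmetric]) auto
  also have "(\<Sum>i\<in>{n..<n + m}. t i * (\<integral>\<^sup>+h. f h \<partial>P i g)) \<le> (\<Sum>i\<in>{n..<n + m}. t i * 1)"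
    by (intro sum_mono mult_left_mono int) simp
  also have "\<dots> \<le> ennreal ((1/2) ^ n)" using tail by simp
  finally show "(\<Sum>i<m. t i * (\<integral>\<^sup>+h. f h \<partial>P i g)) \<le> Q n f g + ennreal ((1/2) ^ n)"
    by (simp add: add_left_mono)
qed

lemma p_meas:
  assumes f: "f \<in> borel_measurable borel" shows "kernel_op p f \<in> borel_measurable borel"
proof -
  have [measurable]: "(\<lambda>g. \<integral>\<^sup>+h. f h \<partial>P i g) \<in> borel_measurable borel" for i
    by (rule measurable_compose[OF measurable_prob_algebraD[OF P] nn_integral_measurable_subprob_algebra[OF f]])
  have "kernel_op p f = (\<lambda>g. \<Sum>i. t i * (\<integral>\<^sup>+h. f h \<partial>P i g))"
    using p_eq[OF f] by (simp add: fun_eq_iff)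
  then show ?thesis by simp
qed

lemma p_pow_meas: "f \<in> borel_measurable borel \<Longrightarrow> (kernel_op p ^^ k) f \<in> borel_measurable borel"
  by (induction k) (auto intro: p_meas)

lemma Q_pow_le_p_pow:
  assumes f: "f \<in> borel_measurable borel"
  shows "(Q n ^^ k) f g \<le> (kernel_op p ^^ k) f g"
proof (induction k arbitrary: g)
  case (Suc k)
  have "(Q n ^^ Suc k) f g \<le> Q n ((kernel_op p ^^ k) f) g"
    using Q_mono[OF Suc] by simp
  also have "\<dots> \<le> (kernel_op p ^^ Suc k) f g"
    using Q_le_p[OF p_pow_meas[OF f]] by simp
  finally show ?case .
qed simp

lemma p_pow_le_1:
  assumes f: "f \<in> borel_measurable borel" and f1: "\<And>h. f h \<le> 1"
  shows "(kernel_op p ^^ k) f g \<le> 1"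
proof (induction k arbitrary: g)
  case (Suc k)
  let ?u = "(kernel_op p ^^ k) f"
  show ?case
    using p_le_Q[OF p_pow_meas[OF f] Suc, of g 0] by (simp add: Q_def)
qed (use f1 in simp)

text \<open>Union bound: the letters from \<open>n\<close> on have total weight
  \<open>(1/2) ^ n\<close>, and \<open>k\<close> steps offer \<open>k\<close> chances for one of
  them.\<close>

lemma p_pow_le_Q_pow:
  assumes f: "f \<in> borel_measurable borel" and f1: "\<And>h. f h \<le> 1"
  shows "(kernel_op p ^^ k) f g \<le> (Q n ^^ k) f g + ennreal (real k * (1/2) ^ n)"
proof (induction k arbitrary: g)
  case (Suc k)
  let ?u = "(kernel_op p ^^ k) f" and ?e = "ennreal (real k * (1/2) ^ n)"
  have "kernel_op p ?u g \<le> Q n ?u g + ennreal ((1/2) ^ n)"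
    by (rule p_le_Q[OF p_pow_meas[OF f] p_pow_le_1[OF f f1]])
  also have "Q n ?u g \<le> Q n (\<lambda>h. (Q n ^^ k) f h + ?e) g"
    by (rule Q_mono[OF Suc])
  also have "\<dots> = (Q n ^^ Suc k) f g + ennreal (1 - (1/2) ^ n) * ?e"
    using Q_pow_meas[OF f] by (simp add: Q_add Q_const)
  also have "ennreal (1 - (1/2) ^ n) * ?e \<le> 1 * ?e"
    by (rule mult_right_mono[OF q_le_1]) simp
  finally have "kernel_op p ?u g \<le> (Q n ^^ Suc k) f g + (?e + ennreal ((1/2) ^ n))"
    by (simp add: add_left_mono add_right_mono add.assoc)
  also have "?e + ennreal ((1/2) ^ n) = ennreal (real (Suc k) * (1/2) ^ n)"
    by (subst ennreal_plus[symmetric]) (auto simp: algebra_simps)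
  finally show ?case by simp
qed simp

lemma ennreal_tail_small:
  fixes a :: "nat \<Rightarrow> ennreal"
  assumes "(\<Sum>n. a n) < \<infinity>" "0 < \<epsilon>"
  shows "\<exists>N0. \<forall>N\<ge>N0. \<forall>M\<ge>N. (\<Sum>n\<in>{N..<M}. a n) \<le> ennreal \<epsilon>"
proof -
  let ?S = "\<Sum>n. a n"
  have "(\<lambda>N. (\<Sum>n<N. a n) + ennreal \<epsilon>) \<longlonglongrightarrow> ?S + ennreal \<epsilon>"
    by (intro tendsto_add summable_LIMSEQ tendsto_const) simp
  moreover have "?S < ?S + ennreal \<epsilon>"
    using assms by (cases ?S) (auto simp: ennreal_plus[symmetric] ennreal_less_iff simp del: ennreal_plus)
  ultimately have "eventually (\<lambda>N. ?S < (\<Sum>n<N. a n) + ennreal \<epsilon>) sequentially"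
    by (rule order_tendstoD(1))
  then obtain N0 where N0: "\<And>N. N \<ge> N0 \<Longrightarrow> ?S < (\<Sum>n<N. a n) + ennreal \<epsilon>"
    unfolding eventually_sequentially by blast
  have "(\<Sum>n\<in>{N..<M}. a n) \<le> ennreal \<epsilon>" if "N0 \<le> N" "N \<le> M" for N M
  proof -
    have "(\<Sum>n<N. a n) + (\<Sum>n\<in>{N..<M}. a n) = (\<Sum>n<M. a n)"
      unfolding lessThan_atLeast0 using that by (intro sum.atLeastLessThan_concat) auto
    also have "\<dots> \<le> ?S" by (rule sum_le_suminf) auto
    also have "\<dots> \<le> (\<Sum>n<N. a n) + ennreal \<epsilon>" using N0[OF that(1)] by simp
    finally have "(\<Sum>n<N. a n) + (\<Sum>n\<in>{N..<M}. a n) \<le> (\<Sum>n<N. a n) + ennreal \<epsilon>" .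
    moreover have "(\<Sum>n<N. a n) < \<infinity>"
      by (rule le_less_trans[OF sum_le_suminf assms(1)]) auto
    then have "(\<Sum>n<N. a n) \<noteq> \<infinity>" by (rule less_imp_neq)
    ultimately show ?thesis unfolding ennreal_add_left_cancel_le by blast
  qed
  then show ?thesis by blast
qed

text \<open>The order of choices matters: \<open>N\<close> makes \<open>exp (- N)\<close> and the
  tails of \<open>J\<close> at both points small, then \<open>k = K N\<close>, then \<open>M\<close>
  makes \<open>k / 2 ^ M\<close> small. The four errors come from words with letters below
  \<open>N\<close> only, from forgetting at \<open>g\<close>, from forgetting at \<open>g'\<close>,
  and from letters beyond \<open>M\<close>; the constant \<open>c\<close> is common to
  \<open>g\<close> and \<open>g'\<close>.\<close>

lemma mixture_oscillation:
  assumes g: "(\<Sum>n. J n g) < \<infinity>" and g': "(\<Sum>n. J n g') < \<infinity>" and \<epsilon>: "0 < (\<epsilon>::real)"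
  shows "\<exists>k. \<forall>f\<in>borel_measurable borel. (\<forall>h. f h \<le> 1) \<longrightarrow>
        (kernel_op p ^^ k) f g \<le> (kernel_op p ^^ k) f g' + ennreal \<epsilon>"
proof -
  have \<epsilon>4: "0 < \<epsilon> / 4" using \<epsilon> by simp
  obtain N1 where N1: "\<And>N M. N \<ge> N1 \<Longrightarrow> M \<ge> N \<Longrightarrow> (\<Sum>n\<in>{N..<M}. J n g) \<le> ennreal (\<epsilon> / 4)"
    using ennreal_tail_small[OF g \<epsilon>4] by blast
  obtain N2 where N2: "\<And>N M. N \<ge> N2 \<Longrightarrow> M \<ge> N \<Longrightarrow> (\<Sum>n\<in>{N..<M}. J n g') \<le> ennreal (\<epsilon> / 4)"
    using ennreal_tail_small[OF g' \<epsilon>4] by blast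
  have "(\<lambda>n. exp (- real n)) \<longlonglongrightarrow> 0"
    by (intro filterlim_compose[OF exp_at_bot] filterlim_uminus_at_bot_at_top[THEN filterlim_compose]
        filterlim_real_sequentially)
  then have "eventually (\<lambda>n. exp (- real n) < \<epsilon> / 4) sequentially"
    by (rule order_tendstoD(2)) (rule \<epsilon>4)
  then obtain N3 where N3: "\<And>n. n \<ge> N3 \<Longrightarrow> exp (- real n) < \<epsilon> / 4"
    unfolding eventually_sequentially by blast
  define N where "N = max N1 (max N2 N3)"
  have N: "N1 \<le> N" "N2 \<le> N" "N3 \<le> N" by (auto simp: N_def)
  define k where "k = K N"
  have q: "(1 - (1/2::real) ^ N) ^ k \<le> \<epsilon> / 4"
  proof -
    have "(1 - (1/2::real) ^ N) ^ k \<le> exp (- ((1/2) ^ N)) ^ k"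
      using exp_ge_add_one_self[of "- ((1/2::real) ^ N)"] by (intro power_mono) (auto simp: power_le_one)
    also have "\<dots> = exp (- (real k * (1/2) ^ N))"
      by (simp add: exp_of_nat_mult[symmetric])
    also have "real k * (1/2) ^ N = real N"
      unfolding k_def K_def by (simp add: power_divide)
    finally show ?thesis using N3[OF N(3)] by simp
  qed
  have "(\<lambda>M. real k * (1/2) ^ M) \<longlonglongrightarrow> real k * 0"
    by (intro tendsto_intros LIMSEQ_realpow_zero) auto
  then have "eventually (\<lambda>M. real k * (1/2) ^ M < \<epsilon> / 4) sequentially"
    by (intro order_tendstoD(2)) (use \<epsilon>4 in auto)
  then obtain M0 where M0: "\<And>M. M \<ge> M0 \<Longrightarrow> real k * (1/2) ^ M < \<epsilon> / 4"
    unfolding eventually_sequentially by blast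
  define M where "M = max M0 N"
  have M: "M0 \<le> M" "N \<le> M" by (auto simp: M_def)
  show ?thesis
  proof (intro exI[of _ k] ballI impI)
    fix f :: "'a \<Rightarrow> ennreal" assume f: "f \<in> borel_measurable borel" and "\<forall>h. f h \<le> 1"
    then have f1: "\<And>h. f h \<le> 1" by simp
    obtain c where c: "\<And>g. (Q M ^^ k) f g \<le> (Q N ^^ k) f g + c + (\<Sum>n\<in>{N..<M}. J n g)"
      "\<And>g. (Q N ^^ k) f g + c \<le> (Q M ^^ k) f g + (\<Sum>n\<in>{N..<M}. J n g)"
      using telescope[OF f f1 _ M(2), of k] unfolding k_def by blast
    have cle: "c \<le> (kernel_op p ^^ k) f g' + ennreal (\<epsilon> / 4)"
    proof -
      have "c \<le> (Q N ^^ k) f g' + c" by simp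
      also have "\<dots> \<le> (Q M ^^ k) f g' + (\<Sum>n\<in>{N..<M}. J n g')" by (rule c(2))
      also have "\<dots> \<le> (kernel_op p ^^ k) f g' + ennreal (\<epsilon> / 4)"
        by (intro add_mono Q_pow_le_p_pow f N2 N M)
      finally show ?thesis .
    qed
    have "(kernel_op p ^^ k) f g \<le> (Q M ^^ k) f g + ennreal (real k * (1/2) ^ M)"
      by (rule p_pow_le_Q_pow[OF f f1])
    also have "\<dots> \<le> ((Q N ^^ k) f g + c + (\<Sum>n\<in>{N..<M}. J n g)) + ennreal (\<epsilon> / 4)"
      using M0[OF M(1)] by (intro add_mono c(1) ennreal_leI) simp
    also have "\<dots> \<le> (ennreal (\<epsilon> / 4) + ((kernel_op p ^^ k) f g' + ennreal (\<epsilon> / 4)) + ennreal (\<epsilon> / 4)) + ennreal (\<epsilon> / 4)"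
      by (intro add_mono cle N1 N M order_refl order_trans[OF Q_pow_le[OF f1]] ennreal_leI q)
    also have "\<dots> = (kernel_op p ^^ k) f g' + (ennreal (\<epsilon> / 4) + ennreal (\<epsilon> / 4) + ennreal (\<epsilon> / 4) + ennreal (\<epsilon> / 4))"
      by (simp add: ac_simps)
    also have "ennreal (\<epsilon> / 4) + ennreal (\<epsilon> / 4) + ennreal (\<epsilon> / 4) + ennreal (\<epsilon> / 4) = ennreal \<epsilon>"
      using \<epsilon> by (simp flip: ennreal_plus)
    finally show "(kernel_op p ^^ k) f g \<le> (kernel_op p ^^ k) f g' + ennreal \<epsilon>" .
  qed
qed

end

section \<open>Random walks in an environment\<close>

lemma measurable_ac_prob_map_iff:
  fixes \<mu> :: "'a::topological_space measure"
  shows "measurable_ac_prob_map \<mu> \<kappa> \<theta> \<longleftrightarrow>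
    \<theta> \<in> \<kappa> \<rightarrow>\<^sub>M prob_algebra borel \<and> (\<forall>x\<in>space \<kappa>. \<theta> x \<in> ac_prob_measures \<mu>)"
proof safe
  assume \<theta>: "measurable_ac_prob_map \<mu> \<kappa> \<theta>"
  then show ac: "\<theta> x \<in> ac_prob_measures \<mu>" if "x \<in> space \<kappa>" for x
    using that by (simp add: measurable_ac_prob_map_def)
  show "\<theta> \<in> \<kappa> \<rightarrow>\<^sub>M prob_algebra borel"
  proof (rule measurable_prob_algebraI)
    show "prob_space (\<theta> x)" if "x \<in> space \<kappa>" for x
      by (rule ac_prob_measuresD[OF ac[OF that]])
    show "\<theta> \<in> \<kappa> \<rightarrow>\<^sub>M subprob_algebra borel"
    proof (rule measurable_subprob_algebra)
      show "subprob_space (\<theta> x)" "sets (\<theta> x) = sets borel" if "x \<in> space \<kappa>" for x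
        using ac_prob_measuresD[OF ac[OF that]] by (auto intro: prob_space_imp_subprob_space)
      fix A :: "'a set" assume A: "A \<in> sets borel"
      have "(\<lambda>x. \<integral>\<^sup>+g. indicator A g \<partial>\<theta> x) \<in> borel_measurable \<kappa>"
        using \<theta> A by (simp add: measurable_ac_prob_map_def)
      then show "(\<lambda>x. emeasure (\<theta> x) A) \<in> borel_measurable \<kappa>"
        by (rule measurable_cong[THEN iffD1, rotated]) (use A ac_prob_measuresD(2)[OF ac] in simp)
    qed
  qed
next
  assume \<theta>: "\<theta> \<in> \<kappa> \<rightarrow>\<^sub>M prob_algebra borel" and ac: "\<forall>x\<in>space \<kappa>. \<theta> x \<in> ac_prob_measures \<mu>"
  show "measurable_ac_prob_map \<mu> \<kappa> \<theta>"
    unfolding measurable_ac_prob_map_def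
    using ac measurable_compose[OF measurable_prob_algebraD[OF \<theta>] nn_integral_measurable_subprob_algebra]
    by blast
qed

lemma AE_bind_absolutely_continuous:
  assumes p: "p \<in> L \<rightarrow>\<^sub>M prob_algebra borel" and \<nu>: "\<nu> \<in> space (prob_algebra L)"
    and sets: "sets \<mu> = sets borel" and ac: "AE z in \<nu>. absolutely_continuous \<mu> (p z)"
  shows "\<nu> \<bind> p \<in> ac_prob_measures \<mu>"
  unfolding ac_prob_measures_def
proof (intro CollectI conjI)
  show "prob_space (\<nu> \<bind> p)" by (rule prob_space_bind'[OF \<nu> p])
  show s: "sets (\<nu> \<bind> p) = sets borel" by (rule sets_bind'[OF \<nu> p])
  show "absolutely_continuous \<mu> (\<nu> \<bind> p)"
    unfolding absolutely_continuous_def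
  proof
    fix A assume A: "A \<in> null_sets \<mu>"
    then have Ab: "A \<in> sets borel" using sets by auto
    have "emeasure (\<nu> \<bind> p) A = (\<integral>\<^sup>+z. emeasure (p z) A \<partial>\<nu>)"
      by (rule emeasure_bind_prob_algebra[OF \<nu> p Ab])
    also have "\<dots> = (\<integral>\<^sup>+z. 0 \<partial>\<nu>)"
      by (rule nn_integral_cong_AE, use ac in eventually_elim)
        (use A absolutely_continuousD in blast)
    finally show "A \<in> null_sets (\<nu> \<bind> p)"
      using Ab s by (simp add: null_sets_def)
  qed
qed

context haar_action
begin

lemma space_inverse_action: "z \<in> space (\<mu> \<Otimes>\<^sub>M \<kappa>) \<Longrightarrow> act (- fst z) (snd z) \<in> space \<kappa>"
  by (rule act_space) (auto simp: space_pair)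

definition walk_kernel :: "('x \<Rightarrow> 'g measure) \<Rightarrow> 'g \<times> 'x \<Rightarrow> 'g measure" where
  "walk_kernel \<theta> z = translate_measure (fst z) (\<theta> (act (- fst z) (snd z)))"

lemma random_walk_transition_eq:
  "random_walk_transition (environment act \<theta> x) g = walk_kernel \<theta> (g, x)"
  by (simp add: random_walk_transition_def environment_def walk_kernel_def)

lemma measurable_walk_kernel:
  assumes \<theta>[measurable]: "\<theta> \<in> \<kappa> \<rightarrow>\<^sub>M prob_algebra borel"
  shows "walk_kernel \<theta> \<in> completion (\<mu> \<Otimes>\<^sub>M \<kappa>) \<rightarrow>\<^sub>M prob_algebra borel"
proof -
  have "(\<lambda>w. fst (fst w) + snd w) \<in> (borel \<Otimes>\<^sub>M \<kappa>) \<Otimes>\<^sub>M borel \<rightarrow>\<^sub>M (borel :: 'g measure)"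
    using measurable_compose[OF _ measurable_group_plus[OF lc haar], of "\<lambda>w. (fst (fst w), snd w)" "(borel \<Otimes>\<^sub>M \<kappa>) \<Otimes>\<^sub>M borel"]
    by (simp add: case_prod_beta)
  then have 1: "(\<lambda>w. distr (\<theta> (snd w)) borel (\<lambda>h. fst w + h)) \<in> borel \<Otimes>\<^sub>M \<kappa> \<rightarrow>\<^sub>M prob_algebra borel"
    by (intro measurable_distr_prob_space2[where M = borel]) (auto simp: case_prod_beta)
  have 2: "(\<lambda>z. (fst z, act (- fst z) (snd z))) \<in> completion (\<mu> \<Otimes>\<^sub>M \<kappa>) \<rightarrow>\<^sub>M borel \<Otimes>\<^sub>M \<kappa>"
  proof (rule measurable_Pair)
    have "fst \<in> \<mu> \<Otimes>\<^sub>M \<kappa> \<rightarrow>\<^sub>M \<mu>" by (rule measurable_fst)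
    then show "fst \<in> completion (\<mu> \<Otimes>\<^sub>M \<kappa>) \<rightarrow>\<^sub>M borel"
      by (intro measurable_completion) (simp add: measurable_cong_sets[OF refl sets_\<mu>])
    show "(\<lambda>z. act (- fst z) (snd z)) \<in> completion (\<mu> \<Otimes>\<^sub>M \<kappa>) \<rightarrow>\<^sub>M \<kappa>"
      by (rule measurable_inverse_action[unfolded case_prod_beta'])
  qed
  show ?thesis
    using measurable_compose[OF 2 1] by (simp add: walk_kernel_def[abs_def] translate_measure_def)
qed

lemma walk_kernel_ac:
  assumes \<theta>: "measurable_ac_prob_map \<mu> \<kappa> \<theta>" and z: "z \<in> space (\<mu> \<Otimes>\<^sub>M \<kappa>)"
  shows "walk_kernel \<theta> z \<in> ac_prob_measures \<mu>"
proof -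
  have "\<theta> (act (- fst z) (snd z)) \<in> ac_prob_measures \<mu>"
    using \<theta> space_inverse_action[OF z] by (simp add: measurable_ac_prob_map_def)
  note a = ac_prob_measuresD[OF this]
  have "(\<lambda>h. fst z + h) \<in> \<theta> (act (- fst z) (snd z)) \<rightarrow>\<^sub>M borel"
    using measurable_left_translation[OF lc haar] by (simp add: measurable_cong_sets[OF a(2) refl])
  from prob_space.prob_space_distr[OF a(1) this] show ?thesis
    using absolutely_continuous_translate[OF lc haar a(2,3)]
    by (simp add: ac_prob_measures_def walk_kernel_def translate_measure_def)
qed

lemma ex_ac_prob: "\<exists>c. c \<in> ac_prob_measures \<mu>"
proof -
  obtain w where w: "w \<in> borel_measurable \<mu>" "prob_space (density \<mu> w)"
    by (rule G.equivalent_prob_density[OF \<mu>_nonzero]) (rule that)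
  then show ?thesis
    using absolutely_continuousI_density[OF w(1)] sets_\<mu>
    by (intro exI[of _ "density \<mu> w"]) (simp add: ac_prob_measures_def)
qed

text \<open>Absolute continuity is demanded at every point, so that each section is a kernel all of
  whose steps ignore null sets, as \<open>markov_version\<close> asks.\<close>

definition kernel_version :: "('x \<Rightarrow> 'g measure) \<Rightarrow> ('g \<times> 'x \<Rightarrow> 'g measure) \<Rightarrow> bool" where
  "kernel_version \<theta> p \<longleftrightarrow> p \<in> borel \<Otimes>\<^sub>M \<kappa> \<rightarrow>\<^sub>M prob_algebra borel \<and>
    (AE z in \<mu> \<Otimes>\<^sub>M \<kappa>. p z = walk_kernel \<theta> z) \<and>
    (\<forall>z\<in>space (\<mu> \<Otimes>\<^sub>M \<kappa>). p z \<in> ac_prob_measures \<mu>)"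

lemma ex_kernel_version:
  assumes \<theta>: "measurable_ac_prob_map \<mu> \<kappa> \<theta>"
  shows "\<exists>p. kernel_version \<theta> p"
proof -
  obtain c where c: "c \<in> ac_prob_measures \<mu>" using ex_ac_prob by blast
  have "\<theta> \<in> \<kappa> \<rightarrow>\<^sub>M prob_algebra borel" using \<theta> by (simp add: measurable_ac_prob_map_iff)
  from completion_prob_kernel_version[OF measurable_walk_kernel[OF this] ac_prob_measuresD(4)[OF c]]
  obtain p where p: "p \<in> \<mu> \<Otimes>\<^sub>M \<kappa> \<rightarrow>\<^sub>M prob_algebra borel" "AE z in \<mu> \<Otimes>\<^sub>M \<kappa>. p z = walk_kernel \<theta> z"
    "\<forall>z\<in>space (\<mu> \<Otimes>\<^sub>M \<kappa>). p z = walk_kernel \<theta> z \<or> p z = c"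
    by (elim exE conjE) (rule that)
  have "p z \<in> ac_prob_measures \<mu>" if "z \<in> space (\<mu> \<Otimes>\<^sub>M \<kappa>)" for z
    using bspec[OF p(3) that] walk_kernel_ac[OF \<theta> that] c by auto
  then show ?thesis
    using p(1,2) unfolding kernel_version_def measurable_cong_sets[OF sets_pair refl] by blast
qed

lemma kernel_version_section:
  assumes p: "kernel_version \<theta> p" and x: "x \<in> space \<kappa>"
  shows "(\<lambda>g. p (g, x)) \<in> borel \<rightarrow>\<^sub>M prob_algebra borel" "p (g, x) \<in> ac_prob_measures \<mu>"
    "absolutely_continuous \<mu> (p (g, x))"
proof -
  show "(\<lambda>g. p (g, x)) \<in> borel \<rightarrow>\<^sub>M prob_algebra borel"
    using p x by (auto simp: kernel_version_def intro: measurable_compose[OF measurable_Pair2'])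
  show "p (g, x) \<in> ac_prob_measures \<mu>"
    using p x by (auto simp: kernel_version_def space_pair)
  then show "absolutely_continuous \<mu> (p (g, x))" by (rule ac_prob_measuresD)
qed

definition version_good :: "('x \<Rightarrow> 'g measure) \<Rightarrow> ('g \<times> 'x \<Rightarrow> 'g measure) \<Rightarrow> 'x \<Rightarrow> bool" where
  "version_good \<theta> p x \<longleftrightarrow> x \<in> space \<kappa> \<and> (AE g in \<mu>. p (g, x) = walk_kernel \<theta> (g, x))"

lemma AE_version_good:
  assumes "kernel_version \<theta> p" shows "AE x in \<kappa>. version_good \<theta> p x"
proof -
  have "AE x in \<kappa>. AE g in \<mu>. p (g, x) = walk_kernel \<theta> (g, x)"
    using assms by (intro AE_pair_sections) (simp add: kernel_version_def)
  then show ?thesis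
    using AE_space by eventually_elim (simp add: version_good_def)
qed

lemma markov_version_section:
  assumes \<theta>: "measurable_ac_prob_map \<mu> \<kappa> \<theta>" and p: "kernel_version \<theta> p" and x: "version_good \<theta> p x"
    and K: "is_markov_law (\<lambda>g. p (g, x)) K"
  shows "markov_version \<mu> (\<lambda>g. p (g, x)) (random_walk_transition (environment act \<theta> x)) K"
proof
  have xs: "x \<in> space \<kappa>" and AE: "AE g in \<mu>. p (g, x) = walk_kernel \<theta> (g, x)"
    using x by (simp_all add: version_good_def)
  have w: "walk_kernel \<theta> (g, x) \<in> ac_prob_measures \<mu>" for g
    by (rule walk_kernel_ac[OF \<theta>]) (simp add: space_pair xs)
  note sec = kernel_version_section[OF p xs]
  show "(\<lambda>g. p (g, x)) \<in> borel \<rightarrow>\<^sub>M prob_algebra borel" "absolutely_continuous \<mu> (p (g, x))" for g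
    by (rule sec)+
  show "absolutely_continuous \<mu> (random_walk_transition (environment act \<theta> x) g)" for g
    unfolding random_walk_transition_eq by (rule ac_prob_measuresD[OF w])
  show "AE g in \<mu>. random_walk_transition (environment act \<theta> x) g = p (g, x)"
    using AE by eventually_elim (simp add: random_walk_transition_eq)
  show "markov_kernel \<mu> (random_walk_transition (environment act \<theta> x))"
    unfolding markov_kernel_def random_walk_transition_eq
  proof (intro conjI allI ballI)
    show "prob_space (walk_kernel \<theta> (g, x))" "sets (walk_kernel \<theta> (g, x)) = sets borel" for g
      by (rule ac_prob_measuresD[OF w])+
    fix A :: "'g set" assume A: "A \<in> sets borel"
    show "(\<lambda>g. emeasure (walk_kernel \<theta> (g, x)) A) \<in> borel_measurable (completion \<mu>)"
    proof (rule completion_measurable_AE)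
      show "(\<lambda>g. emeasure (p (g, x)) A) \<in> borel_measurable \<mu>"
        using measurable_emeasure_kernel[OF measurable_prob_algebraD[OF sec(1)] A]
        by (simp add: measurable_cong_sets[OF sets_\<mu> refl])
      show "AE g in \<mu>. emeasure (walk_kernel \<theta> (g, x)) A = emeasure (p (g, x)) A"
        using AE by eventually_elim simp
    qed simp
  qed
qed (rule sigma_finite_\<mu> sets_\<mu> K)+

section \<open>Amenability as almost everywhere convergence\<close>

text \<open>Since \<open>\<theta> x\<close> is the step from the identity in the environment of
  \<open>x\<close>, this is the distance between the first steps from \<open>g\<close> and from the
  identity in one environment.\<close>

definition TV :: "('x \<Rightarrow> 'g measure) \<Rightarrow> 'g \<times> 'x \<Rightarrow> real" where
  "TV \<theta> z = total_variation_diff (walk_kernel \<theta> z) (\<theta> (snd z))"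

lemma TV_measurable:
  assumes \<theta>: "measurable_ac_prob_map \<mu> \<kappa> \<theta>"
  shows "TV \<theta> \<in> borel_measurable (completion (\<mu> \<Otimes>\<^sub>M \<kappa>))"
proof -
  have m: "\<theta> \<in> \<kappa> \<rightarrow>\<^sub>M prob_algebra borel" using \<theta> by (simp add: measurable_ac_prob_map_iff)
  have "(\<lambda>z. \<theta> (snd z)) \<in> completion (\<mu> \<Otimes>\<^sub>M \<kappa>) \<rightarrow>\<^sub>M prob_algebra borel"
    by (intro measurable_completion measurable_compose[OF measurable_snd m])
  then show ?thesis
    unfolding TV_def[abs_def]
    by (intro borel_measurable_total_variation_diff measurable_walk_kernel[OF m])
qed

lemma TV_bounds:
  assumes \<theta>: "measurable_ac_prob_map \<mu> \<kappa> \<theta>" and z: "z \<in> space (\<mu> \<Otimes>\<^sub>M \<kappa>)"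
  shows "0 \<le> TV \<theta> z" "TV \<theta> z \<le> 2"
proof -
  have "\<theta> (snd z) \<in> ac_prob_measures \<mu>"
    using \<theta> z by (auto simp: measurable_ac_prob_map_def space_pair)
  note a = ac_prob_measuresD[OF this] ac_prob_measuresD[OF walk_kernel_ac[OF \<theta> z]]
  show "0 \<le> TV \<theta> z" "TV \<theta> z \<le> 2"
    unfolding TV_def using total_variation_diff_nonneg[OF a(5,1)] total_variation_diff_le_2[OF a(5,1)] a(2,6)
    by simp_all
qed

lemma amenable_function_eq:
  "(\<lambda>(g, x). total_variation_diff (translate_measure g (\<theta> (act (- g) x))) (\<theta> x)) = TV \<theta>"
  by (simp add: fun_eq_iff TV_def walk_kernel_def)

lemma amenableI:
  assumes \<theta>: "\<And>n. measurable_ac_prob_map \<mu> \<kappa> (\<theta> n)"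
    and lim: "AE z in \<mu> \<Otimes>\<^sub>M \<kappa>. (\<lambda>n. TV (\<theta> n) z) \<longlonglongrightarrow> 0"
  shows "amenable_action \<mu> \<kappa> act"
  unfolding amenable_action_def amenable_function_eq weak_star_tendsto_def
proof (intro exI[of _ \<theta>] conjI allI impI)
  let ?M = "completion (\<mu> \<Otimes>\<^sub>M \<kappa>)"
  have AE2: "AE z in ?M. \<bar>TV (\<theta> n) z\<bar> \<le> 2" for n
    using TV_bounds[OF \<theta>] by (intro AE_I2) auto
  show "measurable_ac_prob_map \<mu> \<kappa> (\<theta> n)" for n by (rule \<theta>)
  show "essentially_bounded ?M (TV (\<theta> n))" for n
    unfolding essentially_bounded_def using TV_measurable[OF \<theta>] AE2 by blast
  show "essentially_bounded ?M (\<lambda>_. 0)"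
    unfolding essentially_bounded_def by auto
  fix \<phi> :: "'g \<times> 'x \<Rightarrow> real" assume \<phi>: "integrable ?M \<phi>"
  show "(\<lambda>n. \<integral>z. TV (\<theta> n) z * \<phi> z \<partial>?M) \<longlonglongrightarrow> (\<integral>z. 0 * \<phi> z \<partial>?M)"
  proof (rule integral_dominated_convergence[where w = "\<lambda>z. 2 * \<bar>\<phi> z\<bar>"])
    show "AE z in ?M. (\<lambda>n. TV (\<theta> n) z * \<phi> z) \<longlonglongrightarrow> 0 * \<phi> z"
      using AE_completion[OF lim] by eventually_elim (intro tendsto_intros)
    show "AE z in ?M. norm (TV (\<theta> n) z * \<phi> z) \<le> 2 * \<bar>\<phi> z\<bar>" for n
      using AE2[of n] by eventually_elim (simp add: abs_mult mult_right_mono)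
    show "(\<lambda>z. TV (\<theta> n) z * \<phi> z) \<in> borel_measurable ?M" for n
      using TV_measurable[OF \<theta>] \<phi> by (intro borel_measurable_times) auto
  qed (use \<phi> in auto)
qed

text \<open>The functions are nonnegative, so testing against one strictly positive integrable
  \<phi> amounts to convergence in L1 with weight \<phi>, and a subsequence converges almost
  everywhere.\<close>

lemma amenableE:
  assumes "amenable_action \<mu> \<kappa> act"
  obtains \<theta> where "\<And>n. measurable_ac_prob_map \<mu> \<kappa> (\<theta> n)"
    "AE z in \<mu> \<Otimes>\<^sub>M \<kappa>. (\<lambda>n::nat. TV (\<theta> n) z) \<longlonglongrightarrow> 0"
proof -
  let ?M = "completion (\<mu> \<Otimes>\<^sub>M \<kappa>)"
  obtain \<theta> where \<theta>: "\<And>n. measurable_ac_prob_map \<mu> \<kappa> (\<theta> n)"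
    and ws: "weak_star_tendsto ?M (\<lambda>n. TV (\<theta> n)) (\<lambda>_. 0)"
    using assms unfolding amenable_action_def amenable_function_eq by blast
  have lim: "(\<lambda>n. \<integral>z. TV (\<theta> n) z * \<phi> z \<partial>?M) \<longlonglongrightarrow> 0" if "integrable ?M \<phi>" for \<phi>
    using ws that unfolding weak_star_tendsto_def by simp
  obtain h where h: "h \<in> borel_measurable (\<mu> \<Otimes>\<^sub>M \<kappa>)" "integral\<^sup>N (\<mu> \<Otimes>\<^sub>M \<kappa>) h \<noteq> \<infinity>"
    "\<And>z. z \<in> space (\<mu> \<Otimes>\<^sub>M \<kappa>) \<Longrightarrow> 0 < h z \<and> h z < \<infinity>"
    using P.Ex_finite_integrable_function by blast
  define \<phi> where "\<phi> z = enn2real (h z)" for z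
  have \<phi>m: "\<phi> \<in> borel_measurable (\<mu> \<Otimes>\<^sub>M \<kappa>)"
    unfolding \<phi>_def[abs_def] using h(1) by measurable
  have \<phi>pos: "0 < \<phi> z" if "z \<in> space (\<mu> \<Otimes>\<^sub>M \<kappa>)" for z
    using h(3)[OF that] by (simp add: \<phi>_def enn2real_positive_iff)
  have "(\<integral>\<^sup>+z. ennreal (\<phi> z) \<partial>(\<mu> \<Otimes>\<^sub>M \<kappa>)) = integral\<^sup>N (\<mu> \<Otimes>\<^sub>M \<kappa>) h"
  proof (intro nn_integral_cong)
    fix z assume "z \<in> space (\<mu> \<Otimes>\<^sub>M \<kappa>)"
    from h(3)[OF this] show "ennreal (\<phi> z) = h z" by (simp add: \<phi>_def)
  qed
  then have "integrable (\<mu> \<Otimes>\<^sub>M \<kappa>) \<phi>"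
    using h(2) \<phi>m by (intro integrableI_nonneg) (auto simp: \<phi>_def less_top[symmetric])
  then have \<phi>: "integrable ?M \<phi>"
    using integrable_completion[OF \<phi>m] by simp
  have int: "integrable ?M (\<lambda>z. TV (\<theta> n) z * \<phi> z)" for n
  proof (rule Bochner_Integration.integrable_bound[OF integrable_mult_right[OF \<phi>, of 2]])
    show "(\<lambda>z. TV (\<theta> n) z * \<phi> z) \<in> borel_measurable ?M"
      using TV_measurable[OF \<theta>] \<phi> by (intro borel_measurable_times) auto
    show "AE z in ?M. norm (TV (\<theta> n) z * \<phi> z) \<le> norm (2 * \<phi> z)"
      using TV_bounds[OF \<theta>] by (intro AE_I2) (auto simp: abs_mult intro!: mult_right_mono)
  qed
  have "(\<integral>z. norm (TV (\<theta> n) z * \<phi> z) \<partial>?M) = (\<integral>z. TV (\<theta> n) z * \<phi> z \<partial>?M)" for n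
    using TV_bounds(1)[OF \<theta>] \<phi>pos
    by (intro Bochner_Integration.integral_cong refl) (auto simp: abs_mult less_imp_le)
  then have "(\<lambda>n. \<integral>z. norm (TV (\<theta> n) z * \<phi> z) \<partial>?M) \<longlonglongrightarrow> 0"
    using lim[OF \<phi>] by simp
  from tendsto_L1_AE_subseq[OF int this] obtain r where
    r: "AE z in ?M. (\<lambda>n. TV (\<theta> (r n)) z * \<phi> z) \<longlonglongrightarrow> 0" by blast
  have "AE z in \<mu> \<Otimes>\<^sub>M \<kappa>. (\<lambda>n. TV (\<theta> (r n)) z) \<longlonglongrightarrow> 0"
    using r[unfolded AE_completion_iff] AE_space
  proof eventually_elim
    case (elim z)
    from tendsto_divide[OF elim(1) tendsto_const[of "\<phi> z"]] \<phi>pos[OF elim(2)] show ?case by simp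
  qed
  with \<theta> show thesis by (rule that[of "\<lambda>n. \<theta> (r n)"])
qed

section \<open>Liouville property implies amenability\<close>

lemma markov_iter_ac:
  assumes p: "p \<in> borel \<rightarrow>\<^sub>M prob_algebra borel" and ac: "\<And>g. absolutely_continuous \<mu> (p g)"
    and \<nu>: "\<nu> \<in> ac_prob_measures \<mu>"
  shows "markov_iter p k \<nu> \<in> ac_prob_measures \<mu>"
proof (induction k)
  case (Suc k)
  show ?case
    unfolding markov_iter_Suc
    by (rule AE_bind_absolutely_continuous[OF p ac_prob_measuresD(4)[OF Suc] sets_\<mu>]) (simp add: ac)
qed (use \<nu> in simp)

lemma AE_left_translate:
  assumes "AE h in \<mu>. Q h" shows "AE h in \<mu>. Q (g + h)"
proof -
  have m: "(\<lambda>h. g + h) \<in> \<mu> \<rightarrow>\<^sub>M borel"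
    using measurable_left_translation[OF lc haar] by (simp add: measurable_cong_sets[OF sets_\<mu> refl])
  obtain N where N: "N \<in> null_sets \<mu>" "{h\<in>space \<mu>. \<not> Q h} \<subseteq> N"
    using assms unfolding eventually_ae_filter by blast
  then have Nb: "N \<in> sets borel" using sets_\<mu> by auto
  have "(\<lambda>h. g + h) -` N \<in> sets \<mu>"
    using measurable_sets[OF m Nb] by (simp add: space_\<mu>)
  moreover have "emeasure \<mu> ((\<lambda>h. g + h) -` N) = 0"
    using haar_left_invariant[OF lc haar Nb, of g] N(1) by auto
  ultimately have "(\<lambda>h. g + h) -` N \<in> null_sets \<mu>" by (simp add: null_sets_def)
  from AE_not_in[OF this] show ?thesis
    by eventually_elim (use N(2) in \<open>auto simp: space_\<mu>\<close>)
qed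

text \<open>Equivariance of the walk under a change of environment. For the Borel versions the
  one-step identity holds for almost every \<open>h\<close> only, which suffices because all
  iterates are absolutely continuous.\<close>

lemma translate_markov_iter:
  assumes \<theta>: "measurable_ac_prob_map \<mu> \<kappa> \<theta>" and p: "kernel_version \<theta> p"
    and x: "version_good \<theta> p x" and y: "version_good \<theta> p (act (- g) x)"
  shows "translate_measure g (markov_iter (\<lambda>h. p (h, act (- g) x)) k (\<theta> (act (- g) x))) =
    markov_iter (\<lambda>h. p (h, x)) k (walk_kernel \<theta> (g, x))"
proof (induction k)
  case 0
  show ?case by (simp add: walk_kernel_def)
next
  case (Suc k)
  let ?y = "act (- g) x"
  have xs: "x \<in> space \<kappa>" and ys: "?y \<in> space \<kappa>" using x y by (auto simp: version_good_def)
  note px = kernel_version_section[OF p xs] and py = kernel_version_section[OF p ys]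
  let ?q = "markov_iter (\<lambda>h. p (h, ?y)) k (\<theta> ?y)"
  have q: "?q \<in> ac_prob_measures \<mu>"
    using \<theta> ys by (intro markov_iter_ac[OF py(1,3)]) (simp add: measurable_ac_prob_map_def)
  note q = ac_prob_measuresD[OF q]
  have tr: "(\<lambda>h. g + h) \<in> borel \<rightarrow>\<^sub>M (borel :: 'g measure)"
    by (rule measurable_left_translation[OF lc haar])
  have q_ne: "space ?q \<noteq> {}" using prob_space.not_empty[OF q(1)] .
  have py': "(\<lambda>h. p (h, ?y)) \<in> ?q \<rightarrow>\<^sub>M subprob_algebra borel"
    using measurable_prob_algebraD[OF py(1)] by (simp add: measurable_cong_sets[OF q(2) refl])
  have px': "(\<lambda>h. p (g + h, x)) \<in> ?q \<rightarrow>\<^sub>M subprob_algebra borel"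
    using measurable_compose[OF tr measurable_prob_algebraD[OF px(1)]]
    by (simp add: measurable_cong_sets[OF q(2) refl])
  have "translate_measure g (markov_iter (\<lambda>h. p (h, ?y)) (Suc k) (\<theta> ?y)) =
      distr (?q \<bind> (\<lambda>h. p (h, ?y))) borel (\<lambda>h. g + h)"
    by (simp add: translate_measure_def)
  also have "\<dots> = ?q \<bind> (\<lambda>h. distr (p (h, ?y)) borel (\<lambda>h. g + h))"
    by (rule distr_bind[OF py' q_ne tr])
  also have "\<dots> = ?q \<bind> (\<lambda>h. p (g + h, x))"
  proof (rule bind_cong_AE[OF refl])
    show "(\<lambda>h. distr (p (h, ?y)) borel (\<lambda>h. g + h)) \<in> ?q \<rightarrow>\<^sub>M subprob_algebra borel"
      by (rule measurable_compose[OF py' measurable_distr[OF tr]])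
    have "AE h in \<mu>. p (h, ?y) = walk_kernel \<theta> (h, ?y)" using y by (simp add: version_good_def)
    moreover have "AE h in \<mu>. p (g + h, x) = walk_kernel \<theta> (g + h, x)"
      using x by (intro AE_left_translate) (simp add: version_good_def)
    ultimately have "AE h in \<mu>. distr (p (h, ?y)) borel (\<lambda>h. g + h) = p (g + h, x)"
    proof eventually_elim
      case (elim h)
      \<comment> \<open>The inverse of \<open>g + h\<close> is \<open>- h + - g\<close>, so
        \<open>- g\<close> acts first.\<close>
      have "act (- h) ?y = act (- (g + h)) x"
        using act_add[OF xs, of "- h" "- g"] by (simp add: minus_add)
      moreover have "distr (distr N borel (\<lambda>k. h + k)) borel (\<lambda>k. g + k) = distr N borel (\<lambda>k. g + h + k)"
        if "sets N = sets borel" for N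
        using that measurable_left_translation[OF lc haar]
        by (subst distr_distr) (auto simp: o_def add.assoc[symmetric] measurable_cong_sets[OF that refl])
      moreover have "sets (\<theta> (act (- h) ?y)) = sets borel"
        using \<theta> act_space[OF ys, of "- h"] ac_prob_measuresD(2) by (auto simp: measurable_ac_prob_map_def)
      ultimately show ?case
        using elim by (simp add: walk_kernel_def translate_measure_def)
    qed
    then show "AE h in ?q. distr (p (h, ?y)) borel (\<lambda>h. g + h) = p (g + h, x)"
      using q(2) sets_\<mu> by (intro absolutely_continuous_AE[OF _ q(3)]) simp_all
  qed (rule px')
  also have "\<dots> = distr ?q borel (\<lambda>h. g + h) \<bind> (\<lambda>h. p (h, x))"
    using tr by (subst bind_distr[OF _ measurable_prob_algebraD[OF px(1)] q_ne])
      (simp_all add: measurable_cong_sets[OF q(2) refl])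
  also have "distr ?q borel (\<lambda>h. g + h) = markov_iter (\<lambda>h. p (h, x)) k (walk_kernel \<theta> (g, x))"
    using Suc by (simp add: translate_measure_def)
  finally show ?case by simp
qed

text \<open>Convex combinations of laws: uniform weights give the averages for (iii) to (i),
  geometric weights the mixture for (i) to (ii).\<close>

definition pmf_mix :: "nat pmf \<Rightarrow> (nat \<Rightarrow> 'g measure) \<Rightarrow> 'g measure" where
  "pmf_mix \<tau> q = measure_pmf \<tau> \<bind> q"

lemma measure_pmf_in_prob_algebra: "measure_pmf \<tau> \<in> space (prob_algebra (count_space UNIV))"
  by (simp add: space_prob_algebra measure_pmf.prob_space_axioms)

lemma pmf_mix_ac:
  assumes "\<And>k. q k \<in> ac_prob_measures \<mu>"
  shows "pmf_mix \<tau> q \<in> ac_prob_measures \<mu>"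
  unfolding pmf_mix_def
proof (rule AE_bind_absolutely_continuous[OF _ measure_pmf_in_prob_algebra])
  show "q \<in> count_space UNIV \<rightarrow>\<^sub>M prob_algebra borel"
    using ac_prob_measuresD(4)[OF assms] by simp
qed (use sets_\<mu> ac_prob_measuresD(3)[OF assms] in auto)

lemma measurable_pmf_mix:
  assumes q: "\<And>k. (\<lambda>x. q k x) \<in> L \<rightarrow>\<^sub>M prob_algebra borel"
  shows "(\<lambda>x. pmf_mix \<tau> (\<lambda>k. q k x)) \<in> L \<rightarrow>\<^sub>M prob_algebra borel"
proof -
  have "(\<lambda>w. q (fst w) (snd w)) \<in> count_space UNIV \<Otimes>\<^sub>M L \<rightarrow>\<^sub>M prob_algebra borel"
    by (rule measurable_pair_measure_countable1) (use q in simp_all)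
  from measurable_compose[OF measurable_pair_swap' this]
  have "(\<lambda>(x, k). q k x) \<in> L \<Otimes>\<^sub>M count_space UNIV \<rightarrow>\<^sub>M prob_algebra borel"
    by (simp add: case_prod_beta')
  moreover have "(\<lambda>_. measure_pmf \<tau>) \<in> L \<rightarrow>\<^sub>M prob_algebra (count_space UNIV)"
    by (rule measurable_const[OF measure_pmf_in_prob_algebra])
  ultimately show ?thesis
    unfolding pmf_mix_def by (intro measurable_bind_prob_space2[where N = "count_space UNIV"])
qed

lemma measure_average:
  assumes q: "\<And>k. q k \<in> ac_prob_measures \<mu>" and A: "A \<in> sets borel"
  shows "measure (pmf_mix (pmf_of_set {..n}) q) A = (\<Sum>k<Suc n. measure (q k) A) / real (Suc n)"
proof -
  have qm: "q \<in> count_space UNIV \<rightarrow>\<^sub>M prob_algebra borel"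
    using ac_prob_measuresD(4)[OF q] by simp
  have em: "emeasure (q k) A = ennreal (measure (q k) A)" for k
    using prob_space.finite_measure[OF ac_prob_measuresD(1)[OF q]] by (simp add: finite_measure.emeasure_eq_measure)
  have "emeasure (pmf_mix (pmf_of_set {..n}) q) A = (\<integral>\<^sup>+k. emeasure (q k) A \<partial>measure_pmf (pmf_of_set {..n}))"
    unfolding pmf_mix_def
    by (rule emeasure_bind_prob_algebra[OF measure_pmf_in_prob_algebra qm A])
  also have "\<dots> = (\<Sum>k\<le>n. emeasure (q k) A) / real (Suc n)"
    by (subst nn_integral_pmf_of_set) (auto simp: ennreal_of_nat_eq_real_of_nat)
  also have "\<dots> = ennreal ((\<Sum>k\<le>n. measure (q k) A) / real (Suc n))"
    unfolding em by (simp add: sum_nonneg divide_ennreal del: of_nat_Suc)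
  finally show ?thesis
    unfolding measure_def[of "pmf_mix (pmf_of_set {..n}) q"] by (simp add: sum_nonneg lessThan_Suc_atMost)
qed

lemma liouville_imp_amenable:
  assumes \<theta>: "measurable_ac_prob_map \<mu> \<kappa> \<theta>"
    and L: "AE x in \<kappa>. liouville_chain \<mu> (random_walk_transition (environment act \<theta> x))"
  shows "amenable_action \<mu> \<kappa> act"
proof -
  obtain p where pv: "kernel_version \<theta> p" using ex_kernel_version[OF \<theta>] by blast
  have \<theta>m: "\<theta> \<in> \<kappa> \<rightarrow>\<^sub>M prob_algebra borel" and \<theta>ac: "\<And>x. x \<in> space \<kappa> \<Longrightarrow> \<theta> x \<in> ac_prob_measures \<mu>"
    using \<theta> by (simp_all add: measurable_ac_prob_map_iff)
  \<comment> \<open>This is the law at time \<open>k + 1\<close> of the walk from the identity: the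
    first step \<open>\<theta> x\<close> serves as initial law, because merging is available for
    absolutely continuous laws and a point mass need not be one.\<close>
  define q where "q x k = markov_iter (\<lambda>g. p (g, x)) k (\<theta> x)" for x k
  have q_ac: "q x k \<in> ac_prob_measures \<mu>" if "x \<in> space \<kappa>" for x k
    unfolding q_def by (rule markov_iter_ac[OF kernel_version_section(1,3)[OF pv that] \<theta>ac[OF that]])
  have pm: "(\<lambda>(x, g). p (g, x)) \<in> \<kappa> \<Otimes>\<^sub>M borel \<rightarrow>\<^sub>M prob_algebra borel"
    using pv measurable_compose[OF measurable_pair_swap', of p borel \<kappa> "prob_algebra borel"]
    by (simp add: kernel_version_def case_prod_beta)
  have q_meas: "(\<lambda>x. q x k) \<in> \<kappa> \<rightarrow>\<^sub>M prob_algebra borel" for k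
  proof (induction k)
    case (Suc k)
    show ?case
      using measurable_bind_prob_space2[OF Suc pm] by (simp add: q_def)
  qed (simp add: q_def \<theta>m)
  define \<theta>' where "\<theta>' n x = pmf_mix (pmf_of_set {..n}) (q x)" for n x
  have \<theta>'_map: "measurable_ac_prob_map \<mu> \<kappa> (\<theta>' n)" for n
    unfolding measurable_ac_prob_map_iff
    unfolding \<theta>'_def[abs_def] by (intro conjI ballI measurable_pmf_mix pmf_mix_ac q_ac q_meas)
  have "AE z in \<mu> \<Otimes>\<^sub>M \<kappa>. (\<lambda>n. TV (\<theta>' n) z) \<longlonglongrightarrow> 0"
    \<comment> \<open>A good version is needed at \<open>x\<close> and also at
      \<open>act (- g) x\<close>; the latter is where quasi-invariance enters.\<close>
    using AE_snd[OF L] AE_snd[OF AE_version_good[OF pv]] AE_inverse_action[OF AE_version_good[OF pv]] AE_space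
  proof eventually_elim
    case (elim z)
    obtain g x where z: "z = (g, x)" by (cases z)
    let ?y = "act (- g) x"
    have Lx: "liouville_chain \<mu> (random_walk_transition (environment act \<theta> x))"
      and x: "version_good \<theta> p x" and y: "version_good \<theta> p ?y"
      using elim by (simp_all add: z)
    have xs: "x \<in> space \<kappa>" and ys: "?y \<in> space \<kappa>" using x y by (auto simp: version_good_def)
    obtain K where K: "is_markov_law (\<lambda>g. p (g, x)) K"
      using ex_markov_law[OF kernel_version_section(1)[OF pv xs]] by blast
    interpret V: markov_version \<mu> "\<lambda>g. p (g, x)" "random_walk_transition (environment act \<theta> x)" K
      by (rule markov_version_section[OF \<theta> pv x K])
    let ?w = "walk_kernel \<theta> (g, x)"
    have w: "?w \<in> ac_prob_measures \<mu>"
      by (rule walk_kernel_ac[OF \<theta>]) (simp add: space_pair xs)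
    \<comment> \<open>By equivariance the translated average belongs to the same chain, in the
      environment of \<open>x\<close>, now with initial law \<open>?w\<close>.\<close>
    have left: "measure (translate_measure g (\<theta>' n ?y)) A =
        (\<Sum>k<Suc n. measure (markov_iter (\<lambda>g. p (g, x)) k ?w) A) / real (Suc n)"
      if A: "A \<in> sets borel" for n A
    proof -
      have tr: "measure (translate_measure g N) A = measure N ((\<lambda>h. g + h) -` A)"
        if "N \<in> ac_prob_measures \<mu>" for N
      proof -
        note N = ac_prob_measuresD[OF that]
        have "(\<lambda>h. g + h) \<in> N \<rightarrow>\<^sub>M borel"
          using measurable_left_translation[OF lc haar] by (simp add: measurable_cong_sets[OF N(2) refl])
        from measure_distr[OF this A] show ?thesis
          using sets_eq_imp_space_eq[OF N(2)] by (simp add: translate_measure_def)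
      qed
      have A': "(\<lambda>h. g + h) -` A \<in> sets borel"
        using measurable_sets[OF measurable_left_translation[OF lc haar] A, of g] by simp
      have qk: "measure (q ?y k) ((\<lambda>h. g + h) -` A) = measure (markov_iter (\<lambda>g. p (g, x)) k ?w) A" for k
        using translate_markov_iter[OF \<theta> pv x y, of k] tr[OF q_ac[OF ys], of k] by (simp add: q_def)
      have "\<theta>' n ?y \<in> ac_prob_measures \<mu>"
        using \<theta>'_map[of n] ys by (simp add: measurable_ac_prob_map_iff)
      from tr[OF this] have "measure (translate_measure g (\<theta>' n ?y)) A = measure (\<theta>' n ?y) ((\<lambda>h. g + h) -` A)" .
      also have "\<dots> = (\<Sum>k<Suc n. measure (q ?y k) ((\<lambda>h. g + h) -` A)) / real (Suc n)"
        unfolding \<theta>'_def by (rule measure_average[OF q_ac[OF ys] A'])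
      also have "\<dots> = (\<Sum>k<Suc n. measure (markov_iter (\<lambda>g. p (g, x)) k ?w) A) / real (Suc n)"
        unfolding qk ..
      finally show ?thesis .
    qed
    have right: "measure (\<theta>' n x) A = (\<Sum>k<Suc n. measure (markov_iter (\<lambda>g. p (g, x)) k (\<theta> x)) A) / real (Suc n)"
      if A: "A \<in> sets borel" for n A
      unfolding \<theta>'_def measure_average[OF q_ac[OF xs] A] q_def ..
    show "(\<lambda>n. TV (\<theta>' n) z) \<longlonglongrightarrow> 0"
    proof (rule LIMSEQ_I)
      fix r :: real assume "0 < r"
      \<comment> \<open>The norm is at most twice the bound on sets, and
        \<open>2 * (r / 3) < r\<close>.\<close>
      then have "0 < r / 3" by simp
      from V.liouville_averages_merge[OF Lx w \<theta>ac[OF xs] this]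
      obtain N where N: "\<And>n B. n \<ge> N \<Longrightarrow> B \<in> sets borel \<Longrightarrow>
        \<bar>(\<Sum>k<n. measure (markov_iter (\<lambda>g. p (g, x)) k ?w) B) -
         (\<Sum>k<n. measure (markov_iter (\<lambda>g. p (g, x)) k (\<theta> x)) B)\<bar> \<le> r / 3 * real n"
        by blast
      have "norm (TV (\<theta>' n) z - 0) < r" if "n \<ge> N" for n
      proof -
        have zs: "z \<in> space (\<mu> \<Otimes>\<^sub>M \<kappa>)" by (rule elim)
        note a = ac_prob_measuresD[OF walk_kernel_ac[OF \<theta>'_map[of n] zs]]
        have "\<theta>' n x \<in> ac_prob_measures \<mu>"
          using \<theta>'_map[of n] xs by (simp add: measurable_ac_prob_map_iff)
        note b = ac_prob_measuresD[OF this]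
        have "TV (\<theta>' n) z \<le> 2 * (r / 3)"
          unfolding TV_def
        proof (rule total_variation_diff_le)
          show "finite_measure (walk_kernel (\<theta>' n) z)" "finite_measure (\<theta>' n (snd z))"
            "sets (\<theta>' n (snd z)) = sets (walk_kernel (\<theta>' n) z)"
            using a b by (auto simp: z prob_space.finite_measure)
          fix A assume "A \<in> sets (walk_kernel (\<theta>' n) z)"
          then have A: "A \<in> sets borel" using a by simp
          let ?S = "\<lambda>\<nu>. \<Sum>k<Suc n. measure (markov_iter (\<lambda>g. p (g, x)) k \<nu>) A"
          have "\<bar>measure (walk_kernel (\<theta>' n) z) A - measure (\<theta>' n (snd z)) A\<bar> = \<bar>?S ?w - ?S (\<theta> x)\<bar> / real (Suc n)"
            unfolding z snd_conv walk_kernel_def[of "\<theta>' n"] fst_conv left[OF A] right[OF A]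
            by (simp only: diff_divide_distrib[symmetric] abs_divide abs_of_nat)
          also have "\<dots> \<le> r / 3"
            using N[of "Suc n" A] A that by (simp add: pos_divide_le_eq)
          finally show "\<bar>measure (walk_kernel (\<theta>' n) z) A - measure (\<theta>' n (snd z)) A\<bar> \<le> r / 3" .
        qed
        then show ?thesis
          using TV_bounds(1)[OF \<theta>'_map[of n] zs] \<open>0 < r\<close> by simp
      qed
      then show "\<exists>no. \<forall>n\<ge>no. norm (TV (\<theta>' n) z - 0) < r" by blast
    qed
  qed
  then show ?thesis by (rule amenableI[OF \<theta>'_map])
qed

end

section \<open>Amenability implies triviality of the tail boundary\<close>

context haar_action
begin

text \<open>The operators \<open>Q n\<close> of \<open>letter_mixture\<close> for all environments
  at once: \<open>x\<close> is carried along as a parameter, so that the types can be chosen by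
  integrals over the product.\<close>

definition mixture_op ::
    "(nat \<Rightarrow> 'g \<times> 'x \<Rightarrow> 'g measure) \<Rightarrow> nat \<Rightarrow> ('g \<times> 'x \<Rightarrow> ennreal) \<Rightarrow> 'g \<times> 'x \<Rightarrow> ennreal" where
  "mixture_op p n u z = (\<Sum>i<n. ennreal ((1/2) ^ Suc i) * (\<integral>\<^sup>+h. u (h, snd z) \<partial>p i z))"

lemma mixture_op_summand_meas:
  assumes p: "p \<in> borel \<Otimes>\<^sub>M \<kappa> \<rightarrow>\<^sub>M prob_algebra borel" and u[measurable]: "u \<in> borel_measurable (borel \<Otimes>\<^sub>M \<kappa>)"
  shows "(\<lambda>z. \<integral>\<^sup>+h. u (h, snd z) \<partial>p z) \<in> borel_measurable (borel \<Otimes>\<^sub>M \<kappa>)"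
proof (rule nn_integral_measurable_subprob_algebra2[OF _ measurable_prob_algebraD[OF p]])
  show "(\<lambda>(z, h). u (h, snd z)) \<in> borel_measurable ((borel \<Otimes>\<^sub>M \<kappa>) \<Otimes>\<^sub>M borel)"
    by measurable
qed

lemma mixture_op_meas:
  assumes p: "\<And>i. p i \<in> borel \<Otimes>\<^sub>M \<kappa> \<rightarrow>\<^sub>M prob_algebra borel" and u: "u \<in> borel_measurable (borel \<Otimes>\<^sub>M \<kappa>)"
  shows "mixture_op p n u \<in> borel_measurable (borel \<Otimes>\<^sub>M \<kappa>)"
  unfolding mixture_op_def[abs_def] using mixture_op_summand_meas[OF p u] by measurable

text \<open>The operator integrates the group variable against absolutely continuous laws, so
  convergence for almost every \<open>h\<close> is enough for dominated convergence; the bound 2 is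
  that of the total variation of two probability measures.\<close>

lemma mixture_op_tendsto_0:
  assumes p: "\<And>i. kernel_version (\<theta> i) (p i)"
    and u: "\<And>r. u r \<in> borel_measurable (borel \<Otimes>\<^sub>M \<kappa>)" "\<And>r z. z \<in> space (\<mu> \<Otimes>\<^sub>M \<kappa>) \<Longrightarrow> u r z \<le> 2"
    and lim: "AE z in \<mu> \<Otimes>\<^sub>M \<kappa>. (\<lambda>r. u r z) \<longlonglongrightarrow> 0"
  shows "AE z in \<mu> \<Otimes>\<^sub>M \<kappa>. (\<lambda>r::nat. mixture_op p n (u r) z) \<longlonglongrightarrow> 0"
  using AE_snd[OF AE_pair_sections[OF lim]] AE_space
proof eventually_elim
  case (elim z)
  obtain g x where z: "z = (g, x)" by (cases z)
  have x: "x \<in> space \<kappa>" using elim(2) by (simp add: z space_pair)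
  have AEx: "AE h in \<mu>. (\<lambda>r. u r (h, x)) \<longlonglongrightarrow> 0" using elim(1) by (simp add: z)
  have int: "(\<lambda>r. \<integral>\<^sup>+h. u r (h, x) \<partial>p i z) \<longlonglongrightarrow> 0" for i
  proof -
    note pi = ac_prob_measuresD[OF kernel_version_section(2)[OF p[of i] x, of g], folded z]
    have "(\<lambda>r. \<integral>\<^sup>+h. u r (h, x) \<partial>p i z) \<longlonglongrightarrow> (\<integral>\<^sup>+h. 0 \<partial>p i z)"
    proof (rule nn_integral_dominated_convergence[where w = "\<lambda>_. 2"])
      show "(\<lambda>h. u r (h, x)) \<in> borel_measurable (p i z)" for r
        using measurable_compose[OF measurable_Pair2'[OF x] u(1)[of r]]
        by (simp add: measurable_cong_sets[OF pi(2) refl])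
      show "AE h in p i z. u r (h, x) \<le> 2" for r
        using u(2) x by (intro AE_I2) (simp add: space_pair)
      show "AE h in p i z. (\<lambda>r. u r (h, x)) \<longlonglongrightarrow> 0"
        using pi(2) sets_\<mu> by (intro absolutely_continuous_AE[OF _ pi(3) AEx]) simp
      show "(\<integral>\<^sup>+h. 2 \<partial>p i z) < \<infinity>"
        by (simp add: prob_space.emeasure_space_1[OF pi(1)])
    qed simp_all
    then show ?thesis by simp
  qed
  have "(\<lambda>r. ennreal ((1/2) ^ Suc i) * (\<integral>\<^sup>+h. u r (h, x) \<partial>p i z)) \<longlonglongrightarrow> ennreal ((1/2) ^ Suc i) * 0" for i
    by (rule ennreal_tendsto_cmult[OF _ int]) simp
  then have "(\<lambda>r. \<Sum>i<n. ennreal ((1/2) ^ Suc i) * (\<integral>\<^sup>+h. u r (h, x) \<partial>p i z)) \<longlonglongrightarrow> (\<Sum>i<n. 0)"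
    by (intro tendsto_sum) (simp only: mult_zero_right)
  then show ?case by (simp add: mixture_op_def z)
qed

lemma mixture_op_le:
  assumes p: "\<And>i. kernel_version (\<theta> i) (p i)"
    and u: "\<And>z. z \<in> space (\<mu> \<Otimes>\<^sub>M \<kappa>) \<Longrightarrow> u z \<le> 2" and z: "z \<in> space (\<mu> \<Otimes>\<^sub>M \<kappa>)"
  shows "mixture_op p n u z \<le> 2"
proof -
  obtain g x where gx: "z = (g, x)" by (cases z)
  have x: "x \<in> space \<kappa>" using z by (simp add: gx space_pair)
  have "(\<integral>\<^sup>+h. u (h, x) \<partial>p i z) \<le> 2" for i
  proof -
    note pi = ac_prob_measuresD[OF kernel_version_section(2)[OF p[of i] x, of g], folded gx]
    have "(\<integral>\<^sup>+h. u (h, x) \<partial>p i z) \<le> (\<integral>\<^sup>+h. 2 \<partial>p i z)"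
      using u x by (intro nn_integral_mono) (simp add: space_pair)
    then show ?thesis by (simp add: prob_space.emeasure_space_1[OF pi(1)])
  qed
  then have "mixture_op p n u z \<le> (\<Sum>i<n. ennreal ((1/2) ^ Suc i) * 2)"
    unfolding mixture_op_def gx snd_conv by (intro sum_mono mult_left_mono) simp_all
  also have "\<dots> = ennreal (\<Sum>i<n. (1/2) ^ Suc i * 2)"
    by (subst sum_ennreal[symmetric]) (auto simp: ennreal_mult' simp del: power_Suc)
  also have "(\<Sum>i<n. (1/2) ^ Suc i * 2) = (2 - 2 * (1/2) ^ n :: real)"
    by (induction n) simp_all
  also have "ennreal \<dots> \<le> ennreal 2" by (rule ennreal_leI) simp
  finally show ?thesis by simp
qed

text \<open>
  The integral with the positive weight \<open>h\<close> quantifies almost everywhere convergence, so that the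
  types can be chosen inductively with summable errors.
\<close>

lemma ex_next_type:
  assumes p: "\<And>i. kernel_version (\<theta> i) (p i)"
    and D: "\<And>r. D r \<in> borel_measurable (borel \<Otimes>\<^sub>M \<kappa>)" "\<And>r z. z \<in> space (\<mu> \<Otimes>\<^sub>M \<kappa>) \<Longrightarrow> D r z \<le> 2"
    and lim: "AE z in \<mu> \<Otimes>\<^sub>M \<kappa>. (\<lambda>r::nat. D r z) \<longlonglongrightarrow> 0"
    and h: "h \<in> borel_measurable (\<mu> \<Otimes>\<^sub>M \<kappa>)" "integral\<^sup>N (\<mu> \<Otimes>\<^sub>M \<kappa>) h < \<infinity>" and \<epsilon>: "0 < (\<epsilon>::real)"
  shows "\<exists>r. (\<integral>\<^sup>+z. (\<Sum>j<m. (mixture_op p n ^^ j) (D r) z) * h z \<partial>(\<mu> \<Otimes>\<^sub>M \<kappa>)) \<le> ennreal \<epsilon>"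
proof -
  have pm: "p i \<in> borel \<Otimes>\<^sub>M \<kappa> \<rightarrow>\<^sub>M prob_algebra borel" for i
    using p by (simp add: kernel_version_def)
  let ?u = "\<lambda>j r. (mixture_op p n ^^ j) (D r)"
  have u: "(\<forall>r. ?u j r \<in> borel_measurable (borel \<Otimes>\<^sub>M \<kappa>)) \<and> (\<forall>r. \<forall>z\<in>space (\<mu> \<Otimes>\<^sub>M \<kappa>). ?u j r z \<le> 2) \<and>
      (AE z in \<mu> \<Otimes>\<^sub>M \<kappa>. (\<lambda>r. ?u j r z) \<longlonglongrightarrow> 0)" for j
  proof (induction j)
    case (Suc j)
    then have IH: "\<And>r. ?u j r \<in> borel_measurable (borel \<Otimes>\<^sub>M \<kappa>)"
      "\<And>r z. z \<in> space (\<mu> \<Otimes>\<^sub>M \<kappa>) \<Longrightarrow> ?u j r z \<le> 2"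
      "AE z in \<mu> \<Otimes>\<^sub>M \<kappa>. (\<lambda>r. ?u j r z) \<longlonglongrightarrow> 0" by auto
    show ?case
      using mixture_op_meas[OF pm IH(1)] mixture_op_le[OF p IH(2)] mixture_op_tendsto_0[OF p IH]
      by simp
  qed (use D lim in simp)
  have um[measurable]: "?u j r \<in> borel_measurable (\<mu> \<Otimes>\<^sub>M \<kappa>)" for j r
    using u[of j] by (simp add: measurable_cong_sets[OF sets_pair refl])
  note h(1)[measurable]
  have "(\<lambda>r. \<integral>\<^sup>+z. (\<Sum>j<m. ?u j r z) * h z \<partial>(\<mu> \<Otimes>\<^sub>M \<kappa>)) \<longlonglongrightarrow> (\<integral>\<^sup>+z. 0 \<partial>(\<mu> \<Otimes>\<^sub>M \<kappa>))"
  proof (rule nn_integral_dominated_convergence[where w = "\<lambda>z. ennreal (2 * real m) * h z"])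
    show "(\<lambda>z. (\<Sum>j<m. ?u j r z) * h z) \<in> borel_measurable (\<mu> \<Otimes>\<^sub>M \<kappa>)" for r by measurable
    show "(\<integral>\<^sup>+z. ennreal (2 * real m) * h z \<partial>(\<mu> \<Otimes>\<^sub>M \<kappa>)) < \<infinity>"
      using h(2) by (simp add: nn_integral_cmult ennreal_mult_less_top)
    show "AE z in \<mu> \<Otimes>\<^sub>M \<kappa>. (\<Sum>j<m. ?u j r z) * h z \<le> ennreal (2 * real m) * h z" for r
    proof (rule AE_I2)
      fix z assume z: "z \<in> space (\<mu> \<Otimes>\<^sub>M \<kappa>)"
      have "(\<Sum>j<m. ?u j r z) \<le> (\<Sum>j<m. 2)"
        using u z by (intro sum_mono) blast
      also have "(\<Sum>j<m. 2::ennreal) = ennreal (2 * real m)"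
        by (simp add: ennreal_mult' ennreal_of_nat_eq_real_of_nat mult.commute)
      finally show "(\<Sum>j<m. ?u j r z) * h z \<le> ennreal (2 * real m) * h z"
        by (rule mult_right_mono) simp
    qed
    have "AE z in \<mu> \<Otimes>\<^sub>M \<kappa>. h z \<noteq> \<infinity>"
      using h by (intro nn_integral_PInf_AE) auto
    moreover have "AE z in \<mu> \<Otimes>\<^sub>M \<kappa>. \<forall>j. (\<lambda>r. ?u j r z) \<longlonglongrightarrow> 0"
      unfolding AE_all_countable using u by blast
    ultimately show "AE z in \<mu> \<Otimes>\<^sub>M \<kappa>. (\<lambda>r. (\<Sum>j<m. ?u j r z) * h z) \<longlonglongrightarrow> 0"
    proof eventually_elim
      case (elim z)
      have "(\<lambda>r. \<Sum>j<m. ?u j r z) \<longlonglongrightarrow> (\<Sum>j<m. 0)"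
        using elim(2) by (intro tendsto_sum) blast
      then have "(\<lambda>r. h z * (\<Sum>j<m. ?u j r z)) \<longlonglongrightarrow> h z * 0"
        using elim(1) by (intro ennreal_tendsto_cmult) (simp_all add: less_top)
      then show ?case by (simp add: mult.commute)
    qed
  qed simp_all
  then have "eventually (\<lambda>r. (\<integral>\<^sup>+z. (\<Sum>j<m. ?u j r z) * h z \<partial>(\<mu> \<Otimes>\<^sub>M \<kappa>)) < ennreal \<epsilon>) sequentially"
    by (rule order_tendstoD(2)) (use \<epsilon> in simp)
  then obtain r where "(\<integral>\<^sup>+z. (\<Sum>j<m. ?u j r z) * h z \<partial>(\<mu> \<Otimes>\<^sub>M \<kappa>)) < ennreal \<epsilon>"
    using eventually_happens'[OF sequentially_bot] by blast
  then show ?thesis by (intro exI[of _ r]) simp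
qed

text \<open>Its weights are the \<open>(1/2) ^ Suc i\<close> of
  \<open>letter_mixture\<close>.\<close>

definition type_pmf :: "nat pmf" where "type_pmf = geometric_pmf (1/2)"

lemma nn_integral_pmf_mix_type:
  assumes q: "\<And>k. q k \<in> ac_prob_measures \<mu>" and f: "f \<in> borel_measurable borel"
  shows "(\<integral>\<^sup>+h. f h \<partial>pmf_mix type_pmf q) = (\<Sum>i. ennreal ((1/2) ^ Suc i) * (\<integral>\<^sup>+h. f h \<partial>q i))"
proof -
  have qm: "q \<in> measure_pmf type_pmf \<rightarrow>\<^sub>M subprob_algebra borel"
    using ac_prob_measuresD[OF q] by (auto simp: space_subprob_algebra intro: prob_space_imp_subprob_space)
  have "(\<integral>\<^sup>+h. f h \<partial>pmf_mix type_pmf q) = (\<integral>\<^sup>+k. \<integral>\<^sup>+h. f h \<partial>q k \<partial>measure_pmf type_pmf)"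
    unfolding pmf_mix_def by (rule nn_integral_bind[OF f qm])
  also have "\<dots> = (\<Sum>i. ennreal (pmf type_pmf i) * (\<integral>\<^sup>+h. f h \<partial>q i))"
    by (simp add: nn_integral_measure_pmf nn_integral_count_space_nat)
  finally show ?thesis
    by (simp add: type_pmf_def)
qed

lemma kernel_version_pmf_mix:
  assumes \<theta>: "\<And>i. measurable_ac_prob_map \<mu> \<kappa> (\<theta> i)" and p: "\<And>i. kernel_version (\<theta> i) (p i)"
  shows "kernel_version (\<lambda>x. pmf_mix \<tau> (\<lambda>i. \<theta> i x)) (\<lambda>z. pmf_mix \<tau> (\<lambda>i. p i z))"
  unfolding kernel_version_def
proof (intro conjI ballI)
  show "(\<lambda>z. pmf_mix \<tau> (\<lambda>i. p i z)) \<in> borel \<Otimes>\<^sub>M \<kappa> \<rightarrow>\<^sub>M prob_algebra borel"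
    using p by (intro measurable_pmf_mix) (simp add: kernel_version_def)
  show "pmf_mix \<tau> (\<lambda>i. p i z) \<in> ac_prob_measures \<mu>" if "z \<in> space (\<mu> \<Otimes>\<^sub>M \<kappa>)" for z
    using p that by (intro pmf_mix_ac) (simp add: kernel_version_def)
  have "AE z in \<mu> \<Otimes>\<^sub>M \<kappa>. \<forall>i. p i z = walk_kernel (\<theta> i) z"
    unfolding AE_all_countable using p by (simp add: kernel_version_def)
  then show "AE z in \<mu> \<Otimes>\<^sub>M \<kappa>. pmf_mix \<tau> (\<lambda>i. p i z) = walk_kernel (\<lambda>x. pmf_mix \<tau> (\<lambda>i. \<theta> i x)) z"
    using AE_space
  proof eventually_elim
    case (elim z)
    let ?y = "act (- fst z) (snd z)"
    have "\<theta> i ?y \<in> ac_prob_measures \<mu>" for i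
      using \<theta>[of i] space_inverse_action[OF elim(2)] by (simp add: measurable_ac_prob_map_def)
    note a = ac_prob_measuresD[OF this]
    have "\<theta> i ?y \<in> space (subprob_algebra borel)" for i
      using a(1,2)[of i] by (simp add: space_subprob_algebra prob_space_imp_subprob_space)
    then have m: "(\<lambda>i. \<theta> i ?y) \<in> measure_pmf \<tau> \<rightarrow>\<^sub>M subprob_algebra borel"
      by simp
    have "walk_kernel (\<lambda>x. pmf_mix \<tau> (\<lambda>i. \<theta> i x)) z = measure_pmf \<tau> \<bind> (\<lambda>i. walk_kernel (\<theta> i) z)"
      unfolding walk_kernel_def translate_measure_def pmf_mix_def
      by (rule distr_bind[OF m _ measurable_left_translation[OF lc haar]]) simp
    then show ?case using elim(1) by (simp add: pmf_mix_def)
  qed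
qed

lemma mixture_op_section:
  assumes "\<And>n f g. q n f g = (\<Sum>i<n. ennreal ((1/2) ^ Suc i) * (\<integral>\<^sup>+h. f h \<partial>p i (g, x)))"
  shows "(mixture_op p n ^^ j) u (g, x) = (q n ^^ j) (\<lambda>g. u (g, x)) g"
proof (induction j arbitrary: g)
  case (Suc j)
  let ?v = "(mixture_op p n ^^ j) u" and ?w = "(q n ^^ j) (\<lambda>g. u (g, x))"
  have "(mixture_op p n ^^ Suc j) u (g, x) =
      (\<Sum>i<n. ennreal ((1/2) ^ Suc i) * (\<integral>\<^sup>+h. ?v (h, x) \<partial>p i (g, x)))"
    by (simp add: mixture_op_def[of p n ?v])
  also have "\<dots> = (\<Sum>i<n. ennreal ((1/2) ^ Suc i) * (\<integral>\<^sup>+h. ?w h \<partial>p i (g, x)))"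
    by (simp only: Suc)
  also have "\<dots> = (q n ^^ Suc j) (\<lambda>g. u (g, x)) g"
    by (simp add: assms[of n ?w])
  finally show ?case .
qed simp

lemma amenable_imp_trivial_tail:
  assumes "amenable_action \<mu> \<kappa> act"
  shows "\<exists>\<theta>. measurable_ac_prob_map \<mu> \<kappa> \<theta> \<and>
    (AE x in \<kappa>. trivial_tail_boundary \<mu> (random_walk_transition (environment act \<theta> x)))"
proof -
  obtain \<theta> :: "nat \<Rightarrow> 'x \<Rightarrow> 'g measure" where \<theta>: "\<And>n. measurable_ac_prob_map \<mu> \<kappa> (\<theta> n)"
    and lim: "AE z in \<mu> \<Otimes>\<^sub>M \<kappa>. (\<lambda>n. TV (\<theta> n) z) \<longlonglongrightarrow> 0"
    by (rule amenableE[OF assms]) (rule that)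
  have "\<forall>n. \<exists>p. kernel_version (\<theta> n) p" using ex_kernel_version[OF \<theta>] by blast
  then obtain p where p: "\<And>n. kernel_version (\<theta> n) (p n)" by metis
  have \<theta>m: "\<theta> n \<in> \<kappa> \<rightarrow>\<^sub>M prob_algebra borel" and \<theta>ac: "\<And>x. x \<in> space \<kappa> \<Longrightarrow> \<theta> n x \<in> ac_prob_measures \<mu>" for n
    using \<theta>[of n] by (simp_all add: measurable_ac_prob_map_iff)
  have pm: "p n \<in> borel \<Otimes>\<^sub>M \<kappa> \<rightarrow>\<^sub>M prob_algebra borel"
    and pac: "\<And>z. z \<in> space (\<mu> \<Otimes>\<^sub>M \<kappa>) \<Longrightarrow> p n z \<in> ac_prob_measures \<mu>" for n
    using p[of n] by (simp_all add: kernel_version_def)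
  define D where "D n z = ennreal (total_variation_diff (p n z) (\<theta> n (snd z)))" for n z
  have "(\<lambda>z. total_variation_diff (p n z) (\<theta> n (snd z))) \<in> borel_measurable (borel \<Otimes>\<^sub>M \<kappa>)" for n
    by (intro borel_measurable_total_variation_diff pm measurable_compose[OF measurable_snd \<theta>m])
  then have D_meas: "D n \<in> borel_measurable (borel \<Otimes>\<^sub>M \<kappa>)" for n
    unfolding D_def[abs_def] by (rule measurable_compose[OF _ measurable_ennreal])
  have D_le: "D n z \<le> 2" if z: "z \<in> space (\<mu> \<Otimes>\<^sub>M \<kappa>)" for n z
  proof -
    have "snd z \<in> space \<kappa>" using z by (auto simp: space_pair)
    note a = ac_prob_measuresD[OF pac[OF z, of n]] and b = ac_prob_measuresD[OF \<theta>ac[OF this, of n]]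
    have "total_variation_diff (p n z) (\<theta> n (snd z)) \<le> 2"
      using a b by (intro total_variation_diff_le_2) simp_all
    then have "D n z \<le> ennreal 2" unfolding D_def by (rule ennreal_leI)
    then show ?thesis by simp
  qed
  have D_lim: "AE z in \<mu> \<Otimes>\<^sub>M \<kappa>. (\<lambda>n. D n z) \<longlonglongrightarrow> 0"
  proof -
    have "AE z in \<mu> \<Otimes>\<^sub>M \<kappa>. \<forall>n. p n z = walk_kernel (\<theta> n) z"
      unfolding AE_all_countable using p by (simp add: kernel_version_def)
    then show ?thesis
      using lim
    proof eventually_elim
      case (elim z)
      have "(\<lambda>n. D n z) = (\<lambda>n. ennreal (TV (\<theta> n) z))"
        using elim(1) by (simp add: D_def TV_def)
      with tendsto_ennrealI[OF elim(2)] show ?case by simp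
    qed
  qed
  obtain h where h: "h \<in> borel_measurable (\<mu> \<Otimes>\<^sub>M \<kappa>)" "integral\<^sup>N (\<mu> \<Otimes>\<^sub>M \<kappa>) h \<noteq> \<infinity>"
    "\<And>z. z \<in> space (\<mu> \<Otimes>\<^sub>M \<kappa>) \<Longrightarrow> 0 < h z \<and> h z < \<infinity>"
    using P.Ex_finite_integrable_function by blast
  note h(1)[measurable]
  define J where "J s n r z = (\<Sum>j<n * 2 ^ n. (mixture_op (\<lambda>i. p (s i)) n ^^ j) (D r) z)" for s :: "nat \<Rightarrow> nat" and n r z
  have "\<exists>s. \<forall>n. (\<integral>\<^sup>+z. J s n (s n) z * h z \<partial>(\<mu> \<Otimes>\<^sub>M \<kappa>)) \<le> ennreal ((1/2) ^ n)"
  \<comment> \<open>\<open>J s n r\<close> depends on \<open>s\<close> only through its values below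
    \<open>n\<close>, so the type \<open>s n\<close> can be chosen after the preceding ones.\<close>
  proof (rule dependent_wellorder_choice)
    fix r :: nat and f g :: "nat \<Rightarrow> nat" and n assume "\<And>y. y < n \<Longrightarrow> f y = g y"
    then have "mixture_op (\<lambda>i. p (f i)) n = mixture_op (\<lambda>i. p (g i)) n"
      by (simp add: fun_eq_iff mixture_op_def)
    then show "((\<integral>\<^sup>+z. J f n r z * h z \<partial>(\<mu> \<Otimes>\<^sub>M \<kappa>)) \<le> ennreal ((1/2) ^ n)) =
        ((\<integral>\<^sup>+z. J g n r z * h z \<partial>(\<mu> \<Otimes>\<^sub>M \<kappa>)) \<le> ennreal ((1/2) ^ n))"
      by (simp add: J_def)
  next
    fix n and f :: "nat \<Rightarrow> nat"
    show "\<exists>r. (\<integral>\<^sup>+z. J f n r z * h z \<partial>(\<mu> \<Otimes>\<^sub>M \<kappa>)) \<le> ennreal ((1/2) ^ n)"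
      unfolding J_def
      by (rule ex_next_type[where \<theta> = "\<lambda>i. \<theta> (f i)"])
        (use p D_meas D_le D_lim h in \<open>auto simp: less_top[symmetric]\<close>)
  qed
  then obtain s where s: "\<And>n. (\<integral>\<^sup>+z. J s n (s n) z * h z \<partial>(\<mu> \<Otimes>\<^sub>M \<kappa>)) \<le> ennreal ((1/2) ^ n)"
    by blast
  let ?p = "\<lambda>i. p (s i)"
  have pow_meas: "(mixture_op ?p n ^^ j) (D r) \<in> borel_measurable (borel \<Otimes>\<^sub>M \<kappa>)" for n j r
    by (induction j) (use D_meas mixture_op_meas[OF pm] in auto)
  have J_meas[measurable]: "J s n r \<in> borel_measurable (\<mu> \<Otimes>\<^sub>M \<kappa>)" for n r
    unfolding J_def[abs_def] measurable_cong_sets[OF sets_pair refl]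
    by (intro borel_measurable_sum pow_meas)
  \<comment> \<open>The weighted integrals are summable and \<open>h\<close> is positive, so the
    series of costs is finite almost everywhere.\<close>
  have J_fin: "AE z in \<mu> \<Otimes>\<^sub>M \<kappa>. (\<Sum>n. J s n (s n) z) < \<infinity>"
  proof -
    have "(\<integral>\<^sup>+z. (\<Sum>n. J s n (s n) z * h z) \<partial>(\<mu> \<Otimes>\<^sub>M \<kappa>)) = (\<Sum>n. \<integral>\<^sup>+z. J s n (s n) z * h z \<partial>(\<mu> \<Otimes>\<^sub>M \<kappa>))"
      by (rule nn_integral_suminf) measurable
    also have "\<dots> \<le> (\<Sum>n. ennreal ((1/2) ^ n))"
      by (intro suminf_le s) auto
    also have "\<dots> = ennreal (\<Sum>n. (1/2) ^ n)"
      by (rule suminf_ennreal2) (auto intro: summable_geometric)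
    also have "\<dots> < \<infinity>" by simp
    finally have "AE z in \<mu> \<Otimes>\<^sub>M \<kappa>. (\<Sum>n. J s n (s n) z * h z) \<noteq> \<infinity>"
      by (intro nn_integral_PInf_AE) (auto simp: less_top[symmetric])
    then show ?thesis
      using AE_space
    proof eventually_elim
      case (elim z)
      have "(\<Sum>n. J s n (s n) z * h z) = (\<Sum>n. J s n (s n) z) * h z" by simp
      with elim(1) h(3)[OF elim(2)] show ?case
        by (auto simp: less_top ennreal_mult_eq_top_iff)
    qed
  qed
  let ?\<theta> = "\<lambda>x. pmf_mix type_pmf (\<lambda>i. \<theta> (s i) x)" and ?q = "\<lambda>z. pmf_mix type_pmf (\<lambda>i. p (s i) z)"
  have \<theta>_map: "measurable_ac_prob_map \<mu> \<kappa> ?\<theta>"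
    unfolding measurable_ac_prob_map_iff by (intro conjI ballI measurable_pmf_mix pmf_mix_ac \<theta>m \<theta>ac)
  have q: "kernel_version ?\<theta> ?q"
    by (rule kernel_version_pmf_mix[OF \<theta> p])
  have "AE x in \<kappa>. trivial_tail_boundary \<mu> (random_walk_transition (environment act ?\<theta> x))"
    using AE_version_good[OF q] AE_pair_sections[OF J_fin]
  proof eventually_elim
    case (elim x)
    have x: "x \<in> space \<kappa>" using elim(1) by (simp add: version_good_def)
    obtain K where K: "is_markov_law (\<lambda>g. ?q (g, x)) K"
      using ex_markov_law[OF kernel_version_section(1)[OF q x]] by blast
    interpret V: markov_version \<mu> "\<lambda>g. ?q (g, x)" "random_walk_transition (environment act ?\<theta> x)" K
      by (rule markov_version_section[OF \<theta>_map q elim(1) K])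
    interpret L: letter_mixture "\<lambda>i g. p (s i) (g, x)" "\<lambda>i. \<theta> (s i) x" "\<lambda>i g. D (s i) (g, x)" "\<lambda>g. ?q (g, x)"
    proof
      fix i g
      show "(\<lambda>g. p (s i) (g, x)) \<in> borel \<rightarrow>\<^sub>M prob_algebra borel"
        by (rule kernel_version_section(1)[OF p x])
      show "(\<lambda>g. D (s i) (g, x)) \<in> borel_measurable borel"
        by (rule measurable_compose[OF measurable_Pair2'[OF x] D_meas])
      note a = ac_prob_measuresD[OF kernel_version_section(2)[OF p x, of "s i" g]]
        and b = ac_prob_measuresD[OF \<theta>ac[OF x, of "s i"]]
      have sets: "sets (\<theta> (s i) x) = sets (p (s i) (g, x))" using a b by simp
      fix u :: "'g \<Rightarrow> ennreal" assume u: "u \<in> borel_measurable borel" "\<And>h. u h \<le> 1"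
      show "(\<integral>\<^sup>+h. u h \<partial>p (s i) (g, x)) \<le> (\<integral>\<^sup>+h. u h \<partial>\<theta> (s i) x) + D (s i) (g, x)"
        using nn_integral_le_total_variation[OF a(1) b(1) sets u(2)] by (simp add: D_def)
      show "(\<integral>\<^sup>+h. u h \<partial>\<theta> (s i) x) \<le> (\<integral>\<^sup>+h. u h \<partial>p (s i) (g, x)) + D (s i) (g, x)"
        using nn_integral_le_total_variation[OF b(1) a(1) sets[symmetric] u(2)]
        by (simp add: D_def total_variation_diff_commute[OF sets])
    next
      fix f :: "'g \<Rightarrow> ennreal" and g :: 'g assume f: "f \<in> borel_measurable borel"
      show "kernel_op (\<lambda>g. ?q (g, x)) f g = (\<Sum>i. ennreal ((1/2) ^ Suc i) * (\<integral>\<^sup>+h. f h \<partial>p (s i) (g, x)))"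
        unfolding kernel_op_def
        by (rule nn_integral_pmf_mix_type[OF kernel_version_section(2)[OF p x] f])
    qed
    \<comment> \<open>The costs for a fixed \<open>x\<close> are sections of those controlled on the
      product, hence almost every \<open>g\<close> is a good starting point.\<close>
    have LJ: "L.J n g = J s n (s n) (g, x)" for n g
      unfolding L.J_def L.K_def J_def
      by (intro sum.cong refl mixture_op_section[symmetric]) (simp add: L.Q_def L.t_def)
    show ?case
    proof (rule V.trivial_tail_boundaryI[where G = "{g. (\<Sum>n. L.J n g) < \<infinity>}"])
      show "AE g in \<mu>. g \<in> {g. (\<Sum>n. L.J n g) < \<infinity>}"
        using elim(2) unfolding LJ by simp
      show "\<exists>k. \<forall>f\<in>borel_measurable borel. (\<forall>h. f h \<le> 1) \<longrightarrow>
          (kernel_op (\<lambda>g. ?q (g, x)) ^^ k) f g \<le> (kernel_op (\<lambda>g. ?q (g, x)) ^^ k) f g' + ennreal \<epsilon>"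
        if "g \<in> {g. (\<Sum>n. L.J n g) < \<infinity>}" "g' \<in> {g. (\<Sum>n. L.J n g) < \<infinity>}" "0 < \<epsilon>" for g g' and \<epsilon> :: real
        using L.mixture_oscillation[of g g' \<epsilon>] that by simp
    qed
  qed
  with \<theta>_map show ?thesis by blast
qed

end

lemma trivial_tail_imp_liouville:
  assumes "trivial_tail_boundary \<mu> \<pi>" shows "liouville_chain \<mu> \<pi>"
  using assms unfolding trivial_tail_boundary_def liouville_chain_def trivial_mod0_def exit_events_def
  by blast

theorem theorem50:
  fixes \<mu> :: "'g::{topological_group_add, second_countable_topology, t2_space} measure"
    and \<kappa> :: "'x measure"
    and act :: "'g \<Rightarrow> 'x \<Rightarrow> 'x"
  assumes "locally compact (UNIV :: 'g set)"
    and "left_haar_measure \<mu>"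
    and "lebesgue_rokhlin_space \<kappa>"
    and "measure_class_preserving_action \<mu> \<kappa> act"
  shows "(amenable_action \<mu> \<kappa> act \<longleftrightarrow>
           (\<exists>\<theta>. measurable_ac_prob_map \<mu> \<kappa> \<theta> \<and>
             (AE x in \<kappa>. trivial_tail_boundary \<mu>
                (random_walk_transition (environment act \<theta> x)))))
       \<and> (amenable_action \<mu> \<kappa> act \<longleftrightarrow>
           (\<exists>\<theta>. measurable_ac_prob_map \<mu> \<kappa> \<theta> \<and>
             (AE x in \<kappa>. liouville_chain \<mu>
                (random_walk_transition (environment act \<theta> x)))))"
proof -
  interpret haar_action \<mu> \<kappa> act
    using assms by unfold_locales (simp_all add: lebesgue_rokhlin_space_def
      sigma_finite_measure_def complete_measure_def)
  let ?T = "\<lambda>\<theta>. AE x in \<kappa>. trivial_tail_boundary \<mu> (random_walk_transition (environment act \<theta> x))"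
  let ?L = "\<lambda>\<theta>. AE x in \<kappa>. liouville_chain \<mu> (random_walk_transition (environment act \<theta> x))"
  have TL: "?T \<theta> \<Longrightarrow> ?L \<theta>" for \<theta>
    by (erule eventually_mono) (rule trivial_tail_imp_liouville)
  show ?thesis
    using amenable_imp_trivial_tail liouville_imp_amenable TL by blast
qed

end
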